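(* There are absolute constants $c>0$ and $C_0\ge1$ such that for every $n$, every symmetric norm $l$ on $\mathbb{R}^n$ and every $D\ge1$ the following holds. Any (randomized, one-pass) turnstile streaming algorithm that, for every input stream defining a vector $v\in\mathbb{Z}^n$ with $|v_i|\le n^{C_0}$ for all $i$, outputs with probability at least $0.99$ a $D$-approximation to $l(v)$, must use at least $c\cdot\mathrm{mmc}(l)^2/D^2$ bits of space in the worst case.
   Context: A norm $l:\mathbb{R}^n\to\mathbb{R}$ is symmetric if $l(Px)=l(x)$ for every permutation matrix $P$ and $l(|x|)=l(x)$, where $|x|$ is the coordinate-wise absolute value. For $k\le n$, $l^{(k)}$ is the norm on $\mathbb{R}^k$ given by $l^{(k)}(x_1,\dots,x_k)=l(x_1,\dots,x_k,0,\dots,0)$. For a norm $l$ on $\mathbb{R}^k$, $\mathfrak{b}_l=\max\{l(x):x\in S^{k-1}\}$, where $S^{k-1}$ is the $\ell_2$ unit sphere, and $\mathrm{M}_l$ is the (unique) median of $l(X)$ for $X$ uniform on $S^{k-1}$, i.e. $\Pr[l(X)\ge \mathrm{M}_l]\ge 1/2$ and $\Pr[l(X)\le \mathrm{M}_l]\ge 1/2$. $\mathrm{mc}(l)=\mathfrak{b}_l/\mathrm{M}_l$ and $\mathrm{mmc}(l)=\max_{1\le k\le n}\mathrm{mc}(l^{(k)})$. Turnstile streaming model: the stream is a sequence of updates $(i,\pm1)$, $i\in[n]$; each update adds $\pm1$ to coordinate $i$ of a vector $v$ that starts at $0$, and the algorithm must output an answer about the final $v$. Coordinates of $v$ are assumed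 bounded in absolute value by $\mathrm{poly}(n)$. The algorithm is randomized, reads the stream once, and its space is the number of bits of working memory (the state carried from one update to the next). For $D\ge1$, a $D$-approximation to $l(v)$ is a value $\hat l$ with $l(v)\le\hat l\le D\,l(v)$. *)

theory Defs
  imports "HOL-Probability.Probability" "HOL-Combinatorics.Combinatorics"
begin

text \<open>
  Vectors of \<open>\<real>\<^sup>n\<close> are functions on the index set \<open>{..<n}\<close>, i.e. elements of
  \<open>extensional {..<n}\<close>; this is also the space of \<open>Pi\<^sub>M {..<n} (\<lambda>_. lborel)\<close>.
  A function on \<open>\<real>\<^sup>n\<close> is a total function of which only the values on \<open>extensional {..<n}\<close> matter.
\<close>

type_synonym rvec = "nat \<Rightarrow> real"

abbreviation Rn :: "nat \<Rightarrow> rvec set" where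
  "Rn n \<equiv> extensional {..<n}"


section \<open>Symmetric norms\<close>

definition norm_on :: "nat \<Rightarrow> (rvec \<Rightarrow> real) \<Rightarrow> bool" where
  "norm_on n l \<longleftrightarrow>
     (\<forall>x\<in>Rn n. l x = 0 \<longleftrightarrow> (\<forall>i<n. x i = 0)) \<and>
     (\<forall>x\<in>Rn n. \<forall>a. l (\<lambda>i\<in>{..<n}. a * x i) = \<bar>a\<bar> * l x) \<and>
     (\<forall>x\<in>Rn n. \<forall>y\<in>Rn n. l (\<lambda>i\<in>{..<n}. x i + y i) \<le> l x + l y)"

definition symmetric_norm :: "nat \<Rightarrow> (rvec \<Rightarrow> real) \<Rightarrow> bool" where
  "symmetric_norm n l \<longleftrightarrow>
     norm_on n l \<and>
     (\<forall>x\<in>Rn n. \<forall>p. p permutes {..<n} \<longrightarrow> l (\<lambda>i\<in>{..<n}. x (p i)) = l x) \<and>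
     (\<forall>x\<in>Rn n. l (\<lambda>i\<in>{..<n}. \<bar>x i\<bar>) = l x)"

text \<open>\<open>norm_restr n l k\<close> is \<open>l\<^sup>(\<^sup>k\<^sup>)\<close>, a function on \<open>\<real>\<^sup>k\<close>, for \<open>l\<close> a norm on \<open>\<real>\<^sup>n\<close>.\<close>

definition norm_restr :: "nat \<Rightarrow> (rvec \<Rightarrow> real) \<Rightarrow> nat \<Rightarrow> rvec \<Rightarrow> real" where
  "norm_restr n l k x = l (\<lambda>i\<in>{..<n}. if i < k then x i else 0)"


section \<open>Maximum and median on the sphere\<close>

definition unit_sphere :: "nat \<Rightarrow> rvec set" where
  "unit_sphere k = {x \<in> Rn k. L2_set x {..<k} = 1}"

definition unit_ball :: "nat \<Rightarrow> rvec set" where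
  "unit_ball k = {x \<in> Rn k. L2_set x {..<k} \<le> 1}"

text \<open>
  The uniform distribution on \<open>S\<^bsup>k-1\<^esup>\<close> is the normalised cone measure: the law of
  \<open>x / \<parallel>x\<parallel>\<^sub>2\<close> for \<open>x\<close> uniform in the unit ball of \<open>\<real>\<^sup>k\<close>.  The origin, where the
  quotient is not on the sphere, is a null set (\<open>k \<ge> 1\<close>).
\<close>

definition sphere_measure :: "nat \<Rightarrow> rvec measure" where
  "sphere_measure k =
     distr (uniform_measure (Pi\<^sub>M {..<k} (\<lambda>_. lborel)) (unit_ball k)) (Pi\<^sub>M {..<k} (\<lambda>_. lborel))
       (\<lambda>x. \<lambda>i\<in>{..<k}. x i / L2_set x {..<k})"

definition max_sphere :: "nat \<Rightarrow> (rvec \<Rightarrow> real) \<Rightarrow> real" where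
  "max_sphere k l = (SUP x\<in>unit_sphere k. l x)"

definition is_median_sphere :: "nat \<Rightarrow> (rvec \<Rightarrow> real) \<Rightarrow> real \<Rightarrow> bool" where
  "is_median_sphere k l m \<longleftrightarrow>
     \<P>(x in sphere_measure k. l x \<ge> m) \<ge> 1/2 \<and> \<P>(x in sphere_measure k. l x \<le> m) \<ge> 1/2"

definition median_sphere :: "nat \<Rightarrow> (rvec \<Rightarrow> real) \<Rightarrow> real" where
  "median_sphere k l = (THE m. is_median_sphere k l m)"

definition mc :: "nat \<Rightarrow> (rvec \<Rightarrow> real) \<Rightarrow> real" where
  "mc k l = max_sphere k l / median_sphere k l"

definition mmc :: "nat \<Rightarrow> (rvec \<Rightarrow> real) \<Rightarrow> real" where
  "mmc n l = (MAX k\<in>{1..n}. mc k (norm_restr n l k))"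


section \<open>Turnstile streams and randomized streaming algorithms\<close>

type_synonym update = "nat \<times> int"

definition turnstile_streams :: "nat \<Rightarrow> update list set" where
  "turnstile_streams n = lists ({..<n} \<times> {1, -1})"

definition stream_vec :: "update list \<Rightarrow> nat \<Rightarrow> int" where
  "stream_vec \<sigma> i = (\<Sum>(j, \<delta>)\<leftarrow>\<sigma>. if j = i then \<delta> else 0)"

text \<open>
  The working memory is a bit string; it is all that is carried from one update to the next.
  Randomness is not charged: the algorithm may toss fresh coins at every step, and
  it may also consult, throughout, a read-only random string (coded as a natural number)
  drawn before the stream starts.  The maps are arbitrary, so the model is non-uniform.
\<close>

record stream_alg =
  seed :: "nat pmf"
  init_mem :: "nat \<Rightarrow> bool list pmf"
  step_mem :: "nat \<Rightarrow> bool list \<Rightarrow> update \<Rightarrow> bool list pmf"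
  answer :: "nat \<Rightarrow> bool list \<Rightarrow> real pmf"

definition memory :: "stream_alg \<Rightarrow> nat \<Rightarrow> update list \<Rightarrow> bool list pmf" where
  "memory A r \<sigma> = foldl (\<lambda>p u. bind_pmf p (\<lambda>w. step_mem A r w u)) (init_mem A r) \<sigma>"

definition alg_output :: "stream_alg \<Rightarrow> update list \<Rightarrow> real pmf" where
  "alg_output A \<sigma> = bind_pmf (seed A) (\<lambda>r. bind_pmf (memory A r \<sigma>) (answer A r))"

text \<open>
  Worst-case space at most \<open>s\<close> bits.  The set of streams is closed under prefixes, so this
  bounds the memory at every moment of every run.
\<close>

definition uses_space :: "nat \<Rightarrow> stream_alg \<Rightarrow> nat \<Rightarrow> bool" where
  "uses_space n A s \<longleftrightarrow>
     (\<forall>\<sigma>\<in>turnstile_streams n. \<forall>r\<in>set_pmf (seed A). \<forall>w\<in>set_pmf (memory A r \<sigma>). length w \<le> s)"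

definition is_approx :: "real \<Rightarrow> real \<Rightarrow> real \<Rightarrow> bool" where
  "is_approx D a b \<longleftrightarrow> a \<le> b \<and> b \<le> D * a"

definition approximates_norm ::
    "nat \<Rightarrow> (rvec \<Rightarrow> real) \<Rightarrow> real \<Rightarrow> real \<Rightarrow> stream_alg \<Rightarrow> bool" where
  "approximates_norm n l D B A \<longleftrightarrow>
     (\<forall>\<sigma>\<in>turnstile_streams n. (\<forall>i<n. \<bar>real_of_int (stream_vec \<sigma> i)\<bar> \<le> B) \<longrightarrow>
        \<P>(y in measure_pmf (alg_output A \<sigma>).
             is_approx D (l (\<lambda>i\<in>{..<n}. real_of_int (stream_vec \<sigma> i))) y) \<ge> 0.99)"

end

theory Submission
  imports Defs "HOL-Real_Asymp.Real_Asymp"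
begin

text \<open>
  Let \<open>M\<close> be the median of the norm \<open>\<nu> = l\<^sup>(\<^sup>k\<^sup>)\<close> on the sphere of \<open>\<real>\<^sup>k\<close>, where \<open>k\<close> attains \<open>mmc\<close>, and let \<open>y\<close>
  be an integer vector, with largest entry \<open>Y\<close>, proportional up to rounding to a maximiser of \<open>\<nu>\<close> on
  the sphere.  Take about \<open>N = k Y\<^sup>2 / |y|\<^sup>2\<close> randomly signed permutations of \<open>y\<close>, arranged so that in every
  coordinate their squares add up to at most \<open>2 Y\<^sup>2\<close>.  A sum of any subset of these blocks has norm
  at most \<open>T = O(Y \<surd>k M)\<close> with high probability: each coordinate of such a sum is subgaussian, hence
  dominated by a Gaussian, and for a Gaussian vector \<open>g\<close> the norm \<open>\<nu> g\<close> is \<open>O(\<surd>k M)\<close> with high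
  probability.  For the latter, \<open>g / |g|\<close> is uniform on the sphere, and \<open>g / 2\<close> is stochastically
  smaller than the coordinatewise minimum of two independent copies of \<open>g\<close>, so that doubling the
  threshold squares the probability of exceeding it.

  The stream is cut into \<open>s \<approx> D T / \<nu> y\<close> stages.  In the null distribution every block is offered in
  one random stage and inserted with probability 1/2; in the planted one a block \<open>j\<close> is offered in
  every stage, so that about \<open>s / 2\<close> copies of it make the norm exceed \<open>D T\<close>.  An algorithm with
  \<open>S\<close> bits learns at most \<open>O(S)\<close> about the blocks of a stage, so for an average block and stage the relative
  entropy between skipping and offering it is \<open>O(s S / N)\<close>, and by the chain rule that between the two
  final memories is \<open>O(s\<^sup>2 S / N)\<close>.  As the algorithm separates them, \<open>S = \<Omega>(N / s\<^sup>2)\<close>, which is of the order of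
  \<open>(\<nu> y / (|y| M D))\<^sup>2\<close>.
\<close>

section \<open>The uniform measure on the sphere as the direction of a Gaussian vector\<close>

text \<open>The norm of a Gaussian vector is needed only up to a constant factor, so no
  concentration of measure on the sphere enters: the median yields a success probability of 1/4, and
  five doublings of the threshold do the rest. A single block has norm at most a fifth of the noise
  level \<open>T\<close>, so inserting it once could not be noticed; this forces the stages, in
  which one block is repeated until it outweighs the noise. In the formal game each block
  \<open>j\<close> has its own pair of streams, and the null one omits \<open>j\<close> altogether.
  Neither stream of the pair then depends on the stage \<open>P j\<close>, which may therefore be
  set to the stage under examination; there, omitting \<open>j\<close> amounts to conditioning an
  ordinary stage on \<open>j\<close> not being chosen. This reassignment costs one factor
  \<open>s\<close> and the sum over the stages another. Relative entropy is taken from null to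
  planted because the supports are nested in that direction; the chain rule is then weighted by null
  memories, which the stages before \<open>P j\<close> cannot tell from ordinary ones.\<close>

definition gauss :: "real measure" where
  "gauss = density lborel std_normal_density"

definition gaussn :: "nat \<Rightarrow> (nat \<Rightarrow> real) measure" where
  "gaussn k = Pi\<^sub>M {..<k} (\<lambda>_. gauss)"

lemma prob_space_gauss: "prob_space gauss"
  unfolding gauss_def by (rule prob_space_normal_density) simp

lemma sets_gauss [simp, measurable_cong]: "sets gauss = sets borel"
  by (simp add: gauss_def)

lemma space_gauss [simp]: "space gauss = UNIV"
  by (simp add: gauss_def)

interpretation gauss: prob_space gauss
  by (rule prob_space_gauss)

interpretation gauss_prod: product_prob_space "\<lambda>_::nat. gauss" UNIV
  by standard

interpretation lborel_prod: product_sigma_finite "\<lambda>_::nat. (lborel :: real measure)"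
  by standard

lemma prob_space_gaussn: "prob_space (gaussn k)"
  unfolding gaussn_def by (rule prob_space_PiM) (rule prob_space_gauss)

interpretation gaussn: prob_space "gaussn k"
  by (rule prob_space_gaussn)

abbreviation (input) vborel :: "nat \<Rightarrow> (nat \<Rightarrow> real) measure" where
  "vborel k \<equiv> Pi\<^sub>M {..<k} (\<lambda>_. borel)"

lemma sets_gaussn [simp, measurable_cong]: "sets (gaussn k) = sets (vborel k)"
  unfolding gaussn_def by (rule sets_PiM_cong) auto

lemma space_gaussn [simp]: "space (gaussn k) = Rn k"
  by (simp add: gaussn_def space_PiM PiE_def)

abbreviation pborel :: "nat set \<Rightarrow> (nat \<Rightarrow> real) measure" where
  "pborel I \<equiv> Pi\<^sub>M I (\<lambda>_. borel)"

abbreviation plebesgue :: "nat set \<Rightarrow> (nat \<Rightarrow> real) measure" where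
  "plebesgue I \<equiv> Pi\<^sub>M I (\<lambda>_. lborel)"

abbreviation pgauss :: "nat set \<Rightarrow> (nat \<Rightarrow> real) measure" where
  "pgauss I \<equiv> Pi\<^sub>M I (\<lambda>_. gauss)"

lemma sets_lebesgue_prod [simp]: "sets (plebesgue I) = sets (pborel I)"
  by (rule sets_PiM_cong) auto

lemma space_lebesgue_prod [simp]: "space (plebesgue I) = extensional I"
  by (simp add: space_PiM PiE_def)

lemma borel_measurable_L2_set [measurable]:
  "(\<lambda>x. L2_set x {..<k}) \<in> borel_measurable (vborel k)"
  unfolding L2_set_def by measurable

text \<open>The product of the one-dimensional densities depends on \<open>x\<close> only through
  its Euclidean norm; this radial form is what the passage to the sphere uses.\<close>

lemma gaussn_eq_density:
  "gaussn k = density (plebesgue {..<k})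
     (\<lambda>x. ennreal ((1 / sqrt (2 * pi)) ^ k * exp (- (L2_set x {..<k})\<^sup>2 / 2)))"
proof -
  have eq: "ennreal ((1 / sqrt (2 * pi)) ^ k * exp (- (L2_set x {..<k})\<^sup>2 / 2))
      = (\<Prod>i\<in>{..<k}. ennreal (std_normal_density (x i)))" for x
  proof -
    have "(\<Prod>i\<in>{..<k}. std_normal_density (x i)) = (1 / sqrt (2 * pi)) ^ k * (\<Prod>i\<in>{..<k}. exp (- (x i)\<^sup>2 / 2))"
      by (simp only: std_normal_density_def prod.distrib prod_constant card_lessThan)
    also have "(\<Prod>i\<in>{..<k}. exp (- (x i)\<^sup>2 / 2)) = exp (- (L2_set x {..<k})\<^sup>2 / 2)"
      by (simp add: exp_sum [symmetric] L2_set_def sum_nonneg sum_divide_distrib sum_negf)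
    finally show ?thesis
      by (subst prod_ennreal) simp_all
  qed
  have [measurable]: "(\<lambda>x. ennreal ((1 / sqrt (2 * pi)) ^ k * exp (- (L2_set x {..<k})\<^sup>2 / 2)))
      \<in> borel_measurable (vborel k)" by measurable
  let ?d = "density (plebesgue {..<k}) (\<lambda>x. ennreal ((1 / sqrt (2 * pi)) ^ k *
        exp (- (L2_set x {..<k})\<^sup>2 / 2)))"
  show ?thesis
    unfolding gaussn_def
  proof (rule gauss_prod.PiM_eqI [symmetric])
    show "sets (?d) = sets (pgauss {..<k})"
      by (simp add: sets_gaussn [unfolded gaussn_def])
    fix A :: "nat \<Rightarrow> real set"
    assume A: "\<And>i. i \<in> {..<k} \<Longrightarrow> A i \<in> sets gauss"
    then have A': "Pi\<^sub>E {..<k} A \<in> sets (vborel k)"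
      by (intro sets_PiM_I_finite) auto
    have "emeasure (?d) (Pi\<^sub>E {..<k} A)
       = (\<integral>\<^sup>+x. (\<Prod>i\<in>{..<k}. ennreal (std_normal_density (x i))) * indicator (Pi\<^sub>E {..<k} A) x \<partial>plebesgue {..<k})"
      by (subst emeasure_density) (simp_all only: eq [symmetric], simp_all add: A' cong: measurable_cong_sets)
    also have "\<dots> = (\<integral>\<^sup>+x. (\<Prod>i\<in>{..<k}. ennreal (std_normal_density (x i)) * indicator (A i) (x i)) \<partial>plebesgue {..<k})"
    proof (rule nn_integral_cong)
      fix x :: "nat \<Rightarrow> real" assume "x \<in> space (plebesgue {..<k})"
      then have "(indicator (Pi\<^sub>E {..<k} A) x :: ennreal) = (\<Prod>i\<in>{..<k}. indicator (A i) (x i))"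
        by (auto simp: indicator_def PiE_def Pi_def)
      then show "(\<Prod>i\<in>{..<k}. ennreal (std_normal_density (x i))) * indicator (Pi\<^sub>E {..<k} A) x =
         (\<Prod>i\<in>{..<k}. ennreal (std_normal_density (x i)) * indicator (A i) (x i))"
        by (simp add: prod.distrib)
    qed
    also have "\<dots> = (\<Prod>i\<in>{..<k}. \<integral>\<^sup>+y. ennreal (std_normal_density y) * indicator (A i) y \<partial>lborel)"
      using A by (intro lborel_prod.product_nn_integral_prod) auto
    also have "\<dots> = (\<Prod>i\<in>{..<k}. emeasure gauss (A i))"
      using A by (intro prod.cong refl) (simp add: gauss_def emeasure_density)
    finally show "emeasure (?d) (Pi\<^sub>E {..<k} A) = (\<Prod>i\<in>{..<k}. emeasure gauss (A i))" .
  qed simp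
qed

text \<open>Fubini isolates one coordinate at a time, and the affine substitution on the line
  contributes one factor \<open>r\<close> for each.\<close>

lemma nn_integral_PiM_lborel_scale:
  fixes r :: real
  assumes r: "r > 0" and "finite I" and f: "f \<in> borel_measurable (pborel I)"
  shows "(\<integral>\<^sup>+x. f x \<partial>plebesgue I)
     = ennreal (r ^ card I) * (\<integral>\<^sup>+x. f (\<lambda>i\<in>I. r * x i) \<partial>plebesgue I)"
  using assms(2,3)
proof (induction I arbitrary: f rule: finite_induct)
  case empty
  then show ?case by (simp add: lborel_prod.nn_integral_empty)
next
  case (insert i I)
  note [measurable] = insert.prems
  have ext: "(\<lambda>j\<in>insert i I. r * (x(i := y)) j) = (\<lambda>j\<in>I. r * x j)(i := r * y)" for x :: "nat \<Rightarrow> real" and y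
    using insert.hyps by (auto simp: fun_eq_iff)
  have m: "(\<lambda>p. f ((fst p)(i := snd p))) \<in> borel_measurable (pborel I \<Otimes>\<^sub>M borel)"
    using insert.prems by measurable
  have m': "(\<lambda>x. \<integral>\<^sup>+y. f (x(i := y)) \<partial>lborel) \<in> borel_measurable (pborel I)"
    using m by measurable
  have mm: "(\<lambda>x. f (\<lambda>j\<in>insert i I. r * x j)) \<in> borel_measurable (plebesgue (insert i I))"
    by (simp cong: measurable_cong_sets)
  have "(\<integral>\<^sup>+x. f x \<partial>plebesgue (insert i I))
     = (\<integral>\<^sup>+x. (\<integral>\<^sup>+y. f (x(i := y)) \<partial>lborel) \<partial>plebesgue I)"
    using insert by (intro lborel_prod.product_nn_integral_insert) (auto cong: measurable_cong_sets)
  also have "\<dots> = ennreal (r ^ card I) * (\<integral>\<^sup>+x. (\<integral>\<^sup>+y. f ((\<lambda>j\<in>I. r * x j)(i := y)) \<partial>lborel) \<partial>plebesgue I)"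
    using m' by (rule insert.IH)
  also have "(\<integral>\<^sup>+x. (\<integral>\<^sup>+y. f ((\<lambda>j\<in>I. r * x j)(i := y)) \<partial>lborel) \<partial>plebesgue I)
    = (\<integral>\<^sup>+x. ennreal r * (\<integral>\<^sup>+y. f ((\<lambda>j\<in>I. r * x j)(i := r * y)) \<partial>lborel) \<partial>plebesgue I)"
  proof (rule nn_integral_cong)
    fix x :: "nat \<Rightarrow> real" assume x: "x \<in> space (plebesgue I)"
    have "(\<lambda>y. f ((\<lambda>j\<in>I. r * x j)(i := y))) \<in> borel_measurable borel"
      by measurable (auto simp: space_PiM)
    from nn_integral_real_affine [OF this, of r 0] r
    show "(\<integral>\<^sup>+y. f ((\<lambda>j\<in>I. r * x j)(i := y)) \<partial>lborel) = ennreal r * (\<integral>\<^sup>+y. f ((\<lambda>j\<in>I. r * x j)(i := r * y)) \<partial>lborel)"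
      by simp
  qed
  also have "\<dots> = ennreal r * (\<integral>\<^sup>+x. (\<integral>\<^sup>+y. f ((\<lambda>j\<in>I. r * x j)(i := r * y)) \<partial>lborel) \<partial>plebesgue I)"
    by (rule nn_integral_cmult) (simp cong: measurable_cong_sets)
  also have "(\<integral>\<^sup>+x. (\<integral>\<^sup>+y. f ((\<lambda>j\<in>I. r * x j)(i := r * y)) \<partial>lborel) \<partial>plebesgue I)
     = (\<integral>\<^sup>+x. f (\<lambda>j\<in>insert i I. r * x j) \<partial>plebesgue (insert i I))"
    using insert by (subst lborel_prod.product_nn_integral_insert) (auto simp only: ext cong: measurable_cong_sets intro!: mm)
  finally have "(\<integral>\<^sup>+x. f x \<partial>plebesgue (insert i I)) = ennreal (r ^ card I) * (ennreal r *
      (\<integral>\<^sup>+x. f (\<lambda>j\<in>insert i I. r * x j) \<partial>plebesgue (insert i I)))" .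
  moreover have "ennreal (r ^ card (insert i I)) = ennreal (r ^ card I) * ennreal r"
    using r insert.hyps by (simp add: ennreal_mult mult.commute)
  ultimately show ?case by (simp only: mult.assoc)
qed

text \<open>The antiderivative is \<open>- exp (- r\<^sup>2 / 2)\<close>. With \<open>t\<close> the
  norm of \<open>x\<close>, the indicator becomes that of the ball of radius \<open>r\<close>, so
  the Gaussian density is an average of ball indicators.\<close>

lemma exp_neg_square_half_layer_cake:
  assumes "t \<ge> 0"
  shows "ennreal (exp (- t\<^sup>2 / 2)) = (\<integral>\<^sup>+r. ennreal (r * exp (- r\<^sup>2 / 2)) * indicator {t..} r \<partial>lborel)"
proof -
  have lim: "((\<lambda>r::real. - exp (- r\<^sup>2 / 2)) \<longlongrightarrow> 0) at_top"
    by real_asymp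
  have "(\<integral>\<^sup>+r. ennreal (r * exp (- r\<^sup>2 / 2)) * indicator {t..} r \<partial>lborel) = ennreal (0 - (- exp (- t\<^sup>2 / 2)))"
    by (rule nn_integral_FTC_atLeast [OF _ _ _ lim])
       (use assms in \<open>auto intro!: derivative_eq_intros simp: field_simps\<close>)
  then show ?thesis by simp
qed

definition normalize_vec :: "nat \<Rightarrow> rvec \<Rightarrow> rvec" where
  "normalize_vec k x = (\<lambda>i\<in>{..<k}. x i / L2_set x {..<k})"

lemma measurable_normalize_vec [measurable]:
  "normalize_vec k \<in> vborel k \<rightarrow>\<^sub>M vborel k"
  unfolding normalize_vec_def by measurable

lemma L2_set_scale: "r \<ge> 0 \<Longrightarrow> L2_set (\<lambda>i\<in>I. r * x i) I = r * L2_set x I"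
  by (subst L2_set_right_distrib) (auto intro: L2_set_cong)

lemma L2_set_restrict: "L2_set (restrict x I) I = L2_set x I"
  by (rule L2_set_cong) simp_all

lemma normalize_vec_restrict: "normalize_vec k (restrict x {..<k}) = normalize_vec k x"
  unfolding normalize_vec_def L2_set_restrict by (simp add: fun_eq_iff)

lemma normalize_vec_scale:
  assumes "r > 0"
  shows "normalize_vec k (\<lambda>i. r * x i) = normalize_vec k x"
proof -
  have "L2_set (\<lambda>i. r * x i) {..<k} = r * L2_set x {..<k}"
    using assms by (subst L2_set_right_distrib) auto
  then show ?thesis using assms by (auto simp: normalize_vec_def fun_eq_iff)
qed

lemma unit_ball_sets [measurable]: "unit_ball k \<in> sets (vborel k)"
proof -
  have "unit_ball k = {x \<in> space (vborel k). L2_set x {..<k} \<le> 1}"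
    by (simp add: unit_ball_def space_PiM PiE_def)
  also have "\<dots> \<in> sets (vborel k)" by measurable
  finally show ?thesis .
qed

lemma indicator_atLeast: "indicator {a..} r = (if a \<le> r then 1 else 0)"
  by (simp add: indicator_def)

text \<open>A Gaussian vector is a mixture of uniform distributions on centred balls.\<close>

lemma emeasure_gaussn_cone:
  "\<exists>Z. \<forall>A \<in> sets (vborel k).
      (\<forall>r>0. \<forall>x. (\<lambda>i\<in>{..<k}. r * x i) \<in> A \<longleftrightarrow> x \<in> A \<or> x \<notin> Rn k \<and> restrict x {..<k} \<in> A) \<longrightarrow>
      emeasure (gaussn k) A = Z * emeasure (plebesgue {..<k}) (A \<inter> unit_ball k)"
proof (intro exI ballI impI)
  \<comment> \<open>For extensional \<open>x\<close> the hypothesis \<open>cone\<close> is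
    invariance under dilations; the second disjunct concerns only arguments outside
    \<open>Rn k\<close>, where membership has to be tested after restriction.\<close>
  fix A assume A [measurable]: "A \<in> sets (vborel k)"
    and cone: "\<forall>r>0. \<forall>x. (\<lambda>i\<in>{..<k}. r * x i) \<in> A \<longleftrightarrow> x \<in> A \<or> x \<notin> Rn k \<and> restrict x {..<k} \<in> A"
  let ?L = "plebesgue {..<k}"
  let ?w = "\<lambda>r. ennreal (r * exp (- r\<^sup>2 / 2))"
  let ?i = "\<lambda>x r. indicator {L2_set x {..<k}..} r * indicator A x"
  interpret L: sigma_finite_measure ?L
    by (rule lborel_prod.sigma_finite) simp
  interpret LL: pair_sigma_finite ?L "lborel :: real measure" ..
  define c where "c = ennreal ((1 / sqrt (2 * pi)) ^ k)"
  have inner: "?w r * (\<integral>\<^sup>+x. ?i x r \<partial>?L)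
      = ?w r * ennreal (r ^ k) * emeasure ?L (A \<inter> unit_ball k)" for r
  proof (cases "r > 0")
    case True
    have "(\<lambda>x. ?i x r :: ennreal) \<in> borel_measurable (vborel k)"
      unfolding indicator_atLeast by measurable
    from nn_integral_PiM_lborel_scale [OF True _ this]
    have "(\<integral>\<^sup>+x. ?i x r \<partial>?L)
       = ennreal (r ^ k) * (\<integral>\<^sup>+x. indicator {L2_set (\<lambda>i\<in>{..<k}. r * x i) {..<k}..} r * indicator A (\<lambda>i\<in>{..<k}. r * x i) \<partial>?L)"
      by simp
    also have "(\<integral>\<^sup>+x. indicator {L2_set (\<lambda>i\<in>{..<k}. r * x i) {..<k}..} r * indicator A (\<lambda>i\<in>{..<k}. r * x i) \<partial>?L)
       = (\<integral>\<^sup>+x. indicator (A \<inter> unit_ball k) x \<partial>?L)"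
    proof (rule nn_integral_cong)
      fix x assume "x \<in> space ?L"
      then have x: "x \<in> Rn k" by simp
      have "L2_set (\<lambda>i\<in>{..<k}. r * x i) {..<k} = r * L2_set x {..<k}"
        using True by (intro L2_set_scale) simp
      moreover have "r * L2_set x {..<k} \<le> r \<longleftrightarrow> L2_set x {..<k} \<le> 1"
        using True by simp
      ultimately show "(indicator {L2_set (\<lambda>i\<in>{..<k}. r * x i) {..<k}..} r * indicator A (\<lambda>i\<in>{..<k}. r * x i) :: ennreal)
          = indicator (A \<inter> unit_ball k) x"
        using cone True x by (auto simp add: indicator_def unit_ball_def)
    qed
    also have "\<dots> = emeasure ?L (A \<inter> unit_ball k)"
      by (rule nn_integral_indicator) simp
    finally show ?thesis by (simp add: mult_ac)
  next
    case False
    then have "r * exp (- r\<^sup>2 / 2) \<le> 0" by (simp add: mult_nonpos_nonneg)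
    then show ?thesis by (simp add: ennreal_neg)
  qed
  have m: "(\<lambda>(x, r). ?w r * ?i x r)
      \<in> borel_measurable (?L \<Otimes>\<^sub>M lborel)"
  proof -
    have "(\<lambda>(x, r). ?w r * ?i x r)
      \<in> borel_measurable (vborel k \<Otimes>\<^sub>M borel)"
      unfolding indicator_atLeast by measurable
    moreover have "sets (?L \<Otimes>\<^sub>M lborel) = sets (vborel k \<Otimes>\<^sub>M borel)"
      by (intro sets_pair_measure_cong) auto
    ultimately show ?thesis by (simp cong: measurable_cong_sets)
  qed
  have "emeasure (gaussn k) A
      = (\<integral>\<^sup>+x. ennreal ((1 / sqrt (2 * pi)) ^ k * exp (- (L2_set x {..<k})\<^sup>2 / 2)) * indicator A x \<partial>?L)"
    unfolding gaussn_eq_density by (rule emeasure_density) (simp_all cong: measurable_cong_sets)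
  also have "\<dots> = (\<integral>\<^sup>+x. c * (ennreal (exp (- (L2_set x {..<k})\<^sup>2 / 2)) * indicator A x) \<partial>?L)"
    by (simp add: c_def ennreal_mult mult_ac)
  also have "\<dots> = c * (\<integral>\<^sup>+x. ennreal (exp (- (L2_set x {..<k})\<^sup>2 / 2)) * indicator A x \<partial>?L)"
    by (rule nn_integral_cmult) (simp cong: measurable_cong_sets)
  also have "(\<integral>\<^sup>+x. ennreal (exp (- (L2_set x {..<k})\<^sup>2 / 2)) * indicator A x \<partial>?L)
     = (\<integral>\<^sup>+x. (\<integral>\<^sup>+r. ?w r * ?i x r \<partial>lborel) \<partial>?L)"
    by (subst exp_neg_square_half_layer_cake) (simp_all add: nn_integral_multc flip: mult.assoc)
  also have "\<dots> = (\<integral>\<^sup>+r. (\<integral>\<^sup>+x. ?w r * ?i x r \<partial>?L) \<partial>lborel)"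
    using LL.Fubini' [OF m] by simp
  also have "\<dots> = (\<integral>\<^sup>+r. ?w r * (\<integral>\<^sup>+x. ?i x r \<partial>?L) \<partial>lborel)"
    by (intro nn_integral_cong, subst nn_integral_cmult [symmetric])
       (auto simp: mult_ac indicator_atLeast cong: measurable_cong_sets)
  also have "\<dots> = (\<integral>\<^sup>+r. ?w r * ennreal (r ^ k) * emeasure ?L (A \<inter> unit_ball k) \<partial>lborel)"
    by (simp only: inner)
  also have "\<dots> = (\<integral>\<^sup>+r. ?w r * ennreal (r ^ k) \<partial>lborel) * emeasure ?L (A \<inter> unit_ball k)"
    by (rule nn_integral_multc) simp
  finally show "emeasure (gaussn k) A = ennreal ((1 / sqrt (2 * pi)) ^ k) *
     (\<integral>\<^sup>+r. ?w r * ennreal (r ^ k) \<partial>lborel) * emeasure ?L (A \<inter> unit_ball k)"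
    by (simp add: c_def mult_ac)
qed

text \<open>The preimage of a set under normalisation is a cone, so its Gaussian measure is, up to a
  universal factor, the volume of its part in the unit ball, and this is how the cone measure is
  defined.\<close>

lemma sphere_measure_eq:
  "sphere_measure k = distr (gaussn k) (vborel k) (normalize_vec k)"
proof (rule measure_eqI)
  show "sets (sphere_measure k) = sets (distr (gaussn k) (vborel k) (normalize_vec k))"
    by (simp add: sphere_measure_def)
  fix Q assume "Q \<in> sets (sphere_measure k)"
  then have Q [measurable]: "Q \<in> sets (vborel k)" by (simp add: sphere_measure_def)
  let ?L = "plebesgue {..<k}"
  define V where "V = emeasure ?L (unit_ball k)"
  obtain Z where Z: "\<forall>A \<in> sets (vborel k).
      (\<forall>r>0. \<forall>x. (\<lambda>i\<in>{..<k}. r * x i) \<in> A \<longleftrightarrow> x \<in> A \<or> x \<notin> Rn k \<and> restrict x {..<k} \<in> A) \<longrightarrow>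
      emeasure (gaussn k) A = Z * emeasure ?L (A \<inter> unit_ball k)"
    by (rule exE [OF emeasure_gaussn_cone])
  note Z = Z [THEN bspec, THEN mp]
  define A where "A = {x \<in> space (vborel k). normalize_vec k x \<in> Q}"
  have A [measurable]: "A \<in> sets (vborel k)" unfolding A_def by measurable
  have 1: "emeasure (gaussn k) A = Z * emeasure ?L (A \<inter> unit_ball k)"
    using A by (rule Z) (auto simp: A_def space_PiM PiE_def normalize_vec_scale normalize_vec_restrict)
  \<comment> \<open>The whole space is a cone too: this identifies \<open>Z\<close> as the inverse
    volume of the ball and shows that the volume is neither 0 nor infinite, without computing
    it.\<close>
  have "1 = emeasure (gaussn k) (space (gaussn k))"
    by (rule gaussn.emeasure_space_1 [symmetric])
  also have "\<dots> = Z * emeasure ?L (Rn k \<inter> unit_ball k)"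
    using sets.top [of "gaussn k"] by (subst Z) auto
  also have "Rn k \<inter> unit_ball k = unit_ball k" by (auto simp: unit_ball_def)
  finally have ZV: "Z * V = 1" by (simp add: V_def)
  have Zd: "Z * a = a / V" for a
  proof -
    have "V \<noteq> 0" "V \<noteq> \<infinity>" using ZV by (auto simp: ennreal_mult_eq_top_iff ennreal_top_mult ennreal_mult_top split: if_splits)
    then have "V * inverse V = 1"
      by (metis ennreal_divide_self divide_ennreal_def infinity_ennreal_def less_top)
    then have "inverse V = Z * V * inverse V" using ZV by simp
    then have "inverse V = Z" using \<open>V * inverse V = 1\<close> by (simp add: mult.assoc)
    then show ?thesis by (simp add: divide_ennreal_def mult.commute)
  qed
  have "emeasure (sphere_measure k) Q = emeasure (uniform_measure ?L (unit_ball k)) A"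
  proof -
    have "sphere_measure k = distr (uniform_measure ?L (unit_ball k)) ?L (normalize_vec k)"
      by (simp only: sphere_measure_def normalize_vec_def [abs_def])
    also have "emeasure \<dots> Q = emeasure (uniform_measure ?L (unit_ball k)) (normalize_vec k -` Q \<inter> space (uniform_measure ?L (unit_ball k)))"
      by (rule emeasure_distr) (simp_all cong: measurable_cong_sets)
    also have "normalize_vec k -` Q \<inter> space (uniform_measure ?L (unit_ball k)) = A"
      by (auto simp: A_def space_PiM PiE_def)
    finally show ?thesis .
  qed
  also have "\<dots> = emeasure ?L (unit_ball k \<inter> A) / V"
    unfolding V_def by (rule emeasure_uniform_measure) simp_all
  also have "\<dots> = emeasure (gaussn k) A"
    by (simp add: 1 Zd Int_commute)
  also have "\<dots> = emeasure (distr (gaussn k) (vborel k) (normalize_vec k)) Q"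
    by (subst emeasure_distr) (auto simp: A_def space_PiM PiE_def
         intro!: arg_cong [where f = "emeasure _"] cong: measurable_cong_sets)
  finally show "emeasure (sphere_measure k) Q = emeasure (distr (gaussn k) (vborel k) (normalize_vec k)) Q" .
qed

section \<open>Symmetric norms and their medians\<close>

text \<open>The axioms speak of total functions; \<open>nu_cong\<close> says that only the first
  \<open>k\<close> entries count, which spares a \<open>restrict\<close> in every computation with
  the norm.\<close>

locale sym_norm =
  fixes k :: nat and \<nu> :: "rvec \<Rightarrow> real"
  assumes k_pos: "k \<ge> 1"
    and nu_cong: "(\<And>i. i < k \<Longrightarrow> x i = y i) \<Longrightarrow> \<nu> x = \<nu> y"
    and nu_eq_0_iff: "\<nu> x = 0 \<longleftrightarrow> (\<forall>i<k. x i = 0)"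
    and nu_scale: "\<nu> (\<lambda>i. a * x i) = \<bar>a\<bar> * \<nu> x"
    and nu_add: "\<nu> (\<lambda>i. x i + y i) \<le> \<nu> x + \<nu> y"
    and nu_perm: "p permutes {..<k} \<Longrightarrow> \<nu> (\<lambda>i. x (p i)) = \<nu> x"
    and nu_abs: "\<nu> (\<lambda>i. \<bar>x i\<bar>) = \<nu> x"
begin

abbreviation "unit_vec \<equiv> (\<lambda>i::nat. if i = 0 then 1 else 0 :: real)"

lemma nu_nonneg: "\<nu> x \<ge> 0"
proof -
  have "\<nu> (\<lambda>i. x i + (-1) * x i) \<le> \<nu> x + \<nu> (\<lambda>i. (-1) * x i)" by (rule nu_add)
  then have "\<nu> (\<lambda>i. x i + (-1) * x i) \<le> 2 * \<nu> x" using nu_scale [of "-1" x] by simp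
  moreover have "\<nu> (\<lambda>i. x i + (-1) * x i) = 0" by (subst nu_eq_0_iff) simp
  ultimately show ?thesis by simp
qed

lemma nu_zero: "\<nu> (\<lambda>_. 0) = 0"
  by (simp add: nu_eq_0_iff)

lemma nu_restrict: "\<nu> (restrict x {..<k}) = \<nu> x"
  by (rule nu_cong) simp

lemma nu_abs_cong: "(\<And>i. i < k \<Longrightarrow> \<bar>x i\<bar> = \<bar>y i\<bar>) \<Longrightarrow> \<nu> x = \<nu> y"
  by (metis (mono_tags, lifting) nu_abs nu_cong)

text \<open>When one entry shrinks in absolute value, the new vector is a convex combination of
  \<open>x\<close> and its reflection in that coordinate, and these two have the same norm.\<close>

lemma nu_mono_one:
  assumes "\<bar>t\<bar> \<le> \<bar>x i\<bar>"
  shows "\<nu> (x(i := t)) \<le> \<nu> x"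
proof (cases "x i = 0")
  case True
  with assms have "x(i := t) = x" by (auto simp: fun_eq_iff)
  then show ?thesis by simp
next
  case False
  define a where "a = (1 + t / x i) / 2"
  have "\<bar>t / x i\<bar> \<le> 1" using assms False by (simp add: abs_divide)
  then have "- 1 \<le> t / x i" "t / x i \<le> 1" by (smt (verit))+
  then have a: "0 \<le> a" "a \<le> 1" unfolding a_def by simp_all
  have "x(i := t) = (\<lambda>j. a * x j + (1 - a) * (x(i := - x i)) j)"
    using False by (auto simp: fun_eq_iff a_def field_simps)
  then have "\<nu> (x(i := t)) \<le> \<nu> (\<lambda>j. a * x j) + \<nu> (\<lambda>j. (1 - a) * (x(i := - x i)) j)"
    using nu_add [of "\<lambda>j. a * x j" "\<lambda>j. (1 - a) * (x(i := - x i)) j"] by simp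
  also have "\<dots> = a * \<nu> x + (1 - a) * \<nu> (x(i := - x i))"
    using a by (simp only: nu_scale abs_of_nonneg diff_ge_0_iff_ge)
  also have "\<nu> (x(i := - x i)) = \<nu> x"
    by (rule nu_abs_cong) simp
  finally show ?thesis by (simp add: algebra_simps fun_upd_def)
qed

lemma nu_mono:
  assumes "\<And>i. i < k \<Longrightarrow> \<bar>x i\<bar> \<le> \<bar>y i\<bar>"
  shows "\<nu> x \<le> \<nu> y"
proof -
  have "\<nu> (\<lambda>i. if i < m then x i else y i) \<le> \<nu> y" if "m \<le> k" for m
    using that
  proof (induction m)
    case (Suc m)
    have "\<nu> (\<lambda>i. if i < Suc m then x i else y i) = \<nu> ((\<lambda>i. if i < m then x i else y i)(m := x m))"
      by (rule nu_cong) (auto simp: less_Suc_eq)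
    also have "\<dots> \<le> \<nu> (\<lambda>i. if i < m then x i else y i)"
      using assms Suc.prems by (intro nu_mono_one) simp
    finally show ?case using Suc by simp
  qed simp
  from this [of k] have "\<nu> (\<lambda>i. if i < k then x i else y i) \<le> \<nu> y" by simp
  also have "\<nu> (\<lambda>i. if i < k then x i else y i) = \<nu> x" by (rule nu_cong) simp
  finally show ?thesis .
qed

lemma nu_sum:
  assumes "finite A"
  shows "\<nu> (\<lambda>i. \<Sum>a\<in>A. f a i) \<le> (\<Sum>a\<in>A. \<nu> (f a))"
  using assms
proof (induction A rule: finite_induct)
  case empty
  then show ?case by (simp add: nu_zero)
next
  case (insert a A)
  then show ?case
    using nu_add [of "f a" "\<lambda>i. \<Sum>a\<in>A. f a i"] by simp
qed

lemma nu_basis: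
  assumes "i < k"
  shows "\<nu> (\<lambda>j. if j = i then 1 else 0) = \<nu> unit_vec"
proof -
  have p: "Transposition.transpose 0 i permutes {..<k}"
    using assms by (intro permutes_swap_id) auto
  have "(\<lambda>j. unit_vec (Transposition.transpose 0 i j)) = (\<lambda>j. if j = i then 1 else 0)"
    by (auto simp: fun_eq_iff Transposition.transpose_def)
  then show ?thesis using nu_perm [OF p, of unit_vec] by simp
qed

lemma nu_le_sum: "\<nu> x \<le> \<nu> unit_vec * (\<Sum>i<k. \<bar>x i\<bar>)"
proof -
  have "\<nu> x = \<nu> (\<lambda>j. \<Sum>i<k. x i * (if j = i then 1 else 0))"
    by (rule nu_cong) (simp add: sum.delta if_distrib cong: if_cong)
  also have "\<dots> \<le> (\<Sum>i<k. \<nu> (\<lambda>j. x i * (if j = i then 1 else 0)))"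
    by (rule nu_sum) simp
  also have "\<dots> = (\<Sum>i<k. \<bar>x i\<bar> * \<nu> unit_vec)"
  proof (intro sum.cong refl)
    fix i assume "i \<in> {..<k}"
    then show "\<nu> (\<lambda>j. x i * (if j = i then 1 else 0)) = \<bar>x i\<bar> * \<nu> unit_vec"
      by (subst nu_scale, subst nu_basis) simp_all
  qed
  finally show ?thesis by (simp only: sum_distrib_right mult.commute [of "\<nu> unit_vec"])
qed

lemma nu_diff_le: "\<nu> x \<le> \<nu> y + \<nu> (\<lambda>i. x i - y i)"
  using nu_add [of y "\<lambda>i. x i - y i"] by simp

lemma nu_uminus: "\<nu> (\<lambda>i. - x i) = \<nu> x"
  using nu_scale [of "-1" x] by simp

lemma nu_lipschitz: "\<bar>\<nu> x - \<nu> y\<bar> \<le> \<nu> unit_vec * (\<Sum>i<k. \<bar>x i - y i\<bar>)"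
proof -
  have "\<nu> (\<lambda>i. y i - x i) = \<nu> (\<lambda>i. x i - y i)"
    using nu_uminus [of "\<lambda>i. x i - y i"] by simp
  then have "\<bar>\<nu> x - \<nu> y\<bar> \<le> \<nu> (\<lambda>i. x i - y i)"
    using nu_diff_le [of x y] nu_diff_le [of y x] by simp
  also have "\<dots> \<le> \<nu> unit_vec * (\<Sum>i<k. \<bar>x i - y i\<bar>)" by (rule nu_le_sum)
  finally show ?thesis .
qed

lemma continuous_on_nu: "continuous_on UNIV \<nu>"
  unfolding continuous_on_def
proof
  fix x :: rvec
  have "continuous_on UNIV (\<lambda>y::rvec. \<nu> unit_vec * (\<Sum>i<k. \<bar>y i - x i\<bar>))"
    by (intro continuous_intros continuous_on_product_coordinates)
  then have "((\<lambda>y. \<nu> unit_vec * (\<Sum>i<k. \<bar>y i - x i\<bar>)) \<longlongrightarrow> \<nu> unit_vec * (\<Sum>i<k. \<bar>x i - x i\<bar>)) (at x within UNIV)"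
    by (simp only: continuous_on_def) blast
  then have lim: "((\<lambda>y. \<nu> unit_vec * (\<Sum>i<k. \<bar>y i - x i\<bar>)) \<longlongrightarrow> 0) (at x within UNIV)"
    by simp
  have "((\<lambda>y. \<nu> y - \<nu> x) \<longlongrightarrow> 0) (at x within UNIV)"
    by (rule Lim_null_comparison [OF always_eventually lim]) (simp only: real_norm_def nu_lipschitz simp_thms)
  then show "(\<nu> \<longlongrightarrow> \<nu> x) (at x within UNIV)"
    by (rule LIM_zero_cancel)
qed

lemma borel_measurable_nu [measurable]: "\<nu> \<in> borel_measurable (vborel k)"
proof -
  \<comment> \<open>Extension by zero leads to functions on all of \<open>nat\<close>, where the
    product sigma-algebra is the Borel one, so that continuity gives measurability.\<close>
  have "(\<lambda>x. (\<lambda>i. if i < k then x i else 0)) \<in> vborel k \<rightarrow>\<^sub>M (Pi\<^sub>M UNIV (\<lambda>_. borel))"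
  proof (rule measurable_PiM_single')
    fix i :: nat
    show "(\<lambda>x. if i < k then x i else 0) \<in> vborel k \<rightarrow>\<^sub>M borel"
      by (cases "i < k") auto
  qed auto
  then have 1: "(\<lambda>x. (\<lambda>i. if i < k then x i else 0)) \<in> vborel k \<rightarrow>\<^sub>M borel"
    by (simp cong: measurable_cong_sets add: sets_PiM_equal_borel)
  have "\<nu> \<in> borel_measurable borel"
    by (rule borel_measurable_continuous_onI [OF continuous_on_nu])
  from measurable_compose [OF 1 this] have "(\<lambda>x. \<nu> (\<lambda>i. if i < k then x i else 0)) \<in> borel_measurable (vborel k)" .
  moreover have "(\<lambda>x. \<nu> (\<lambda>i. if i < k then x i else 0)) = \<nu>"
    by (rule ext, rule nu_cong) simp
  ultimately show ?thesis by simp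
qed

lemma nu_normalize: "\<nu> (normalize_vec k x) = \<nu> x / L2_set x {..<k}"
proof -
  have "\<nu> (normalize_vec k x) = \<nu> (\<lambda>i. inverse (L2_set x {..<k}) * x i)"
    by (rule nu_cong) (simp add: normalize_vec_def field_simps)
  then show ?thesis
    by (simp only: nu_scale) (simp add: divide_inverse mult.commute)
qed

definition dir_law :: "real measure" where
  "dir_law = distr (gaussn k) borel (\<lambda>x. \<nu> (normalize_vec k x))"

sublocale dir_law: real_distribution dir_law
  unfolding dir_law_def by (rule gaussn.real_distribution_distr) measurable

lemma measure_dir_law:
  assumes "A \<in> sets borel"
  shows "measure dir_law A = \<P>(x in gaussn k. \<nu> (normalize_vec k x) \<in> A)"
proof -
  have "measure dir_law A = measure (gaussn k) ((\<lambda>x. \<nu> (normalize_vec k x)) -` A \<inter> space (gaussn k))"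
    unfolding dir_law_def by (intro measure_distr assms) measurable
  also have "(\<lambda>x. \<nu> (normalize_vec k x)) -` A \<inter> space (gaussn k) = {x \<in> space (gaussn k). \<nu> (normalize_vec k x) \<in> A}"
    by auto
  finally show ?thesis .
qed

lemma prob_sphere:
  assumes [measurable]: "A \<in> sets borel"
  shows "\<P>(x in sphere_measure k. \<nu> x \<in> A) = measure dir_law A"
proof -
  have "\<P>(x in sphere_measure k. \<nu> x \<in> A) = measure (distr (gaussn k) (vborel k) (normalize_vec k)) {x \<in> space (vborel k). \<nu> x \<in> A}"
    unfolding sphere_measure_eq by simp
  also have "\<dots> = measure (gaussn k) (normalize_vec k -` {x \<in> space (vborel k). \<nu> x \<in> A} \<inter> space (gaussn k))"
    by (rule measure_distr) measurable
  also have "normalize_vec k -` {x \<in> space (vborel k). \<nu> x \<in> A} \<inter> space (gaussn k) = {x \<in> space (gaussn k). \<nu> (normalize_vec k x) \<in> A}"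
    by (auto simp: space_PiM PiE_def normalize_vec_def)
  also have "measure (gaussn k) \<dots> = measure dir_law A"
    by (simp add: measure_dir_law)
  finally show ?thesis .
qed

lemma is_median_sphere_iff:
  "is_median_sphere k \<nu> m \<longleftrightarrow> measure dir_law {m..} \<ge> 1/2 \<and> measure dir_law {..m} \<ge> 1/2"
  using prob_sphere [of "{m..}"] prob_sphere [of "{..m}"] by (simp add: is_median_sphere_def)

end

section \<open>Existence and uniqueness of the median\<close>

lemma real_distribution_median_exists:
  assumes "real_distribution M"
  shows "\<exists>m. measure M {m..} \<ge> 1/2 \<and> measure M {..m} \<ge> 1/2"
proof -
  interpret real_distribution M by fact
  define S where "S = {m. cdf M m \<ge> 1/2}"
  have "\<forall>\<^sub>F x in at_top. cdf M x > 1/2"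
    using cdf_lim_at_top_prob by (rule order_tendstoD) simp
  then obtain a where "cdf M a > 1/2" by (auto simp: eventually_at_top_linorder)
  then have ne: "S \<noteq> {}" by (auto simp: S_def intro!: exI [of _ a])
  have "\<forall>\<^sub>F x in at_bot. cdf M x < 1/2"
    using cdf_lim_at_bot by (rule order_tendstoD) simp
  then obtain b where b: "\<And>x. x \<le> b \<Longrightarrow> cdf M x < 1/2" by (auto simp: eventually_at_bot_linorder)
  then have bdd: "bdd_below S"
    unfolding S_def by (intro bdd_belowI [of _ b]) (metis linorder_not_le mem_Collect_eq nle_le)
  define m where "m = Inf S"
  have above: "cdf M x \<ge> 1/2" if "x > m" for x
  proof -
    have "Inf S < x" using that by (simp add: m_def)
    from cInf_lessD [OF ne this] obtain y where "y \<in> S" "y < x" by blast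
    then show ?thesis using cdf_nondecreasing [of y x] by (simp add: S_def)
  qed
  have below: "cdf M x \<le> 1/2" if "x < m" for x
    using cInf_lower [OF _ bdd, of x] that by (force simp: m_def S_def)
  have "(cdf M \<longlongrightarrow> cdf M m) (at_right m)"
    using cdf_is_right_cont by (simp add: continuous_within)
  \<comment> \<open>Right continuity puts half of the mass at or below \<open>m\<close>; the left
    limit, treated next, puts at most half strictly below it, hence at least half at or
    above.\<close>
  then have 1: "cdf M m \<ge> 1/2"
  proof (rule tendsto_lowerbound)
    show "\<forall>\<^sub>F x in at_right m. 1/2 \<le> cdf M x"
      using eventually_at_right_less [of m] by (rule eventually_mono) (rule above)
  qed simp
  have "measure M {..<m} \<le> 1/2"
  proof (rule tendsto_upperbound [OF cdf_at_left])
    show "\<forall>\<^sub>F x in at_left m. cdf M x \<le> 1/2"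
      by (rule eventually_at_leftI [of "m - 1"]) (use below in auto)
  qed simp
  moreover have "measure M {m..} = 1 - measure M {..<m}"
    using prob_compl [of "{..<m}"] by (simp add: Compl_eq_Diff_UNIV [symmetric] Compl_lessThan)
  ultimately show ?thesis using 1 by (intro exI [of _ m]) (simp add: cdf_def2)
qed

lemma emeasure_gauss_interval_pos:
  assumes "a < b"
  shows "emeasure gauss {a<..<b} > 0"
proof (rule ccontr)
  assume "\<not> emeasure gauss {a<..<b} > 0"
  then have "(\<integral>\<^sup>+x. ennreal (std_normal_density x) * indicator {a<..<b} x \<partial>lborel) = 0"
    by (simp add: gauss_def emeasure_density)
  then have "AE x in lborel. ennreal (std_normal_density x) * indicator {a<..<b} x = 0"
    by (subst (asm) nn_integral_0_iff_AE) auto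
  then have "AE x in lborel. x \<notin> {a<..<b}"
    by eventually_elim (auto simp: indicator_def ennreal_eq_0_iff not_le [THEN iffD2, OF normal_density_pos [of 1]] split: if_splits)
  then have "emeasure lborel {a<..<b} = 0"
    by (subst (asm) AE_iff_measurable [of "{a<..<b}"]) auto
  with assms show False by simp
qed

lemma emeasure_gauss_singleton: "emeasure gauss {a} = 0"
  unfolding gauss_def by (subst emeasure_density) (auto simp: nn_integral_0_iff_AE indicator_def intro!: AE_I' [of "{a}"])

context sym_norm
begin

lemma zero_less_k: "0 < k" using k_pos by simp

lemma gaussn_component: "i < k \<Longrightarrow> distr (gaussn k) gauss (\<lambda>x. x i) = gauss"
  unfolding gaussn_def by (intro distr_PiM_component) (auto intro: prob_space_gauss)

lemma AE_gaussn_nonzero: "AE x in gaussn k. L2_set x {..<k} \<noteq> 0"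
proof -
  have m: "(\<lambda>x. x 0) \<in> gaussn k \<rightarrow>\<^sub>M gauss"
    unfolding gaussn_def using k_pos by (intro measurable_component_singleton) simp
  have "AE y in distr (gaussn k) gauss (\<lambda>x. x 0). y \<noteq> 0"
    unfolding gaussn_component [OF zero_less_k]
    by (rule AE_I' [of "{0}"]) (auto simp: emeasure_gauss_singleton null_sets_def)
  then have "AE x in gaussn k. x 0 \<noteq> 0"
    by (subst (asm) AE_distr_iff [OF m]) auto
  then show ?thesis
    by eventually_elim (use k_pos in \<open>auto simp: L2_set_eq_0_iff\<close>)
qed

text \<open>By connectedness the norm attains a value strictly between \<open>m1\<close> and
  \<open>m2\<close> at some direction, and an open set of vectors around it has positive Gaussian
  measure. This excludes two different medians.\<close>

lemma dir_law_gap: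
  assumes m12: "m1 < m2" and 1: "measure dir_law {..m1} > 0" and 2: "measure dir_law {m2..} > 0"
  shows "measure dir_law {m1<..<m2} > 0"
proof -
  have ex: "\<exists>x\<in>Rn k. L2_set x {..<k} \<noteq> 0 \<and> \<nu> x / L2_set x {..<k} \<in> A"
    if "A \<in> sets borel" "measure dir_law A > 0" for A
  proof (rule ccontr)
    note [measurable] = that(1)
    assume no: "\<not> ?thesis"
    have "AE x in gaussn k. \<not> (\<nu> (normalize_vec k x) \<in> A)"
      using AE_gaussn_nonzero AE_space [of "gaussn k"] by eventually_elim (use no in \<open>auto simp: nu_normalize\<close>)
    moreover have "{x \<in> space (gaussn k). \<nu> (normalize_vec k x) \<in> A} \<in> sets (gaussn k)"
      by measurable
    ultimately have "\<P>(x in gaussn k. \<nu> (normalize_vec k x) \<in> A) = 0"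
      by (subst gaussn.prob_Collect_eq_0)
    with that show False by (simp add: measure_dir_law)
  qed
  obtain x1 where x1: "L2_set x1 {..<k} \<noteq> 0" "\<nu> x1 / L2_set x1 {..<k} \<le> m1"
    using ex [of "{..m1}"] 1 by auto
  obtain x2 where x2: "L2_set x2 {..<k} \<noteq> 0" "\<nu> x2 / L2_set x2 {..<k} \<ge> m2"
    using ex [of "{m2..}"] 2 by auto
  \<comment> \<open>Absolute values put both endpoints in the nonnegative orthant, so the segment
    between them misses the origin, also for \<open>k = 1\<close>, where the sphere itself is
    disconnected.\<close>
  define z where "z t i = (1 - t) * \<bar>x1 i\<bar> + t * \<bar>x2 i\<bar>" for t :: real and i :: nat
  have L2_abs: "L2_set (\<lambda>i. \<bar>x i\<bar>) {..<k} = L2_set x {..<k}" for x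
    by (simp add: L2_set_def)
  have zpos: "L2_set (z t) {..<k} \<noteq> 0" if "0 \<le> t" "t \<le> 1" for t
  proof
    assume "L2_set (z t) {..<k} = 0"
    then have z0: "(1 - t) * \<bar>x1 i\<bar> + t * \<bar>x2 i\<bar> = 0" if "i < k" for i
      using that by (auto simp: L2_set_eq_0_iff z_def)
    have "(1 - t) * \<bar>x1 i\<bar> = 0 \<and> t * \<bar>x2 i\<bar> = 0" if "i < k" for i
      using z0 [OF that] \<open>0 \<le> t\<close> \<open>t \<le> 1\<close>
      by (subst add_nonneg_eq_0_iff [symmetric]) auto
    then show False using x1(1) x2(1) by (cases "t = 0") (auto simp: L2_set_eq_0_iff)
  qed
  have z01: "z 0 = (\<lambda>i. \<bar>x1 i\<bar>)" "z 1 = (\<lambda>i. \<bar>x2 i\<bar>)"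
    by (simp_all add: z_def fun_eq_iff)
  have cont_z: "continuous_on {0..1} z"
    unfolding z_def by (intro continuous_on_coordinatewise_then_product continuous_intros)
  have cont: "continuous_on {0..1} (\<lambda>t. \<nu> (z t) / L2_set (z t) {..<k})"
  proof (intro continuous_intros ballI)
    show "continuous_on {0..1} (\<lambda>t. \<nu> (z t))"
      using continuous_on_compose2 [OF continuous_on_nu cont_z] by auto
    show "continuous_on {0..1} (\<lambda>t. L2_set (z t) {..<k})"
      unfolding L2_set_def z_def by (intro continuous_intros)
  qed (use zpos in auto)
  have ends: "\<nu> (z 0) / L2_set (z 0) {..<k} \<le> m1" "m2 \<le> \<nu> (z 1) / L2_set (z 1) {..<k}"
    using x1 x2 by (simp_all add: z01 nu_abs L2_abs)
  have "m1 \<le> (m1 + m2) / 2" "(m1 + m2) / 2 \<le> m2" using m12 by simp_all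
  then have "\<exists>t\<ge>0. t \<le> 1 \<and> \<nu> (z t) / L2_set (z t) {..<k} = (m1 + m2) / 2"
    using ends by (intro IVT' [where f = "\<lambda>t. \<nu> (z t) / L2_set (z t) {..<k}"]) (linarith | rule cont)+
  then obtain t where t: "0 \<le> t" "t \<le> 1" "\<nu> (z t) / L2_set (z t) {..<k} = (m1 + m2) / 2"
    by blast
  define c where "c = L2_set (z t) {..<k}"
  have c: "c > 0" using zpos [OF t(1,2)] L2_set_nonneg [of "z t" "{..<k}"] unfolding c_def by linarith
  \<comment> \<open>The strict inequalities are cleared of the quotient, so that \<open>W\<close> is
    open; \<open>z t\<close> lies in it because its ratio is the midpoint of \<open>m1\<close> and
    \<open>m2\<close>.\<close>
  define W where "W = (\<lambda>x. \<nu> x - m1 * L2_set x {..<k}) -` {0<..} \<inter> (\<lambda>x. m2 * L2_set x {..<k} - \<nu> x) -` {0<..} \<inter> (\<lambda>x. L2_set x {..<k}) -` {0<..}"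
  have cont_L2: "continuous_on UNIV (\<lambda>x::rvec. L2_set x {..<k})"
    unfolding L2_set_def by (intro continuous_intros continuous_on_product_coordinates)
  have "open W"
    unfolding W_def by (intro open_Int open_vimage continuous_intros continuous_on_nu cont_L2 open_greaterThan)
  have "2 * \<nu> (z t) = c * m1 + c * m2" using t(3) c by (simp add: c_def field_simps)
  moreover have "c * m1 < c * m2" using mult_strict_left_mono [OF m12 c] .
  ultimately have "c * m1 < \<nu> (z t)" "\<nu> (z t) < c * m2" by linarith+
  then have "z t \<in> W" using c by (auto simp: W_def c_def [symmetric] mult.commute)
  have "openin (product_topology (\<lambda>_. euclidean) UNIV) W"
    using \<open>open W\<close> by (simp only: open_fun_def)
  from product_topology_open_contains_basis [OF this \<open>z t \<in> W\<close>]
  have "\<exists>X. z t \<in> Pi\<^sub>E UNIV X \<and> (\<forall>i. open (X i)) \<and> finite {i. X i \<noteq> UNIV} \<and> Pi\<^sub>E UNIV X \<subseteq> W"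
    by simp
  then obtain X where X: "z t \<in> Pi\<^sub>E UNIV X" "\<And>i. open (X i)" "Pi\<^sub>E UNIV X \<subseteq> W" by blast
  have "emeasure gauss (X i) > 0" for i
  proof -
    obtain e where e: "e > 0" "ball (z t i) e \<subseteq> X i" using X(1,2) openE [of "X i" "z t i"] by auto
    have "0 < emeasure gauss {z t i - e<..<z t i + e}"
      using e by (intro emeasure_gauss_interval_pos) simp
    also have "\<dots> \<le> emeasure gauss (X i)"
      using e X(2) by (intro emeasure_mono) (auto simp: ball_eq_greaterThanLessThan)
    finally show ?thesis .
  qed
  then have "0 < (\<Prod>i<k. emeasure gauss (X i))"
    by (simp add: zero_less_iff_neq_zero)
  also have "(\<Prod>i<k. emeasure gauss (X i)) = emeasure (gaussn k) (Pi\<^sub>E {..<k} X)"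
    unfolding gaussn_def using X(2) by (intro gauss_prod.emeasure_PiM [symmetric]) auto
  also have "\<dots> \<le> emeasure (gaussn k) {x \<in> space (gaussn k). \<nu> (normalize_vec k x) \<in> {m1<..<m2}}"
  proof (rule emeasure_mono)
    show "Pi\<^sub>E {..<k} X \<subseteq> {x \<in> space (gaussn k). \<nu> (normalize_vec k x) \<in> {m1<..<m2}}"
    proof
      fix x assume x: "x \<in> Pi\<^sub>E {..<k} X"
      \<comment> \<open>\<open>W\<close> is a set of functions on all of \<open>nat\<close>; the
        entries from \<open>k\<close> on are borrowed from \<open>z t\<close> and affect neither the
        norm nor the length.\<close>
      define x' where "x' i = (if i < k then x i else z t i)" for i
      have "x' \<in> W" using X x by (auto simp: x'_def PiE_def Pi_def)
      moreover have "\<nu> x' = \<nu> x" by (rule nu_cong) (simp add: x'_def)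
      moreover have "L2_set x' {..<k} = L2_set x {..<k}" by (rule L2_set_cong) (simp_all add: x'_def)
      ultimately show "x \<in> {x \<in> space (gaussn k). \<nu> (normalize_vec k x) \<in> {m1<..<m2}}"
        using x by (auto simp: W_def nu_normalize PiE_def field_simps)
    qed
  qed measurable
  finally show ?thesis
    by (simp add: measure_dir_law gaussn.emeasure_eq_measure)
qed

text \<open>Two medians would leave mass 1/2 on either side of a gap of positive mass. Uniqueness
  gives the \<open>THE\<close> in \<open>median_sphere\<close> its meaning.\<close>

lemma ex1_median: "\<exists>!m. is_median_sphere k \<nu> m"
proof -
  obtain m where m: "is_median_sphere k \<nu> m"
    using real_distribution_median_exists [OF dir_law.real_distribution_axioms]
    by (auto simp: is_median_sphere_iff)
  moreover have False if "is_median_sphere k \<nu> m1" "is_median_sphere k \<nu> m2" "m1 < m2" for m1 m2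
  proof -
    have "measure dir_law {m1<..<m2} > 0"
      using that by (intro dir_law_gap) (auto simp: is_median_sphere_iff)
    moreover have "measure dir_law ({..m1} \<union> {m1<..<m2} \<union> {m2..}) = measure dir_law {..m1} + measure dir_law {m1<..<m2} + measure dir_law {m2..}"
      using that(3) by (subst dir_law.finite_measure_Union; (subst dir_law.finite_measure_Union)?) auto
    ultimately show False
      using that dir_law.prob_le_1 [of "{..m1} \<union> {m1<..<m2} \<union> {m2..}"] by (simp add: is_median_sphere_iff)
  qed
  ultimately show ?thesis by (metis linorder_neqE)
qed

definition Med :: real where "Med = median_sphere k \<nu>"

lemma median_Med: "is_median_sphere k \<nu> Med"
  unfolding Med_def median_sphere_def by (rule theI') (rule ex1_median)

section \<open>From the median on the sphere to a Gaussian vector\<close>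

lemma nn_integral_gaussn_square: "(\<integral>\<^sup>+x. ennreal ((L2_set x {..<k})\<^sup>2) \<partial>gaussn k) = ennreal (real k)"
proof -
  have 1: "(\<integral>\<^sup>+y. ennreal (y\<^sup>2) \<partial>gauss) = 1"
  proof -
    have "(\<integral>\<^sup>+y. ennreal (y\<^sup>2) \<partial>gauss) = (\<integral>\<^sup>+y. ennreal (std_normal_density y * y ^ (2 * 1)) \<partial>lborel)"
      unfolding gauss_def by (subst nn_integral_density) (auto simp: ennreal_mult power2_eq_square)
    also have "\<dots> = ennreal (fact (2 * 1) / (2 ^ 1 * fact 1))"
      using nn_integral_eq_integral [OF integrable_std_normal_moment [of "2 * 1"]] integral_std_normal_moment_even [of 1]
      by simp
    finally show ?thesis by simp
  qed
  have 2: "(\<integral>\<^sup>+x. ennreal ((x i)\<^sup>2) \<partial>gaussn k) = 1" if "i < k" for i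
  proof -
    have "(\<integral>\<^sup>+x. ennreal ((x i)\<^sup>2) \<partial>gaussn k) = (\<integral>\<^sup>+y. ennreal (y\<^sup>2) \<partial>distr (gaussn k) gauss (\<lambda>x. x i))"
      using that by (subst nn_integral_distr) auto
    also have "distr (gaussn k) gauss (\<lambda>x. x i) = gauss"
      using that by (rule gaussn_component)
    finally show ?thesis using 1 by simp
  qed
  have "(\<integral>\<^sup>+x. ennreal ((L2_set x {..<k})\<^sup>2) \<partial>gaussn k) = (\<integral>\<^sup>+x. (\<Sum>i<k. ennreal ((x i)\<^sup>2)) \<partial>gaussn k)"
    by (intro nn_integral_cong) (simp add: L2_set_def sum_nonneg sum_ennreal)
  also have "\<dots> = (\<Sum>i<k. (\<integral>\<^sup>+x. ennreal ((x i)\<^sup>2) \<partial>gaussn k))"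
    by (rule nn_integral_sum; measurable)
  also have "\<dots> = ennreal (real k)" by (simp add: 2 ennreal_of_nat_eq_real_of_nat)
  finally show ?thesis .
qed

lemma prob_gaussn_large_norm: "\<P>(x in gaussn k. L2_set x {..<k} > 2 * sqrt (real k)) \<le> 1/4"
proof -
  have "emeasure (gaussn k) {x \<in> space (gaussn k). L2_set x {..<k} > 2 * sqrt (real k)}
     \<le> emeasure (gaussn k) {x \<in> space (gaussn k). 1 \<le> ennreal (1 / (4 * real k)) * ennreal ((L2_set x {..<k})\<^sup>2)}"
  proof (rule emeasure_mono)
    show "{x \<in> space (gaussn k). L2_set x {..<k} > 2 * sqrt (real k)} \<subseteq>
        {x \<in> space (gaussn k). 1 \<le> ennreal (1 / (4 * real k)) * ennreal ((L2_set x {..<k})\<^sup>2)}"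
    proof safe
      fix x :: rvec assume "L2_set x {..<k} > 2 * sqrt (real k)"
      then have "(2 * sqrt (real k))\<^sup>2 \<le> (L2_set x {..<k})\<^sup>2" by (intro power_mono) auto
      then have "1 \<le> 1 / (4 * real k) * (L2_set x {..<k})\<^sup>2" using k_pos by (simp add: field_simps)
      then have "ennreal 1 \<le> ennreal (1 / (4 * real k) * (L2_set x {..<k})\<^sup>2)" by (rule ennreal_leI)
      then show "1 \<le> ennreal (1 / (4 * real k)) * ennreal ((L2_set x {..<k})\<^sup>2)" by (simp add: ennreal_mult [symmetric])
    qed
  qed measurable
  also have "\<dots> \<le> ennreal (1 / (4 * real k)) * (\<integral>\<^sup>+x. ennreal ((L2_set x {..<k})\<^sup>2) * indicator (space (gaussn k)) x \<partial>gaussn k)"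
    by (rule nn_integral_Markov_inequality; measurable)
  also have "(\<integral>\<^sup>+x. ennreal ((L2_set x {..<k})\<^sup>2) * indicator (space (gaussn k)) x \<partial>gaussn k) = ennreal (real k)"
    by (subst nn_integral_gaussn_square [symmetric]) (intro nn_integral_cong, simp)
  also have "ennreal (1 / (4 * real k)) * ennreal (real k) = ennreal (1/4)"
    using k_pos by (simp add: ennreal_mult [symmetric])
  finally show ?thesis by (simp add: gaussn.emeasure_eq_measure)
qed

text \<open>The norm of the direction exceeds \<open>Med\<close> with probability at most 1/2, and
  the length exceeds twice its root mean square with probability at most 1/4; otherwise the two
  bounds multiply.\<close>

lemma prob_gaussn_le_median: "\<P>(x in gaussn k. \<nu> x > 2 * sqrt (real k) * Med) \<le> 3/4"
proof -
  have "measure dir_law {..Med} \<ge> 1/2" using median_Med by (simp add: is_median_sphere_iff)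
  then have 1: "\<P>(x in gaussn k. \<nu> (normalize_vec k x) \<le> Med) \<ge> 1/2"
    using measure_dir_law [of "{..Med}"] by simp
  have "\<P>(x in gaussn k. \<nu> x > 2 * sqrt (real k) * Med)
    \<le> \<P>(x in gaussn k. \<not> \<nu> (normalize_vec k x) \<le> Med \<or> L2_set x {..<k} > 2 * sqrt (real k))"
  proof (rule gaussn.finite_measure_mono)
    show "{x \<in> space (gaussn k). \<nu> x > 2 * sqrt (real k) * Med} \<subseteq> 
      {x \<in> space (gaussn k). \<not> \<nu> (normalize_vec k x) \<le> Med \<or> L2_set x {..<k} > 2 * sqrt (real k)}"
    proof safe
      fix x assume *: "\<nu> x > 2 * sqrt (real k) * Med" "\<nu> (normalize_vec k x) \<le> Med"
        "\<not> L2_set x {..<k} > 2 * sqrt (real k)"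
      have "Med \<ge> 0" using *(2) nu_nonneg [of "normalize_vec k x"] by linarith
      have "\<nu> x \<le> L2_set x {..<k} * Med"
      proof (cases "L2_set x {..<k} = 0")
        case True
        then have "\<nu> x = 0" by (auto simp: nu_eq_0_iff L2_set_eq_0_iff)
        then show ?thesis using True by simp
      next
        case False
        then have "L2_set x {..<k} > 0" using L2_set_nonneg [of x "{..<k}"] by linarith
        then show ?thesis using *(2) by (simp add: nu_normalize field_simps)
      qed
      also have "\<dots> \<le> 2 * sqrt (real k) * Med" using \<open>Med \<ge> 0\<close> *(3) by (intro mult_right_mono) auto
      finally show False using *(1) by simp
    qed
  qed measurable
  also have "\<dots> \<le> \<P>(x in gaussn k. \<not> \<nu> (normalize_vec k x) \<le> Med) + \<P>(x in gaussn k. L2_set x {..<k} > 2 * sqrt (real k))"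
  proof -
    have "{x \<in> space (gaussn k). \<not> \<nu> (normalize_vec k x) \<le> Med \<or> L2_set x {..<k} > 2 * sqrt (real k)}
      = {x \<in> space (gaussn k). \<not> \<nu> (normalize_vec k x) \<le> Med} \<union> {x \<in> space (gaussn k). L2_set x {..<k} > 2 * sqrt (real k)}"
      by blast
    then show ?thesis
      by (simp only:) (rule measure_Un_le; measurable)
  qed
  also have "\<P>(x in gaussn k. \<not> \<nu> (normalize_vec k x) \<le> Med) = 1 - \<P>(x in gaussn k. \<nu> (normalize_vec k x) \<le> Med)"
    by (rule gaussn.prob_neg) measurable
  finally show ?thesis using 1 prob_gaussn_large_norm by simp
qed

end

section \<open>Gaussian comparison and Rademacher noise\<close>

text \<open>Layer-cake: \<open>F\<close> is the integral of the indicators of its superlevel sets.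
  Such a nonempty set is a closed tail \<open>t \<le> \<bar>v\<bar>\<close> or an open one, hence an
  increasing union of closed tails, to which the hypothesis applies.\<close>

lemma upset_nn_integral_mono:
  fixes X :: "'a \<Rightarrow> real" and Y :: "'b \<Rightarrow> real" and F :: "real \<Rightarrow> ennreal"
  assumes "prob_space M" "prob_space N"
    and X [measurable]: "X \<in> borel_measurable M" and Y [measurable]: "Y \<in> borel_measurable N"
    and tail: "\<And>t. emeasure M {x \<in> space M. t \<le> \<bar>X x\<bar>} \<le> emeasure N {y \<in> space N. t \<le> \<bar>Y y\<bar>}"
    and F [measurable]: "F \<in> borel_measurable borel"
    and mono: "\<And>a b. \<bar>a\<bar> \<le> \<bar>b\<bar> \<Longrightarrow> F a \<le> F b"
  shows "(\<integral>\<^sup>+x. F (X x) \<partial>M) \<le> (\<integral>\<^sup>+y. F (Y y) \<partial>N)"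
proof -
  interpret M: prob_space M by fact
  interpret N: prob_space N by fact
  interpret PM: pair_sigma_finite M "lborel :: real measure" ..
  interpret PN: pair_sigma_finite N "lborel :: real measure" ..
  define f where "f s y = (if 0 \<le> s \<and> ennreal s < F y then 1 else 0 :: ennreal)" for s :: real and y
  have [measurable]: "(\<lambda>p. f (fst p) (snd p)) \<in> borel_measurable (borel \<Otimes>\<^sub>M borel)"
    unfolding f_def by measurable
  have F_eq: "F y = (\<integral>\<^sup>+s. f s y \<partial>lborel)" for y
  proof (cases "F y")
    case (real r)
    have "(\<integral>\<^sup>+s. f s y \<partial>lborel) = (\<integral>\<^sup>+s. indicator {0..<r} s \<partial>lborel)"
      using real by (intro nn_integral_cong) (auto simp: f_def indicator_def ennreal_less_iff)
    then show ?thesis using real by simp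
  next
    case top
    have "(\<integral>\<^sup>+s. f s y \<partial>lborel) = (\<integral>\<^sup>+s. indicator {0::real..} s \<partial>lborel)"
      using top by (intro nn_integral_cong) (auto simp: f_def indicator_def)
    also have "\<dots> = emeasure lborel {0::real..}"
      by (rule nn_integral_indicator) simp
    also have "\<dots> = \<infinity>"
    proof (cases "emeasure lborel {0::real..}")
      case (real r)
      have "emeasure lborel {0..r + 1} \<le> emeasure lborel {0::real..}"
        by (rule emeasure_mono) auto
      with real have "ennreal (r + 1) \<le> ennreal r" by simp
      with real(1) show ?thesis by (subst (asm) ennreal_le_iff) auto
    qed simp
    finally show ?thesis using top by simp
  qed
  have sect: "(\<integral>\<^sup>+x. f s (X x) \<partial>M) \<le> (\<integral>\<^sup>+y. f s (Y y) \<partial>N)" for s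
  proof -
    define V where "V = {y. 0 \<le> s \<and> ennreal s < F y}"
    have up: "b \<in> V" if "a \<in> V" "\<bar>a\<bar> \<le> \<bar>b\<bar>" for a b
      using that mono [of a b] by (auto simp: V_def)
    have "\<exists>t :: nat \<Rightarrow> real. decseq t \<and> V = (\<Union>n. {v. t n \<le> \<bar>v\<bar>})" if ne: "V \<noteq> {}"
    proof -
      define a where "a = Inf (abs ` V)"
      have bdd: "bdd_below (abs ` V)" by (rule bdd_belowI [of _ 0]) auto
      have lower: "a \<le> \<bar>v\<bar>" if "v \<in> V" for v
        unfolding a_def using that bdd by (intro cInf_lower) auto
      have above: "v \<in> V" if "a < \<bar>v\<bar>" for v
      proof -
        obtain w where "w \<in> V" "\<bar>w\<bar> < \<bar>v\<bar>"
          using cInf_lessD [of "abs ` V" "\<bar>v\<bar>"] ne \<open>a < \<bar>v\<bar>\<close> by (auto simp: a_def)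
        then show ?thesis using up by force
      qed
      show ?thesis
      proof (cases "\<exists>v\<in>V. \<bar>v\<bar> = a")
        case True
        then have "V = (\<Union>n::nat. {v. a \<le> \<bar>v\<bar>})" using lower up by auto
        then show ?thesis by (intro exI [of _ "\<lambda>_. a"]) (auto simp: decseq_def)
      next
        case False
        define t where "t n = a + 1 / real (Suc n)" for n
        have "decseq t" by (auto simp: decseq_def t_def intro!: divide_left_mono)
        moreover have "V = (\<Union>n. {v. t n \<le> \<bar>v\<bar>})"
        proof (intro equalityI subsetI)
          fix v assume "v \<in> V"
          then have "a < \<bar>v\<bar>" using lower [of v] False by force
          then obtain n where "1 / real (Suc n) < \<bar>v\<bar> - a"
            using nat_approx_posE [of "\<bar>v\<bar> - a"] by auto
          then show "v \<in> (\<Union>n. {v. t n \<le> \<bar>v\<bar>})" by (auto simp: t_def intro!: exI [of _ n])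
        next
          fix v assume "v \<in> (\<Union>n. {v. t n \<le> \<bar>v\<bar>})"
          then obtain n where "t n \<le> \<bar>v\<bar>" by auto
          moreover have "a < t n" by (simp add: t_def)
          ultimately show "v \<in> V" by (intro above) linarith
        qed
        ultimately show ?thesis by blast
      qed
    qed
    then have "emeasure M {x \<in> space M. X x \<in> V} \<le> emeasure N {y \<in> space N. Y y \<in> V}"
    proof (cases "V = {}")
      case False
      assume "V \<noteq> {} \<Longrightarrow> \<exists>t :: nat \<Rightarrow> real. decseq t \<and> V = (\<Union>n. {v. t n \<le> \<bar>v\<bar>})"
      then obtain t :: "nat \<Rightarrow> real" where t: "decseq t" "V = (\<Union>n. {v. t n \<le> \<bar>v\<bar>})"
        using False by blast
      have sup: "emeasure L {x \<in> space L. Z x \<in> V} = (SUP n. emeasure L {x \<in> space L. t n \<le> \<bar>Z x\<bar>})"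
        if [measurable]: "Z \<in> borel_measurable L" for L :: "'c measure" and Z
      proof -
        have "{x \<in> space L. Z x \<in> V} = (\<Union>n. {x \<in> space L. t n \<le> \<bar>Z x\<bar>})"
          using t(2) by auto
        moreover have "incseq (\<lambda>n. {x \<in> space L. t n \<le> \<bar>Z x\<bar>})"
          using t(1) by (auto simp: incseq_def decseq_def intro: order_trans)
        ultimately show ?thesis
          by (subst SUP_emeasure_incseq) auto
      qed
      show ?thesis
        unfolding sup [OF X] sup [OF Y] by (intro SUP_mono') (rule tail)
    qed simp
    moreover have int: "(\<integral>\<^sup>+x. f s (Z x) \<partial>L) = emeasure L {x \<in> space L. Z x \<in> V}"
      if [measurable]: "Z \<in> borel_measurable L" for L :: "'c measure" and Z
    proof -
      have m: "{x \<in> space L. Z x \<in> V} \<in> sets L" unfolding V_def by measurable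
      have "(\<integral>\<^sup>+x. f s (Z x) \<partial>L) = (\<integral>\<^sup>+x. indicator {x \<in> space L. Z x \<in> V} x \<partial>L)"
        by (intro nn_integral_cong) (auto simp: f_def V_def)
      then show ?thesis using m by simp
    qed
    ultimately show ?thesis unfolding int [OF X] int [OF Y] by simp
  qed
  have "(\<integral>\<^sup>+x. F (X x) \<partial>M) = (\<integral>\<^sup>+x. (\<integral>\<^sup>+s. f s (X x) \<partial>lborel) \<partial>M)"
    by (simp add: F_eq)
  also have "\<dots> = (\<integral>\<^sup>+s. (\<integral>\<^sup>+x. f s (X x) \<partial>M) \<partial>lborel)"
    by (rule PM.Fubini' [symmetric]) (unfold f_def, measurable)
  also have "\<dots> \<le> (\<integral>\<^sup>+s. (\<integral>\<^sup>+y. f s (Y y) \<partial>N) \<partial>lborel)"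
    by (intro nn_integral_mono sect)
  also have "\<dots> = (\<integral>\<^sup>+y. (\<integral>\<^sup>+s. f s (Y y) \<partial>lborel) \<partial>N)"
    by (rule PN.Fubini') (unfold f_def, measurable)
  also have "\<dots> = (\<integral>\<^sup>+y. F (Y y) \<partial>N)"
    by (simp add: F_eq)
  finally show ?thesis .
qed

section \<open>Tails of the one-dimensional Gaussian\<close>

definition gtail :: "real \<Rightarrow> real" where
  "gtail t = measure gauss {x. t \<le> \<bar>x\<bar>}"

lemma emeasure_gauss: "A \<in> sets borel \<Longrightarrow> emeasure gauss A = (\<integral>\<^sup>+x. ennreal (std_normal_density x) * indicator A x \<partial>lborel)"
  by (simp add: gauss_def emeasure_density)

lemma measure_gauss_flip: "measure gauss {..-t} = measure gauss {t..}"
proof -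
  have "emeasure gauss {..-t} = (\<integral>\<^sup>+x. ennreal (std_normal_density x) * indicator {..-t} x \<partial>lborel)"
    by (rule emeasure_gauss) simp
  also have "\<dots> = (\<integral>\<^sup>+x. ennreal (std_normal_density (-x)) * indicator {..-t} (-x) \<partial>lborel)"
    by (subst nn_integral_real_affine [where c = "-1" and t = 0]) auto
  also have "\<dots> = (\<integral>\<^sup>+x. ennreal (std_normal_density x) * indicator {t..} x \<partial>lborel)"
    by (intro nn_integral_cong) (auto simp: std_normal_density_def indicator_def)
  also have "\<dots> = emeasure gauss {t..}"
    by (rule emeasure_gauss [symmetric]) simp
  finally show ?thesis by (simp add: gauss.emeasure_eq_measure)
qed

lemma gtail_nonpos: "t \<le> 0 \<Longrightarrow> gtail t = 1"
proof -
  assume "t \<le> 0"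
  then have "{x::real. t \<le> \<bar>x\<bar>} = UNIV" by auto
  then show ?thesis using gauss.prob_space by (simp add: gtail_def)
qed

lemma gtail_eq: "t > 0 \<Longrightarrow> gtail t = 2 * measure gauss {t..}"
proof -
  assume "t > 0"
  then have "{x::real. t \<le> \<bar>x\<bar>} = {..-t} \<union> {t..}" "{..-t} \<inter> {t..} = {}" by auto
  then have "gtail t = measure gauss {..-t} + measure gauss {t..}"
    unfolding gtail_def by (subst gauss.finite_measure_Union [symmetric]) auto
  then show ?thesis by (simp add: measure_gauss_flip)
qed

lemma measure_gauss_nonneg_half: "measure gauss {0..} = 1/2"
proof -
  have "measure gauss {..0} + measure gauss {0<..} = measure gauss ({..0} \<union> {0<..})"
    by (rule gauss.finite_measure_Union [symmetric]) auto
  also have "{..0} \<union> {0<..} = (UNIV :: real set)" by auto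
  also have "measure gauss UNIV = 1" using gauss.prob_space by simp
  finally have 1: "measure gauss {..0} + measure gauss {0<..} = 1" .
  have "measure gauss {0::real} + measure gauss {0<..} = measure gauss ({0} \<union> {0<..})"
    by (rule gauss.finite_measure_Union [symmetric]) auto
  also have "{0::real} \<union> {0<..} = {0..}" by auto
  also have "measure gauss {0::real} = 0" using emeasure_gauss_singleton [of 0] by (simp add: measure_def)
  finally show ?thesis using 1 measure_gauss_flip [of 0] by simp
qed

text \<open>Shifting the Gaussian by \<open>t\<close> reweights it by the decreasing function \<open>exp (- t x)\<close>, which is
  smaller on \<open>{t..}\<close> than on \<open>{0..<t}\<close>.\<close>

lemma gtail_double: "gtail (2 * t) \<le> (gtail t)\<^sup>2"
proof (cases "t > 0")
  case True
  define w where "w x = exp (- t * x)" for x :: real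
  have int: "integrable gauss (\<lambda>x. w x * indicator A x)" if "A \<in> sets borel" "A \<subseteq> {0..}" for A
  proof (rule gauss.integrable_const_bound [where B = 1])
    show "AE x in gauss. norm (w x * indicator A x) \<le> 1"
      using that(2) True by (intro always_eventually) (auto simp: w_def indicator_def)
    have [measurable]: "w \<in> borel_measurable borel" unfolding w_def by measurable
    show "(\<lambda>x. w x * indicator A x) \<in> borel_measurable gauss" using that(1) by measurable
  qed
  have shift: "measure gauss {a + t..} = exp (- t\<^sup>2 / 2) * (\<integral>x. w x * indicator {a..} x \<partial>gauss)" if "a \<ge> 0" for a
  proof -
    have "emeasure gauss {a + t..} = (\<integral>\<^sup>+x. ennreal (std_normal_density x) * indicator {a + t..} x \<partial>lborel)"
      by (rule emeasure_gauss) simp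
    also have "\<dots> = (\<integral>\<^sup>+x. ennreal (std_normal_density (t + x)) * indicator {a + t..} (t + x) \<partial>lborel)"
      by (subst nn_integral_real_affine [where c = 1 and t = t]) auto
    also have "\<dots> = (\<integral>\<^sup>+x. ennreal (std_normal_density x) * ennreal (exp (- t\<^sup>2 / 2) * (w x * indicator {a..} x)) \<partial>lborel)"
    proof (intro nn_integral_cong)
      fix x :: real
      have "- ((t + x)\<^sup>2) / 2 = - x\<^sup>2 / 2 + (- t\<^sup>2 / 2 + - t * x)"
        by (simp add: power2_eq_square field_simps)
      then have "std_normal_density (t + x) = std_normal_density x * (exp (- t\<^sup>2 / 2) * w x)"
        by (simp only: std_normal_density_def w_def exp_add mult.assoc)
      then show "ennreal (std_normal_density (t + x)) * indicator {a + t..} (t + x) =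
         ennreal (std_normal_density x) * ennreal (exp (- t\<^sup>2 / 2) * (w x * indicator {a..} x))"
        by (auto simp: indicator_def ennreal_mult [symmetric] w_def)
    qed
    also have "\<dots> = (\<integral>\<^sup>+x. ennreal (exp (- t\<^sup>2 / 2) * (w x * indicator {a..} x)) \<partial>gauss)"
      unfolding gauss_def by (subst nn_integral_density) (auto simp: w_def)
    also have "\<dots> = ennreal (\<integral>x. exp (- t\<^sup>2 / 2) * (w x * indicator {a..} x) \<partial>gauss)"
      using that int [of "{a..}"] by (intro nn_integral_eq_integral) (auto simp: w_def)
    also have "\<dots> = ennreal (exp (- t\<^sup>2 / 2) * (\<integral>x. w x * indicator {a..} x \<partial>gauss))"
      by simp
    finally show ?thesis
      by (subst (asm) gauss.emeasure_eq_measure, subst (asm) ennreal_inj) (auto intro!: mult_nonneg_nonneg integral_nonneg simp: w_def)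
  qed
  define p0 pt where "p0 = measure gauss {0..}" and "pt = measure gauss {t..}"
  define A C where "A = (\<integral>x. w x * indicator {t..} x \<partial>gauss)" and "C = (\<integral>x. w x * indicator {0..<t} x \<partial>gauss)"
  have AC: "(\<integral>x. w x * indicator {0..} x \<partial>gauss) = A + C"
  proof -
    have "(\<integral>x. w x * indicator {0..} x \<partial>gauss) = (\<integral>x. w x * indicator {t..} x + w x * indicator {0..<t} x \<partial>gauss)"
      using True by (intro Bochner_Integration.integral_cong) (auto simp: indicator_def)
    also have "\<dots> = A + C"
      unfolding A_def C_def using True by (intro Bochner_Integration.integral_add int) auto
    finally show ?thesis .
  qed
  have pd: "measure gauss {0..<t} = p0 - pt"
  proof -
    have "{0..} = {0..<t} \<union> {t..}" using True by auto
    then have "p0 = measure gauss {0..<t} + pt"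
      unfolding p0_def pt_def by (simp only:) (rule gauss.finite_measure_Union, auto)
    then show ?thesis by simp
  qed
  have int_c: "integrable gauss (\<lambda>x. exp (- t * t) * indicator A x)" if "A \<in> sets borel" for A
    using that by (intro integrable_mult_right integrable_real_indicator) (auto simp: less_top [symmetric])
  have A_le: "A \<le> exp (- t * t) * pt"
  proof -
    have "A \<le> (\<integral>x. exp (- t * t) * indicator {t..} x \<partial>gauss)"
      unfolding A_def using True
      by (intro integral_mono int int_c) (auto simp: w_def indicator_def)
    then show ?thesis by (simp add: pt_def)
  qed
  have C_ge: "C \<ge> exp (- t * t) * (p0 - pt)"
  proof -
    have "C \<ge> (\<integral>x. exp (- t * t) * indicator {0..<t} x \<partial>gauss)"
      unfolding C_def using True
      by (intro integral_mono int int_c) (auto simp: w_def indicator_def)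
    then show ?thesis by (simp add: pd)
  qed
  have pt0: "0 \<le> pt" "pt \<le> p0"
    using True pd measure_nonneg [of gauss "{0..<t}"] by (simp_all add: pt_def)
  \<comment> \<open>The mean of \<open>w\<close> over \<open>{t..}\<close> is at most
    \<open>exp (- t * t)\<close>, and its mean over \<open>{0..<t}\<close> is at least that; hence
    \<open>A\<close> has at most the share \<open>pt / p0\<close> of \<open>A + C\<close>.\<close>
  have "A * (p0 - pt) \<le> exp (- t * t) * pt * (p0 - pt)"
    using A_le pt0 by (intro mult_right_mono) auto
  also have "\<dots> = exp (- t * t) * (p0 - pt) * pt" by simp
  also have "\<dots> \<le> C * pt" using C_ge pt0 by (intro mult_right_mono) auto
  finally have "A * p0 \<le> (A + C) * pt" by (simp add: algebra_simps)
  then have "exp (- t\<^sup>2 / 2) * (A * p0) \<le> exp (- t\<^sup>2 / 2) * ((A + C) * pt)"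
    by (intro mult_left_mono) auto
  \<comment> \<open>By \<open>shift\<close>, the masses of \<open>{2 * t..}\<close> and
    \<open>{t..}\<close> are \<open>A\<close> and \<open>A + C\<close> up to a common factor. As
    \<open>p0\<close> is 1/2, passing to two-sided tails absorbs the constants exactly.\<close>
  then have "measure gauss {2 * t..} * p0 \<le> pt * pt"
    using shift [of t] shift [of 0] True by (simp add: A_def [symmetric] AC pt_def mult_ac)
  then show ?thesis
    using True measure_gauss_nonneg_half by (simp add: gtail_eq p0_def pt_def power2_eq_square)
qed (simp add: gtail_nonpos)

text \<open>Only the mass of \<open>{u..u + 1}\<close>, which lies below \<open>2 * u\<close>, is
  counted. The exponent is weakened from 2 to 4 to absorb the factor 3, and the resulting form meets
  \<open>rademacher_tail\<close> at \<open>t = 4 * u\<close>.\<close>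

lemma gtail_ge:
  assumes "u \<ge> 1"
  shows "gtail u \<ge> 2 * exp (- 4 * u\<^sup>2)"
proof -
  have lo: "std_normal_density x \<ge> exp (- 2 * u\<^sup>2) / 3" if "x \<in> {u..u + 1}" for x
  proof -
    have "x\<^sup>2 \<le> (2 * u)\<^sup>2" using that assms by (intro power_mono) auto
    then have "exp (- 2 * u\<^sup>2) \<le> exp (- x\<^sup>2 / 2)" by (simp add: power_mult_distrib)
    moreover have "sqrt (2 * pi) \<le> 3" using pi_less_4 by (intro real_le_lsqrt) auto
    then have "1 / 3 \<le> 1 / sqrt (2 * pi)" by (intro divide_left_mono) auto
    ultimately have "1 / 3 * exp (- 2 * u\<^sup>2) \<le> 1 / sqrt (2 * pi) * exp (- x\<^sup>2 / 2)"
      by (intro mult_mono) auto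
    then show ?thesis by (simp add: std_normal_density_def)
  qed
  have "ennreal (exp (- 2 * u\<^sup>2) / 3) = (\<integral>\<^sup>+x. ennreal (exp (- 2 * u\<^sup>2) / 3) * indicator {u..u + 1} x \<partial>lborel)"
    by (subst nn_integral_cmult_indicator) auto
  also have "\<dots> \<le> (\<integral>\<^sup>+x. ennreal (std_normal_density x) * indicator {u..} x \<partial>lborel)"
    by (intro nn_integral_mono) (use lo in \<open>auto simp: indicator_def intro!: ennreal_leI\<close>)
  also have "\<dots> = emeasure gauss {u..}" by (rule emeasure_gauss [symmetric]) simp
  finally have "exp (- 2 * u\<^sup>2) / 3 \<le> measure gauss {u..}"
    by (simp add: gauss.emeasure_eq_measure)
  then have "gtail u \<ge> 2 * (exp (- 2 * u\<^sup>2) / 3)" using assms by (simp add: gtail_eq)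
  moreover have "exp (- 2 * u\<^sup>2) / 3 \<ge> exp (- 4 * u\<^sup>2)"
  proof -
    have "1 \<le> u\<^sup>2" using assms by simp
    then have "3 \<le> exp (2 * u\<^sup>2)" using exp_ge_add_one_self [of "2 * u\<^sup>2"] by linarith
    then have "3 * exp (- 4 * u\<^sup>2) \<le> exp (2 * u\<^sup>2) * exp (- 4 * u\<^sup>2)" by (intro mult_right_mono) auto
    also have "\<dots> = exp (- 2 * u\<^sup>2)" by (simp add: exp_add [symmetric])
    finally show ?thesis by simp
  qed
  ultimately show ?thesis by simp
qed

text \<open>The density is at most 1/2 on an interval of length 1. Hence a fair coin with values 0
  and 1/2 is dominated by the absolute value of a Gaussian.\<close>

lemma gtail_half: "gtail (1/2) \<ge> 1/2"
proof -
  have "emeasure gauss {-1/2<..<1/2} = (\<integral>\<^sup>+x. ennreal (std_normal_density x) * indicator {-1/2<..<1/2} x \<partial>lborel)"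
    by (rule emeasure_gauss) simp
  also have "\<dots> \<le> (\<integral>\<^sup>+x. ennreal (1/2) * indicator {-1/2<..<1/2::real} x \<partial>lborel)"
  proof (intro nn_integral_mono mult_right_mono ennreal_leI)
    fix x :: real
    have "2 \<le> sqrt (2 * pi)" using pi_gt3 by (intro real_le_rsqrt) auto
    then have "1 / sqrt (2 * pi) \<le> 1 / 2" by (intro divide_left_mono) auto
    then have "1 / sqrt (2 * pi) * exp (- x\<^sup>2 / 2) \<le> 1 / 2 * 1" by (intro mult_mono) auto
    then show "std_normal_density x \<le> 1/2" by (simp add: std_normal_density_def)
  qed simp
  also have "\<dots> = ennreal (1/2)" by (subst nn_integral_cmult_indicator) auto
  finally have 1: "measure gauss {-1/2<..<1/2} \<le> 1/2"
    by (simp only: gauss.emeasure_eq_measure) (subst (asm) ennreal_le_iff, simp_all)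
  have "{x::real. 1/2 \<le> \<bar>x\<bar>} = space gauss - {-1/2<..<1/2}" by auto
  then have "gtail (1/2) = 1 - measure gauss {-1/2<..<1/2}"
    unfolding gtail_def by (simp only:) (rule gauss.prob_compl, simp)
  with 1 show ?thesis by simp
qed

section \<open>Sets increasing in the absolute value of every coordinate\<close>

definition upset :: "nat set \<Rightarrow> rvec set \<Rightarrow> bool" where
  "upset I U \<longleftrightarrow> (\<forall>x\<in>extensional I. \<forall>y\<in>extensional I. (\<forall>i\<in>I. \<bar>x i\<bar> \<le> \<bar>y i\<bar>) \<longrightarrow> x \<in> U \<longrightarrow> y \<in> U)"

lemma upsetD: "upset I U \<Longrightarrow> x \<in> U \<Longrightarrow> x \<in> extensional I \<Longrightarrow> y \<in> extensional I \<Longrightarrow> (\<And>i. i \<in> I \<Longrightarrow> \<bar>x i\<bar> \<le> \<bar>y i\<bar>) \<Longrightarrow> y \<in> U"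
  by (auto simp: upset_def)

lemma space_PiM_gauss: "space (pgauss I) = extensional I"
  by (simp add: space_PiM PiE_def)

lemma sets_PiM_gauss [measurable_cong]: "sets (pgauss I) = sets (pborel I)"
  by (rule sets_PiM_cong) auto

lemma fun_upd_extensional: "x \<in> extensional I \<Longrightarrow> x(i := y) \<in> extensional (insert i I)"
  by (auto simp: extensional_def)

lemma upset_section_mono:
  assumes U: "upset (insert i I) U" and i: "i \<notin> I" and ab: "\<bar>a\<bar> \<le> \<bar>b\<bar>"
    and x: "x \<in> extensional I" "y \<in> extensional I" "\<And>j. j \<in> I \<Longrightarrow> \<bar>x j\<bar> \<le> \<bar>y j\<bar>" and "x(i := a) \<in> U"
  shows "y(i := b) \<in> U"
  by (rule upsetD [OF U \<open>x(i := a) \<in> U\<close>]) (use assms in \<open>auto intro: fun_upd_extensional\<close>)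

definition fsec :: "nat set \<Rightarrow> nat \<Rightarrow> rvec set \<Rightarrow> real \<Rightarrow> rvec set" where
  "fsec I i U y = {x \<in> extensional I. x(i := y) \<in> U}"

lemma fsec_sets:
  assumes [measurable]: "U \<in> sets (pborel (insert i I))"
  shows "fsec I i U y \<in> sets (pborel I)"
proof -
  have "fsec I i U y = {x \<in> space (pborel I). x(i := y) \<in> U}" by (simp add: fsec_def space_PiM PiE_def)
  also have "\<dots> \<in> sets (pborel I)" by measurable
  finally show ?thesis .
qed

lemma fsec_upset: "upset (insert i I) U \<Longrightarrow> i \<notin> I \<Longrightarrow> upset I (fsec I i U y)"
  using upset_section_mono [OF _ _ order.refl] unfolding upset_def [of I] fsec_def by blast

lemma emeasure_gauss_abs: "emeasure gauss {x. t \<le> \<bar>x\<bar>} = ennreal (gtail t)"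
  by (simp add: gtail_def gauss.emeasure_eq_measure)

text \<open>By \<open>gtail_double\<close>, \<open>y / 2\<close> is dominated by the minimum of two
  independent copies. At the minimum each factor is bounded by its value at a copy of its own, and
  the integral of the product splits.\<close>

lemma gauss_half_correlation:
  fixes a b :: "real \<Rightarrow> ennreal"
  assumes [measurable]: "a \<in> borel_measurable borel" "b \<in> borel_measurable borel"
    and a: "\<And>s t. \<bar>s\<bar> \<le> \<bar>t\<bar> \<Longrightarrow> a s \<le> a t" and b: "\<And>s t. \<bar>s\<bar> \<le> \<bar>t\<bar> \<Longrightarrow> b s \<le> b t"
  shows "(\<integral>\<^sup>+y. a (y / 2) * b (y / 2) \<partial>gauss) \<le> (\<integral>\<^sup>+y. a y \<partial>gauss) * (\<integral>\<^sup>+y. b y \<partial>gauss)"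
proof -
  interpret G: pair_prob_space gauss gauss ..
  have "(\<integral>\<^sup>+y. a (y / 2) * b (y / 2) \<partial>gauss)
     \<le> (\<integral>\<^sup>+p. a (min \<bar>fst p\<bar> \<bar>snd p\<bar>) * b (min \<bar>fst p\<bar> \<bar>snd p\<bar>) \<partial>(gauss \<Otimes>\<^sub>M gauss))"
  proof (rule upset_nn_integral_mono [where F = "\<lambda>y. a y * b y" and X = "\<lambda>y. y / 2"])
    show "prob_space gauss" "prob_space (gauss \<Otimes>\<^sub>M gauss)" by unfold_locales
    fix t :: real
    have "emeasure gauss {x \<in> space gauss. t \<le> \<bar>x / 2\<bar>} = ennreal (gtail (2 * t))"
      using emeasure_gauss_abs [of "2 * t"] by (simp add: field_simps)
    also have "\<dots> \<le> ennreal (gtail t * gtail t)"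
      using gtail_double [of t] by (intro ennreal_leI) (simp add: power2_eq_square)
    also have "\<dots> = emeasure gauss {x. t \<le> \<bar>x\<bar>} * emeasure gauss {x. t \<le> \<bar>x\<bar>}"
      by (simp add: emeasure_gauss_abs gtail_def ennreal_mult)
    also have "\<dots> = emeasure (gauss \<Otimes>\<^sub>M gauss) ({x. t \<le> \<bar>x\<bar>} \<times> {x. t \<le> \<bar>x\<bar>})"
      by (rule gauss.emeasure_pair_measure_Times [symmetric]) simp_all
    also have "{x. t \<le> \<bar>x\<bar>} \<times> {x. t \<le> \<bar>x\<bar>} = {p \<in> space (gauss \<Otimes>\<^sub>M gauss). t \<le> \<bar>min \<bar>fst p\<bar> \<bar>snd p\<bar>\<bar>}"
      by (auto simp: space_pair_measure)
    finally show "emeasure gauss {x \<in> space gauss. t \<le> \<bar>x / 2\<bar>} \<le> emeasure (gauss \<Otimes>\<^sub>M gauss) {p \<in> space (gauss \<Otimes>\<^sub>M gauss). t \<le> \<bar>min \<bar>fst p\<bar> \<bar>snd p\<bar>\<bar>}" .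
  qed (auto intro!: mult_mono a b)
  also have "\<dots> \<le> (\<integral>\<^sup>+p. a (fst p) * b (snd p) \<partial>(gauss \<Otimes>\<^sub>M gauss))"
    by (intro nn_integral_mono mult_mono a b) auto
  also have "\<dots> = (\<integral>\<^sup>+x. (\<integral>\<^sup>+y. a x * b y \<partial>gauss) \<partial>gauss)"
    by (subst gauss.nn_integral_fst [symmetric]) auto
  also have "\<dots> = (\<integral>\<^sup>+y. a y \<partial>gauss) * (\<integral>\<^sup>+y. b y \<partial>gauss)"
    by (simp add: nn_integral_cmult nn_integral_multc)
  finally show ?thesis .
qed

text \<open>Induction on the coordinates: with one of them fixed at \<open>y / 2\<close>, the
  hypothesis for the sections yields the product of their measures, two functions increasing in the
  absolute value of \<open>y\<close>, and the one-dimensional case applies.\<close>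

lemma gaussn_half_correlation:
  assumes "finite I" and "U \<in> sets (pborel I)" "V \<in> sets (pborel I)" "upset I U" "upset I V"
  shows "(\<integral>\<^sup>+x. indicator (U \<inter> V) (\<lambda>i\<in>I. x i / 2) \<partial>pgauss I)
     \<le> emeasure (pgauss I) U * emeasure (pgauss I) V"
  using assms
proof (induction I arbitrary: U V rule: finite_induct)
  case empty
  have 1: "emeasure (pgauss {}) W = indicator W (\<lambda>_. undefined)" if "W \<in> sets (pborel {})" for W
  proof -
    have "emeasure (pgauss {}) W = (\<integral>\<^sup>+x. indicator W x \<partial>pgauss {})"
      using that by (subst nn_integral_indicator) (simp_all add: sets_PiM_gauss)
    then show ?thesis by (simp only: PiM_empty nn_integral_count_space_finite finite.intros) simp
  qed
  have "emeasure (pgauss {}) (space (pgauss {})) = 1"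
    by (intro prob_space.emeasure_space_1 prob_space_PiM prob_space_gauss)
  then show ?case
    using empty by (simp add: 1) (simp add: indicator_def)
next
  case (insert i I)
  note [measurable] = insert.prems(1,2)
  define a where "a W y = emeasure (pgauss I) (fsec I i W y)" for W y
  have a_eq: "a W y = (\<integral>\<^sup>+x. indicator W (x(i := y)) \<partial>pgauss I)" if "W \<in> sets (pborel (insert i I))" for W y
  proof -
    have "a W y = (\<integral>\<^sup>+x. indicator (fsec I i W y) x \<partial>pgauss I)"
      unfolding a_def using fsec_sets [OF that] by (subst nn_integral_indicator) (simp_all add: sets_PiM_gauss)
    also have "\<dots> = (\<integral>\<^sup>+x. indicator W (x(i := y)) \<partial>pgauss I)"
      by (intro nn_integral_cong) (auto simp: fsec_def indicator_def space_PiM_gauss)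
    finally show ?thesis .
  qed
  have a_meas: "a W \<in> borel_measurable borel" if [measurable]: "W \<in> sets (pborel (insert i I))" for W
  proof -
    interpret I: prob_space "pgauss I" by (rule prob_space_PiM) (rule prob_space_gauss)
    have "(\<lambda>y. (\<integral>\<^sup>+x. indicator W (x(i := y)) \<partial>pgauss I)) \<in> borel_measurable borel"
      by measurable
    then show ?thesis by (simp add: a_eq [OF that, abs_def])
  qed
  have a_mono: "a W s \<le> a W t" if "upset (insert i I) W" "W \<in> sets (pborel (insert i I))" "\<bar>s\<bar> \<le> \<bar>t\<bar>" for W s t
    unfolding a_def
  proof (rule emeasure_mono)
    show "fsec I i W s \<subseteq> fsec I i W t"
      unfolding fsec_def using upset_section_mono [OF that(1) insert.hyps(2) that(3)] by blast
    show "fsec I i W t \<in> sets (pgauss I)" using fsec_sets [OF that(2)] by (simp add: sets_PiM_gauss)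
  qed
  have total: "(\<integral>\<^sup>+y. a W y \<partial>gauss) = emeasure (pgauss (insert i I)) W" if W [measurable]: "W \<in> sets (pborel (insert i I))" for W
  proof -
    have "emeasure (pgauss (insert i I)) W = (\<integral>\<^sup>+x. indicator W x \<partial>pgauss (insert i I))"
      using W by (subst nn_integral_indicator) (simp_all add: sets_PiM_gauss)
    also have "\<dots> = (\<integral>\<^sup>+y. (\<integral>\<^sup>+x. indicator W (x(i := y)) \<partial>pgauss I) \<partial>gauss)"
      using insert.hyps by (intro gauss_prod.product_nn_integral_insert_rev) measurable
    finally show ?thesis by (simp add: a_eq [OF W])
  qed
  have ext: "(\<lambda>j\<in>insert i I. (x(i := y)) j / 2) = (\<lambda>j\<in>I. x j / 2)(i := y / 2)" for x :: rvec and y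
    using insert.hyps by (auto simp: fun_eq_iff)
  have "(\<integral>\<^sup>+x. indicator (U \<inter> V) (\<lambda>j\<in>insert i I. x j / 2) \<partial>pgauss (insert i I))
      = (\<integral>\<^sup>+y. (\<integral>\<^sup>+x. indicator (U \<inter> V) (\<lambda>j\<in>insert i I. (x(i := y)) j / 2) \<partial>pgauss I) \<partial>gauss)"
    using insert.hyps by (intro gauss_prod.product_nn_integral_insert_rev) measurable
  also have "\<dots> = (\<integral>\<^sup>+y. (\<integral>\<^sup>+x. indicator (fsec I i U (y / 2) \<inter> fsec I i V (y / 2)) (\<lambda>j\<in>I. x j / 2) \<partial>pgauss I) \<partial>gauss)"
    unfolding ext by (intro nn_integral_cong) (auto simp: fsec_def indicator_def)
  also have "\<dots> \<le> (\<integral>\<^sup>+y. a U (y / 2) * a V (y / 2) \<partial>gauss)"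
    unfolding a_def using insert.prems by (intro nn_integral_mono insert.IH fsec_sets fsec_upset insert.hyps)
  also have "\<dots> \<le> (\<integral>\<^sup>+y. a U y \<partial>gauss) * (\<integral>\<^sup>+y. a V y \<partial>gauss)"
    using insert.prems by (intro gauss_half_correlation a_meas a_mono)
  finally show ?case unfolding total [OF insert.prems(1)] total [OF insert.prems(2)] .
qed

text \<open>Coordinates are exchanged for Gaussian ones one at a time; given one coordinate, the
  probability is increasing in its absolute value, as \<open>upset_nn_integral_mono\<close>
  requires. The map \<open>\<phi>\<close> admits a deformed Gaussian as the dominating
  variable.\<close>

lemma Pi_pmf_gauss_domination:
  fixes p :: "nat \<Rightarrow> 'a pmf" and X :: "nat \<Rightarrow> 'a \<Rightarrow> real"
  assumes "finite I" and "U \<in> sets (pborel I)" "upset I U"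
    and phi [measurable]: "\<phi> \<in> borel_measurable borel"
    and tail: "\<And>i t. i \<in> I \<Longrightarrow> measure_pmf.prob (p i) {a. t \<le> \<bar>X i a\<bar>} \<le> measure gauss {y. t \<le> \<bar>\<phi> y\<bar>}"
  shows "(\<integral>\<^sup>+f. indicator U (\<lambda>i\<in>I. X i (f i)) \<partial>Pi_pmf I d p)
     \<le> (\<integral>\<^sup>+x. indicator U (\<lambda>i\<in>I. \<phi> (x i)) \<partial>pgauss I)"
  using assms(1,2,3) tail
proof (induction I arbitrary: U rule: finite_induct)
  case empty
  have "emeasure (pgauss {}) (space (pgauss {})) = 1"
    by (intro prob_space.emeasure_space_1 prob_space_PiM prob_space_gauss)
  then show ?case by (simp add: restrict_def)
next
  case (insert i I)
  note [measurable] = insert.prems(1)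
  define F where "F y = (\<integral>\<^sup>+x. indicator U ((\<lambda>j\<in>I. \<phi> (x j))(i := y)) \<partial>pgauss I)" for y
  interpret I: prob_space "pgauss I" by (rule prob_space_PiM) (rule prob_space_gauss)
  have F_meas: "F \<in> borel_measurable borel"
    unfolding F_def by measurable
  have F_mono: "F s \<le> F t" if "\<bar>s\<bar> \<le> \<bar>t\<bar>" for s t
    unfolding F_def
    using upset_section_mono [OF insert.prems(2) insert.hyps(2) that, where x = "\<lambda>j\<in>I. _ j" and y = "\<lambda>j\<in>I. _ j"]
    by (intro nn_integral_mono) (auto simp: indicator_def split: if_splits)
  have ext: "(\<lambda>j\<in>insert i I. X j ((f(i := y)) j)) = (\<lambda>j\<in>I. X j (f j))(i := X i y)" for f y
    using insert.hyps by (auto simp: fun_eq_iff)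
  have ext': "(\<lambda>j\<in>insert i I. \<phi> ((x(i := y)) j)) = (\<lambda>j\<in>I. \<phi> (x j))(i := \<phi> y)" for x y
    using insert.hyps by (auto simp: fun_eq_iff)
  have "(\<integral>\<^sup>+f. indicator U (\<lambda>j\<in>insert i I. X j (f j)) \<partial>Pi_pmf (insert i I) d p)
     = (\<integral>\<^sup>+y. (\<integral>\<^sup>+f. indicator U (\<lambda>j\<in>insert i I. X j ((f(i := y)) j)) \<partial>Pi_pmf I d p) \<partial>p i)"
    using insert.hyps by (simp add: Pi_pmf_insert nn_integral_pair_pmf' case_prod_unfold del: fun_upd_apply)
  also have "\<dots> = (\<integral>\<^sup>+y. (\<integral>\<^sup>+f. indicator (fsec I i U (X i y)) (\<lambda>j\<in>I. X j (f j)) \<partial>Pi_pmf I d p) \<partial>p i)"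
    unfolding ext by (intro nn_integral_cong) (auto simp: fsec_def indicator_def)
  also have "\<dots> \<le> (\<integral>\<^sup>+y. (\<integral>\<^sup>+x. indicator (fsec I i U (X i y)) (\<lambda>j\<in>I. \<phi> (x j)) \<partial>pgauss I) \<partial>p i)"
    using insert.prems by (intro nn_integral_mono insert.IH fsec_sets fsec_upset insert.hyps) auto
  also have "\<dots> = (\<integral>\<^sup>+y. F (X i y) \<partial>p i)"
    unfolding F_def by (intro nn_integral_cong) (auto simp: fsec_def indicator_def)
  also have "\<dots> \<le> (\<integral>\<^sup>+y. F (\<phi> y) \<partial>gauss)"
    using insert.prems(3) [of i]
    by (intro upset_nn_integral_mono F_meas F_mono)
       (auto simp: measure_pmf.emeasure_eq_measure gauss.emeasure_eq_measure measure_pmf.prob_space_axioms prob_space_gauss)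
  also have "\<dots> = (\<integral>\<^sup>+x. indicator U (\<lambda>j\<in>insert i I. \<phi> (x j)) \<partial>pgauss (insert i I))"
    unfolding F_def ext' [symmetric]
    using insert.hyps by (intro gauss_prod.product_nn_integral_insert_rev [symmetric]) measurable
  finally show ?case .
qed

section \<open>The norm of a Gaussian vector and of the all-ones vector\<close>

context sym_norm
begin

lemma upset_nu: "upset {..<k} {x \<in> Rn k. t < \<nu> x}"
  unfolding upset_def using nu_mono by (fastforce intro: less_le_trans)

lemma superlevel_sets: "{x \<in> Rn k. t < \<nu> x} \<in> sets (vborel k)"
proof -
  have "{x \<in> Rn k. t < \<nu> x} = {x \<in> space (vborel k). t < \<nu> x}" by (simp add: space_PiM PiE_def)
  also have "\<dots> \<in> sets (vborel k)" by measurable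
  finally show ?thesis .
qed

text \<open>Halving a Gaussian vector makes it stochastically smaller than the coordinatewise minimum
  of two independent copies.\<close>

lemma prob_gaussn_double: "\<P>(x in gaussn k. 2 * t < \<nu> x) \<le> (\<P>(x in gaussn k. t < \<nu> x))\<^sup>2"
proof -
  let ?U = "{x \<in> Rn k. t < \<nu> x}"
  have half: "\<nu> (\<lambda>i\<in>{..<k}. x i / 2) = \<nu> x / 2" for x
    using nu_scale [of "1/2" x] by (simp add: nu_restrict)
  have "emeasure (gaussn k) {x \<in> Rn k. 2 * t < \<nu> x} = (\<integral>\<^sup>+x. indicator {x \<in> Rn k. 2 * t < \<nu> x} x \<partial>gaussn k)"
    using superlevel_sets by (intro nn_integral_indicator [symmetric]) simp
  also have "\<dots> = (\<integral>\<^sup>+x. indicator (?U \<inter> ?U) (\<lambda>i\<in>{..<k}. x i / 2) \<partial>pgauss {..<k})"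
    unfolding gaussn_def
    by (intro nn_integral_cong) (auto simp: indicator_def half space_PiM_gauss)
  also have "\<dots> \<le> emeasure (pgauss {..<k}) ?U * emeasure (pgauss {..<k}) ?U"
    by (intro gaussn_half_correlation superlevel_sets upset_nu) simp
  finally show ?thesis
    by (simp add: gaussn_def [symmetric] gaussn.emeasure_eq_measure ennreal_mult [symmetric] power2_eq_square)
qed

lemma prob_gaussn_large: "\<P>(x in gaussn k. 64 * (sqrt (real k) * Med) < \<nu> x) \<le> 1/1000"
proof -
  define T where "T = sqrt (real k) * Med"
  have step: "\<P>(x in gaussn k. 2 * t < \<nu> x) \<le> q\<^sup>2" if "\<P>(x in gaussn k. t < \<nu> x) \<le> q" for t q
    using prob_gaussn_double [of t] power_mono [OF that, of 2] by simp
  have "\<P>(x in gaussn k. 2 * T < \<nu> x) \<le> 3/4"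
    using prob_gaussn_le_median by (simp add: T_def mult_ac)
  \<comment> \<open>Five doublings lead from \<open>2 * T\<close> to \<open>64 * T\<close>, and five
    squarings from 3/4 to its 32nd power, about 1/10000.\<close>
  from step [OF step [OF step [OF step [OF step [OF this]]]]]
  have "\<P>(x in gaussn k. 64 * T < \<nu> x) \<le> (((((3/4)\<^sup>2)\<^sup>2)\<^sup>2)\<^sup>2)\<^sup>2" by simp
  also have "\<dots> \<le> 1/1000" by (simp add: power2_eq_square)
  finally show ?thesis by (simp add: T_def)
qed

lemma Pi_pmf_flip:
  assumes "finite A"
  shows "map_pmf (\<lambda>f i. if i \<in> A then \<not> f i else False) (Pi_pmf A False (\<lambda>_. bernoulli_pmf (1/2))) = Pi_pmf A False (\<lambda>_. bernoulli_pmf (1/2))"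
proof -
  have 1: "map_pmf Not (bernoulli_pmf (1/2)) = bernoulli_pmf (1/2)"
  proof (rule pmf_eqI)
    fix b
    have "pmf (map_pmf Not (bernoulli_pmf (1/2))) (Not (Not b)) = pmf (bernoulli_pmf (1/2)) (Not b)"
      by (intro pmf_map_inj') (auto simp: inj_def)
    then show "pmf (map_pmf Not (bernoulli_pmf (1/2))) b = pmf (bernoulli_pmf (1/2)) b"
      by (cases b) simp_all
  qed
  have "Pi_pmf A False (\<lambda>_. bernoulli_pmf (1/2)) = Pi_pmf A False (\<lambda>_. map_pmf Not (bernoulli_pmf (1/2)))"
    by (simp only: 1)
  also have "\<dots> = map_pmf (\<lambda>f x. if x \<in> A then f x else False) (Pi_pmf A True (\<lambda>_. map_pmf Not (bernoulli_pmf (1/2))))"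
    by (rule Pi_pmf_default_swap [symmetric]) fact
  also have "Pi_pmf A True (\<lambda>_. map_pmf Not (bernoulli_pmf (1/2))) = map_pmf (\<lambda>h. Not \<circ> h) (Pi_pmf A False (\<lambda>_. bernoulli_pmf (1/2)))"
    using assms by (intro Pi_pmf_map) auto
  finally show ?thesis by (simp add: pmf.map_comp o_def)
qed

text \<open>A random set of coordinates and its complement add up to all of them, so, with entries
  1/2, a random set has norm at least a quarter of \<open>\<nu> (\<lambda>_. 1)\<close> with
  probability at least 1/2. By domination a Gaussian vector would then be too large too often; 256
  is four times the 64 of \<open>prob_gaussn_large\<close>.\<close>

lemma nu_ones_le: "\<nu> (\<lambda>_. 1) \<le> 256 * (sqrt (real k) * Med)"
proof (rule ccontr)
  define T where "T = 64 * (sqrt (real k) * Med)"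
  assume "\<not> ?thesis"
  then have T: "T < \<nu> (\<lambda>_. 1) / 4" by (simp add: T_def)
  define P where "P = Pi_pmf {..<k} False (\<lambda>_. bernoulli_pmf (1/2))"
  define w where "w f = \<nu> (\<lambda>i. if f i then 1/2 else 0 :: real)" for f :: "nat \<Rightarrow> bool"
  define fl where "fl f i = (if i \<in> {..<k} then \<not> f i else False)" for f :: "nat \<Rightarrow> bool" and i
  have sum: "w f + w (fl f) \<ge> \<nu> (\<lambda>_. 1) / 2" for f
  proof -
    have "\<nu> (\<lambda>_. 1) / 2 = \<nu> (\<lambda>_. 1/2)" using nu_scale [of "1/2" "\<lambda>_. 1"] by simp
    also have "\<dots> = \<nu> (\<lambda>i. (if f i then 1/2 else 0 :: real) + (if fl f i then 1/2 else 0))"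
      by (rule nu_cong) (simp add: fl_def)
    also have "\<dots> \<le> w f + w (fl f)" unfolding w_def by (rule nu_add)
    finally show ?thesis .
  qed
  have "1 \<le> measure_pmf.prob P ({f. T < w f} \<union> {f. T < w (fl f)})"
  proof -
    have "{f. T < w f} \<union> {f. T < w (fl f)} = UNIV"
      using sum T by (auto simp: not_less) (smt (verit) field_sum_of_halves)
    then show ?thesis by simp
  qed
  also have "\<dots> \<le> measure_pmf.prob P {f. T < w f} + measure_pmf.prob P {f. T < w (fl f)}"
    by (rule measure_Un_le) auto
  also have "measure_pmf.prob P {f. T < w (fl f)} = measure_pmf.prob (map_pmf fl P) {f. T < w f}"
    by (simp add: vimage_def)
  also have "map_pmf fl P = P"
    unfolding P_def fl_def [abs_def] by (rule Pi_pmf_flip) simp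
  finally have half: "1/2 \<le> measure_pmf.prob P {f. T < w f}" by simp
  have w_eq: "\<nu> (\<lambda>i\<in>{..<k}. if f i then 1/2 else 0) = w f" for f
    by (simp add: w_def nu_restrict)
  have "ennreal (1/2) \<le> emeasure (measure_pmf P) {f. T < w f}"
    using half by (simp only: measure_pmf.emeasure_eq_measure ennreal_leI)
  also have "\<dots> = (\<integral>\<^sup>+f. indicator {f. T < w f} f \<partial>P)" by simp
  also have "\<dots> = (\<integral>\<^sup>+f. indicator {x \<in> Rn k. T < \<nu> x} (\<lambda>i\<in>{..<k}. if f i then 1/2 else 0) \<partial>P)"
    by (intro nn_integral_cong) (simp add: indicator_def w_eq)
  also have "\<dots> \<le> (\<integral>\<^sup>+x. indicator {x \<in> Rn k. T < \<nu> x} (\<lambda>i\<in>{..<k}. x i) \<partial>pgauss {..<k})"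
    unfolding P_def
  proof (rule Pi_pmf_gauss_domination [where X = "\<lambda>_ b. if b then 1/2 else 0" and \<phi> = "\<lambda>y. y"])
    fix i t
    show "measure_pmf.prob (bernoulli_pmf (1/2)) {a. t \<le> \<bar>if a then 1/2 else 0 :: real\<bar>} \<le> measure gauss {y. t \<le> \<bar>y\<bar>}"
    proof (cases "t \<le> 0")
      case True
      then show ?thesis using gtail_nonpos [of t] by (simp add: gtail_def)
    next
      case False
      show ?thesis
      proof (cases "t \<le> 1/2")
        case True
        have "{a. t \<le> \<bar>if a then 1/2 else 0 :: real\<bar>} = {True}" using True False by auto
        then have "measure_pmf.prob (bernoulli_pmf (1/2)) {a. t \<le> \<bar>if a then 1/2 else 0 :: real\<bar>} = 1/2"
          by (simp add: measure_pmf_single)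
        also have "\<dots> \<le> gtail (1/2)" by (rule gtail_half)
        also have "\<dots> \<le> gtail t"
          unfolding gtail_def using True by (intro gauss.finite_measure_mono) auto
        finally show ?thesis by (simp add: gtail_def)
      next
        case False
        then have "{a. t \<le> \<bar>if a then 1/2 else 0 :: real\<bar>} = {}" using \<open>\<not> t \<le> 0\<close> by auto
        then show ?thesis by simp
      qed
    qed
  qed (use superlevel_sets upset_nu in auto)
  also have "\<dots> = (\<integral>\<^sup>+x. indicator {x \<in> Rn k. T < \<nu> x} x \<partial>gaussn k)"
    unfolding gaussn_def by (intro nn_integral_cong) (auto simp: space_PiM_gauss indicator_def extensional_restrict)
  also have "\<dots> = ennreal (\<P>(x in gaussn k. T < \<nu> x))"
    using superlevel_sets by (simp add: gaussn.emeasure_eq_measure)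
  also have "\<dots> \<le> ennreal (1/1000)"
    using prob_gaussn_large by (intro ennreal_leI) (simp add: T_def)
  finally show False by (subst (asm) ennreal_le_iff) simp_all
qed

lemma Med_pos: "Med > 0"
proof -
  have "\<nu> (\<lambda>_. 1) \<noteq> 0" using zero_less_k by (auto simp: nu_eq_0_iff)
  then have "0 < \<nu> (\<lambda>_. 1)" using nu_nonneg [of "\<lambda>_. 1"] by linarith
  with nu_ones_le have "0 < sqrt (real k) * Med" by linarith
  then show ?thesis using zero_less_mult_pos k_pos by (metis real_sqrt_gt_0_iff of_nat_0_less_iff zero_less_k)
qed

end

section \<open>Randomly signed sums\<close>

lemma rademacher_tail:
  fixes c :: "nat \<Rightarrow> real"
  assumes "finite J" and c: "(\<Sum>j\<in>J. (c j)\<^sup>2) \<le> 2" and t: "t > 0"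
  shows "measure_pmf.prob (Pi_pmf J 0 (\<lambda>_. pmf_of_set {-1, 1 :: real})) {f. t \<le> \<bar>\<Sum>j\<in>J. f j * c j\<bar>} \<le> 2 * exp (- t\<^sup>2 / 4)"
proof (cases "\<forall>j\<in>J. c j = 0")
  case True
  then have "{f. t \<le> \<bar>\<Sum>j\<in>J. f j * c j\<bar>} = {}" using t by auto
  then show ?thesis by simp
next
  case False
  define P where "P = Pi_pmf J 0 (\<lambda>_. pmf_of_set {-1, 1 :: real})"
  have supp: "AE f in P. f j \<in> {-1, 1}" if "j \<in> J" for j
  proof (rule AE_pmfI)
    fix f assume "f \<in> set_pmf P"
    then show "f j \<in> {-1, 1}"
      using that set_Pi_pmf [OF \<open>finite J\<close>, of 0 "\<lambda>_. pmf_of_set {-1, 1 :: real}"]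
      by (auto simp: P_def PiE_dflt_def)
  qed
  interpret Hoeffding_ineq "measure_pmf P" J "\<lambda>j f. f j * c j" "\<lambda>j. - \<bar>c j\<bar>" "\<lambda>j. \<bar>c j\<bar>"
      "\<Sum>j\<in>J. measure_pmf.expectation P (\<lambda>f. f j * c j)"
  proof unfold_locales
    show "finite J" by fact
    show "prob_space.indep_vars (measure_pmf P) (\<lambda>_. borel) (\<lambda>j f. f j * c j) J"
      unfolding P_def
      by (rule prob_space.indep_vars_compose2 [OF measure_pmf.prob_space_axioms indep_vars_Pi_pmf]) (use assms in auto)
    fix j assume "j \<in> J"
    show "AE f in P. f j * c j \<in> {- \<bar>c j\<bar>..\<bar>c j\<bar>}"
      using supp [OF \<open>j \<in> J\<close>] by eventually_elim auto
  qed
  have E: "measure_pmf.expectation P (\<lambda>f. f j * c j) = 0" if "j \<in> J" for j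
  proof -
    have "measure_pmf.expectation P (\<lambda>f. f j * c j) = measure_pmf.expectation (map_pmf (\<lambda>f. f j) P) (\<lambda>s. s * c j)"
      by simp
    also have "map_pmf (\<lambda>f. f j) P = pmf_of_set {-1, 1}"
      unfolding P_def using assms that by (subst Pi_pmf_component) auto
    also have "measure_pmf.expectation (pmf_of_set {-1, 1}) (\<lambda>s. s * c j) = 0"
      by (subst integral_pmf_of_set) auto
    finally show ?thesis .
  qed
  \<comment> \<open>Each summand ranges over an interval of length
    \<open>2 * \<bar>c j\<bar>\<close>; with squares summing to at most 2, Hoeffding's exponent is
    \<open>t\<^sup>2 / 4\<close> or better.\<close>
  have S: "(\<Sum>j\<in>J. (\<bar>c j\<bar> - - \<bar>c j\<bar>)\<^sup>2) = 4 * (\<Sum>j\<in>J. (c j)\<^sup>2)"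
    by (simp add: sum_distrib_left power_mult_distrib)
  have pos: "(\<Sum>j\<in>J. (c j)\<^sup>2) > 0"
    using False assms(1) by (auto intro!: sum_pos2)
  have "measure_pmf.prob P {f. t \<le> \<bar>\<Sum>j\<in>J. f j * c j\<bar>} \<le> 2 * exp (- 2 * t\<^sup>2 / (4 * (\<Sum>j\<in>J. (c j)\<^sup>2)))"
  proof -
    have "(\<Sum>j\<in>J. measure_pmf.expectation P (\<lambda>f. f j * c j)) = 0"
      using E by (intro sum.neutral) simp
    then show ?thesis
      using Hoeffding_ineq_abs_ge [of t] t pos unfolding S by (simp only:) simp
  qed
  also have "\<dots> \<le> 2 * exp (- t\<^sup>2 / 4)"
  proof -
    have "t\<^sup>2 / 4 \<le> 2 * t\<^sup>2 / (4 * (\<Sum>j\<in>J. (c j)\<^sup>2))"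
      using c pos mult_left_mono [OF c, of "t\<^sup>2"] by (simp add: field_simps)
    then show ?thesis by simp
  qed
  finally show ?thesis by (simp add: P_def)
qed

context sym_norm
begin

text \<open>Coordinatewise, the normalised noise is dominated by \<open>max 4 (4 |g|) \<le> 4 + 4 |g|\<close>, and
  \<open>1280 = 4 * 256 + 4 * 64\<close> combines the bounds for the all-ones vector and for \<open>g\<close>.\<close>

definition noise_bound :: real where
  "noise_bound = 1280 * (sqrt (real k) * Med)"

text \<open>There is a separate sign for every coordinate of every block, so the coordinates of the
  signed sum are independent, as domination on a product requires.\<close>

lemma noise_prob:
  fixes c :: "nat \<Rightarrow> nat \<Rightarrow> real"
  assumes "finite J" and Y: "Y > 0" and c: "\<And>i. i < k \<Longrightarrow> (\<Sum>j\<in>J. (c j i)\<^sup>2) \<le> 2 * Y\<^sup>2"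
  shows "measure_pmf.prob (Pi_pmf {..<k} d (\<lambda>_. Pi_pmf J 0 (\<lambda>_. pmf_of_set {-1, 1 :: real})))
      {e. Y * noise_bound < \<nu> (\<lambda>i. \<Sum>j\<in>J. e i j * c j i)} \<le> 1/1000"
proof -
  define P where "P = Pi_pmf {..<k} d (\<lambda>_. Pi_pmf J 0 (\<lambda>_. pmf_of_set {-1, 1 :: real}))"
  define X where "X i f = (\<Sum>j\<in>J. f j * (c j i / Y))" for i and f :: "nat \<Rightarrow> real"
  define \<phi> where "\<phi> y = max 4 (4 * \<bar>y\<bar>)" for y :: real
  have [measurable]: "\<phi> \<in> borel_measurable borel" unfolding \<phi>_def by measurable
  have nu_X: "\<nu> (\<lambda>i\<in>{..<k}. X i (e i)) = \<nu> (\<lambda>i. \<Sum>j\<in>J. e i j * c j i) / Y" for e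
  proof -
    have "\<nu> (\<lambda>i\<in>{..<k}. X i (e i)) = \<nu> (\<lambda>i. (1 / Y) * (\<Sum>j\<in>J. e i j * c j i))"
      by (rule nu_cong) (simp add: X_def sum_divide_distrib)
    then show ?thesis using Y by (simp only: nu_scale) simp
  qed
  have "emeasure P {e. Y * noise_bound < \<nu> (\<lambda>i. \<Sum>j\<in>J. e i j * c j i)}
     = (\<integral>\<^sup>+e. indicator {e. Y * noise_bound < \<nu> (\<lambda>i. \<Sum>j\<in>J. e i j * c j i)} e \<partial>P)" by simp
  also have "\<dots> = (\<integral>\<^sup>+e. indicator {x \<in> Rn k. noise_bound < \<nu> x} (\<lambda>i\<in>{..<k}. X i (e i)) \<partial>P)"
    using Y by (intro nn_integral_cong) (simp add: indicator_def nu_X pos_less_divide_eq mult.commute)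
  also have "\<dots> \<le> (\<integral>\<^sup>+x. indicator {x \<in> Rn k. noise_bound < \<nu> x} (\<lambda>i\<in>{..<k}. \<phi> (x i)) \<partial>pgauss {..<k})"
    unfolding P_def
  proof (rule Pi_pmf_gauss_domination)
    fix i t assume i: "i \<in> {..<k}"
    show "measure_pmf.prob (Pi_pmf J 0 (\<lambda>_. pmf_of_set {-1, 1 :: real})) {f. t \<le> \<bar>X i f\<bar>} \<le> measure gauss {y. t \<le> \<bar>\<phi> y\<bar>}"
    proof (cases "t \<le> 4")
      \<comment> \<open>The cut-off 4 in \<open>\<phi>\<close> makes the right-hand side 1 here.
        Beyond it \<open>t / 4\<close> is at least 1, where \<open>gtail_ge\<close> holds and
        matches the Hoeffding bound.\<close>
      case True
      then have "{y. t \<le> \<bar>\<phi> y\<bar>} = UNIV" by (auto simp: \<phi>_def)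
      then show ?thesis using gauss.prob_space by simp
    next
      case False
      have "(\<Sum>j\<in>J. (c j i / Y)\<^sup>2) \<le> 2"
        using c [of i] i Y by (simp add: power_divide sum_divide_distrib [symmetric] divide_le_eq)
      then have "measure_pmf.prob (Pi_pmf J 0 (\<lambda>_. pmf_of_set {-1, 1 :: real})) {f. t \<le> \<bar>X i f\<bar>} \<le> 2 * exp (- t\<^sup>2 / 4)"
        unfolding X_def using False assms(1) by (intro rademacher_tail) auto
      also have "\<dots> = 2 * exp (- 4 * (t / 4)\<^sup>2)" by (simp add: power_divide)
      also have "\<dots> \<le> gtail (t / 4)" using False by (intro gtail_ge) simp
      also have "{y. t / 4 \<le> \<bar>y\<bar>} = {y. t \<le> \<bar>\<phi> y\<bar>}" using False by (auto simp: \<phi>_def)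
      then have "gtail (t / 4) = measure gauss {y. t \<le> \<bar>\<phi> y\<bar>}" by (simp add: gtail_def)
      finally show ?thesis .
    qed
  qed (use superlevel_sets upset_nu in auto)
  also have "\<dots> \<le> (\<integral>\<^sup>+x. indicator {x \<in> Rn k. 64 * (sqrt (real k) * Med) < \<nu> x} x \<partial>gaussn k)"
    unfolding gaussn_def
  proof (intro nn_integral_mono)
    fix x assume "x \<in> space (pgauss {..<k})"
    then have x: "x \<in> Rn k" by (simp add: space_PiM_gauss)
    have "\<nu> (\<lambda>i\<in>{..<k}. \<phi> (x i)) \<le> \<nu> (\<lambda>i. 4 * 1 + 4 * \<bar>x i\<bar>)"
      by (rule nu_mono) (auto simp: \<phi>_def)
    also have "\<dots> \<le> \<nu> (\<lambda>i. 4 * 1) + \<nu> (\<lambda>i. 4 * \<bar>x i\<bar>)" by (rule nu_add)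
    also have "\<dots> = 4 * \<nu> (\<lambda>_. 1) + 4 * \<nu> x"
      using nu_scale [of 4 "\<lambda>_. 1"] nu_scale [of 4 "\<lambda>i. \<bar>x i\<bar>"] by (simp add: nu_abs)
    finally have "\<nu> (\<lambda>i\<in>{..<k}. \<phi> (x i)) \<le> 4 * \<nu> (\<lambda>_. 1) + 4 * \<nu> x" .
    then have "noise_bound < \<nu> (\<lambda>i\<in>{..<k}. \<phi> (x i)) \<Longrightarrow> 64 * (sqrt (real k) * Med) < \<nu> x"
      using nu_ones_le by (simp add: noise_bound_def)
    then show "(indicator {x \<in> Rn k. noise_bound < \<nu> x} (\<lambda>i\<in>{..<k}. \<phi> (x i)) :: ennreal)
         \<le> indicator {x \<in> Rn k. 64 * (sqrt (real k) * Med) < \<nu> x} x"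
      using x by (auto simp: indicator_def)
  qed
  also have "\<dots> = ennreal (\<P>(x in gaussn k. 64 * (sqrt (real k) * Med) < \<nu> x))"
    using superlevel_sets by (simp add: gaussn.emeasure_eq_measure)
  also have "\<dots> \<le> ennreal (1/1000)"
    using prob_gaussn_large by (intro ennreal_leI) simp
  finally show ?thesis
    unfolding P_def measure_pmf.emeasure_eq_measure by (subst (asm) ennreal_le_iff) simp_all
qed

end

section \<open>Relative entropy and the information carried by a bounded memory\<close>

text \<open>This is \<open>ln x \<le> x - 1\<close> with a free parameter \<open>c\<close>, sharp at
  \<open>c = a / b\<close> for positive \<open>a\<close>. The entropy inequalities below arise from
  it by a choice of \<open>c\<close> and summation.\<close>

lemma gibbs_pointwise:
  fixes a b c :: real
  assumes "a \<ge> 0" "b \<ge> 0" "c \<ge> 0" "a > 0 \<Longrightarrow> b > 0" "a > 0 \<Longrightarrow> c > 0"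
  shows "a * ln (a / b) \<ge> a * ln c + a - b * c"
proof (cases "a = 0")
  case False
  then have pos: "a > 0" "b > 0" "c > 0" using assms by auto
  have "ln (b * c / a) \<le> b * c / a - 1" using pos by (intro ln_le_minus_one) simp
  moreover have "ln (b * c / a) = ln c - ln (a / b)"
    using pos by (simp add: ln_mult ln_div)
  ultimately have "ln (a / b) \<ge> ln c + 1 - b * c / a" by linarith
  then have "a * ln (a / b) \<ge> a * (ln c + 1 - b * c / a)" using pos by (intro mult_left_mono) auto
  also have "a * (ln c + 1 - b * c / a) = a * ln c + a - b * c" using pos by (simp add: field_simps)
  finally show ?thesis .
qed (use assms in simp)

text \<open>Relative entropy in natural logarithms. Where \<open>pmf q w\<close> is 0, division by
  zero makes the term 0 and not infinite, so an inclusion of supports has to accompany its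
  use.\<close>

definition kl :: "'w set \<Rightarrow> 'w pmf \<Rightarrow> 'w pmf \<Rightarrow> real" where
  "kl R p q = (\<Sum>w\<in>R. pmf p w * ln (pmf p w / pmf q w))"

lemma pmf_pos_mono: "set_pmf p \<subseteq> set_pmf q \<Longrightarrow> pmf p w > 0 \<Longrightarrow> pmf q w > 0"
  by (metis pmf_positive_iff subsetD)

lemma expectation_pmf_sum:
  fixes a :: "'w \<Rightarrow> real"
  assumes "finite R" "set_pmf p \<subseteq> R"
  shows "measure_pmf.expectation p a = (\<Sum>w\<in>R. pmf p w * a w)"
  using assms by (subst integral_measure_pmf_real [of R]) (auto simp: mult.commute)

lemma kl_nonneg:
  assumes "finite R" "set_pmf p \<subseteq> set_pmf q" "set_pmf q \<subseteq> R"
  shows "kl R p q \<ge> 0"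
proof -
  have "kl R p q \<ge> (\<Sum>w\<in>R. pmf p w * ln 1 + pmf p w - pmf q w * 1)"
    unfolding kl_def using assms(2) by (intro sum_mono gibbs_pointwise) (auto intro: pmf_pos_mono)
  also have "(\<Sum>w\<in>R. pmf p w * ln 1 + pmf p w - pmf q w * 1) = 0"
    using assms by (simp add: sum_subtractf sum_pmf_eq_1)
  finally show ?thesis .
qed

text \<open>Gibbs' inequality with \<open>c = 1 - a w / 2\<close>. Unlike Pinsker's inequality the
  bound is linear in \<open>kl\<close>, so it can be averaged over blocks and assignments directly;
  the price is the factor 1/2 on the side of \<open>q\<close>.\<close>

lemma kl_test:
  assumes "finite R" "set_pmf p \<subseteq> set_pmf q" "set_pmf q \<subseteq> R"
    and a: "\<And>w. 0 \<le> a w" "\<And>w. a w \<le> 1"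
  shows "measure_pmf.expectation q a / 2 - measure_pmf.expectation p a \<le> kl R p q"
proof -
  have pw: "- (pmf p w * a w) + pmf p w - pmf q w + pmf q w * a w / 2 \<le> pmf p w * ln (pmf p w / pmf q w)" for w
  proof -
    have "ln (1 - a w / 2) \<ge> - a w"
    proof -
      have pos: "1 - a w / 2 > 0" using a(2) [of w] by simp
      then have "ln (inverse (1 - a w / 2)) \<le> inverse (1 - a w / 2) - 1" by (intro ln_le_minus_one) simp
      also have "inverse (1 - a w / 2) \<le> 1 + a w"
      proof -
        have "1 \<le> (1 + a w) * (1 - a w / 2)"
          using a mult_left_le [OF a(2) a(1), of w] by (simp add: algebra_simps)
        then show ?thesis using pos by (simp add: inverse_eq_divide divide_le_eq)
      qed
      finally show ?thesis using pos by (simp add: ln_inverse)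
    qed
    then have "pmf p w * ln (1 - a w / 2) \<ge> pmf p w * - a w" by (intro mult_left_mono) auto
    moreover have "pmf p w * ln (pmf p w / pmf q w) \<ge> pmf p w * ln (1 - a w / 2) + pmf p w - pmf q w * (1 - a w / 2)"
      using a [of w] assms(2) by (intro gibbs_pointwise) (auto intro: pmf_pos_mono)
    ultimately show ?thesis by (simp add: algebra_simps)
  qed
  have "(\<Sum>w\<in>R. - (pmf p w * a w) + pmf p w - pmf q w + pmf q w * a w / 2) \<le> kl R p q"
    unfolding kl_def by (intro sum_mono pw)
  moreover have "(\<Sum>w\<in>R. - (pmf p w * a w) + pmf p w - pmf q w + pmf q w * a w / 2)
      = - (\<Sum>w\<in>R. pmf p w * a w) + (\<Sum>w\<in>R. pmf q w * a w) / 2"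
    using assms by (simp add: sum.distrib sum_subtractf sum_negf sum_pmf_eq_1 sum_divide_distrib)
  moreover have "measure_pmf.expectation p a = (\<Sum>w\<in>R. pmf p w * a w)" "measure_pmf.expectation q a = (\<Sum>w\<in>R. pmf q w * a w)"
    using assms by (auto intro!: expectation_pmf_sum)
  ultimately show ?thesis by simp
qed

lemma log_sum_inequality:
  fixes a b :: "'m \<Rightarrow> real"
  assumes "finite M" and a: "\<And>m. m \<in> M \<Longrightarrow> a m \<ge> 0" and b: "\<And>m. m \<in> M \<Longrightarrow> b m \<ge> 0"
    and ab: "\<And>m. m \<in> M \<Longrightarrow> a m > 0 \<Longrightarrow> b m > 0"
  shows "(\<Sum>m\<in>M. a m) * ln ((\<Sum>m\<in>M. a m) / (\<Sum>m\<in>M. b m)) \<le> (\<Sum>m\<in>M. a m * ln (a m / b m))"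
proof (cases "(\<Sum>m\<in>M. a m) = 0")
  case True
  then have "\<forall>m\<in>M. a m = 0" using assms by (simp add: sum_nonneg_eq_0_iff)
  then show ?thesis by simp
next
  case False
  then obtain m where m: "m \<in> M" "a m \<noteq> 0" by (meson sum.neutral)
  then have "a m > 0" using a [of m] by linarith
  then have A: "(\<Sum>m\<in>M. a m) > 0" and B: "(\<Sum>m\<in>M. b m) > 0"
    using m assms by (auto intro!: sum_pos2)
  define c where "c = (\<Sum>m\<in>M. a m) / (\<Sum>m\<in>M. b m)"
  have c: "c > 0" using A B by (simp add: c_def)
  have "(\<Sum>m\<in>M. a m * ln (a m / b m)) \<ge> (\<Sum>m\<in>M. a m * ln c + a m - b m * c)"
    using c assms by (intro sum_mono gibbs_pointwise) auto
  also have "(\<Sum>m\<in>M. a m * ln c + a m - b m * c) = (\<Sum>m\<in>M. a m) * ln c + (\<Sum>m\<in>M. a m) - (\<Sum>m\<in>M. b m) * c"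
    by (simp add: sum.distrib sum_subtractf sum_distrib_right)
  also have "(\<Sum>m\<in>M. b m) * c = (\<Sum>m\<in>M. a m)" using B by (simp add: c_def)
  finally show ?thesis by (simp add: c_def)
qed

lemma pmf_bind_sum:
  assumes "finite R" "set_pmf p \<subseteq> R"
  shows "pmf (bind_pmf p k) w = (\<Sum>m\<in>R. pmf p m * pmf (k m) w)"
  using assms unfolding pmf_bind by (rule expectation_pmf_sum)

text \<open>Forgetting the intermediate state does not increase relative entropy, by the log-sum
  inequality, and the joint relative entropy splits with weights taken from
  \<open>p\<close>.\<close>

lemma kl_bind_le:
  assumes R: "finite R" and sub: "set_pmf p \<subseteq> set_pmf q" "set_pmf q \<subseteq> R"
    and sub': "\<And>m. m \<in> R \<Longrightarrow> set_pmf (k m) \<subseteq> set_pmf (h m)" "\<And>m. m \<in> R \<Longrightarrow> set_pmf (h m) \<subseteq> R"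
  shows "kl R (bind_pmf p k) (bind_pmf q h) \<le> kl R p q + (\<Sum>m\<in>R. pmf p m * kl R (k m) (h m))"
proof -
  let ?a = "\<lambda>w m. pmf p m * pmf (k m) w"
  let ?b = "\<lambda>w m. pmf q m * pmf (h m) w"
  let ?c = "\<lambda>w m. pmf (k m) w * (pmf p m * ln (pmf p m / pmf q m))"
  let ?e = "\<lambda>w m. pmf p m * (pmf (k m) w * ln (pmf (k m) w / pmf (h m) w))"
  have pos: "?a w m > 0 \<Longrightarrow> ?b w m > 0" if "m \<in> R" for w m
    using sub(1) sub'(1) [OF that]
    by (auto simp: zero_less_mult_iff intro: pmf_pos_mono)
  have "kl R (bind_pmf p k) (bind_pmf q h) = (\<Sum>w\<in>R. (\<Sum>m\<in>R. ?a w m) * ln ((\<Sum>m\<in>R. ?a w m) / (\<Sum>m\<in>R. ?b w m)))"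
    unfolding kl_def using R sub by (intro sum.cong refl) (simp add: pmf_bind_sum [of R])
  also have "\<dots> \<le> (\<Sum>w\<in>R. (\<Sum>m\<in>R. ?a w m * ln (?a w m / ?b w m)))"
    using R pos by (intro sum_mono log_sum_inequality) auto
  also have "\<dots> = (\<Sum>w\<in>R. (\<Sum>m\<in>R. ?c w m + ?e w m))"
  proof (intro sum.cong refl)
    fix w m assume m: "m \<in> R"
    show "?a w m * ln (?a w m / ?b w m) = ?c w m + ?e w m"
    proof (cases "?a w m = 0")
      case False
      then have "pmf p m > 0" "pmf (k m) w > 0" by (auto simp: less_le)
      moreover from this have "pmf q m > 0" "pmf (h m) w > 0" using sub(1) sub'(1) [OF m] by (auto intro: pmf_pos_mono)
      ultimately show ?thesis by (simp add: ln_mult ln_div algebra_simps)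
    qed auto
  qed
  also have "\<dots> = (\<Sum>m\<in>R. (\<Sum>w\<in>R. ?c w m)) + (\<Sum>m\<in>R. (\<Sum>w\<in>R. ?e w m))"
    by (simp only: sum.distrib) (intro arg_cong2 [where f = "(+)"] sum.swap)
  also have "(\<Sum>m\<in>R. (\<Sum>w\<in>R. ?c w m)) = kl R p q"
  proof -
    have "(\<Sum>w\<in>R. pmf (k m) w) = 1" if "m \<in> R" for m
      using R sub'(1,2) [OF that] by (intro sum_pmf_eq_1) auto
    then show ?thesis by (simp add: kl_def sum_distrib_right [symmetric])
  qed
  also have "(\<Sum>m\<in>R. (\<Sum>w\<in>R. ?e w m)) = (\<Sum>m\<in>R. pmf p m * kl R (k m) (h m))"
    by (simp add: kl_def sum_distrib_left)
  finally show ?thesis .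
qed

section \<open>Information of the memory about a random subset\<close>

definition avg :: "(nat set \<Rightarrow> 'w pmf) \<Rightarrow> nat set \<Rightarrow> 'w pmf" where
  "avg K S = bind_pmf (pmf_of_set (Pow S)) K"

lemma Pow_pmf [simp]: "finite S \<Longrightarrow> set_pmf (pmf_of_set (Pow S)) = Pow S"
  by (rule set_pmf_of_set) auto

lemma set_avg: "finite S \<Longrightarrow> set_pmf (avg K S) = (\<Union>\<beta>\<in>Pow S. set_pmf (K \<beta>))"
  by (simp add: avg_def)

lemma pmf_avg: "finite S \<Longrightarrow> pmf (avg K S) w = (\<Sum>\<beta>\<in>Pow S. pmf (K \<beta>) w) / 2 ^ card S"
  unfolding avg_def pmf_bind by (subst integral_pmf_of_set) (auto simp: card_Pow)

lemma entropy_le_ln_card: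
  assumes "finite R" "set_pmf q \<subseteq> R"
  shows "(\<Sum>w\<in>R. pmf q w * - ln (pmf q w)) \<le> ln (real (card R))"
proof -
  have "R \<noteq> {}" using assms set_pmf_not_empty [of q] by auto
  then have c: "real (card R) > 0" using assms(1) by (simp add: card_gt_0_iff)
  have "pmf q w * ln (pmf q w / 1) \<ge> pmf q w * ln (1 / real (card R)) + pmf q w - 1 * (1 / real (card R))" for w
    using c by (intro gibbs_pointwise) auto
  then have "(\<Sum>w\<in>R. pmf q w * ln (pmf q w)) \<ge> (\<Sum>w\<in>R. pmf q w * ln (1 / real (card R)) + pmf q w - 1 / real (card R))"
    by (intro sum_mono) simp
  also have "(\<Sum>w\<in>R. pmf q w * ln (1 / real (card R)) + pmf q w - 1 / real (card R))
      = (\<Sum>w\<in>R. pmf q w) * ln (1 / real (card R)) + (\<Sum>w\<in>R. pmf q w) - 1"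
    using c by (simp add: sum.distrib sum_subtractf sum_distrib_right)
  also have "\<dots> = - ln (real (card R))" using assms c by (simp add: sum_pmf_eq_1 ln_div)
  finally show ?thesis by (simp add: sum_negf)
qed

text \<open>For \<open>\<beta>\<close> a uniformly random subset of \<open>J\<close>, the memory \<open>w\<close> cannot carry more information on the
  independent bits \<open>j \<in> \<beta>\<close> together than \<open>ln (card R)\<close>.  The inequality compares the joint law of
  \<open>(\<beta>, w)\<close> with the one in which the bits are conditionally independent given \<open>w\<close>.\<close>

lemma sum_kl_avg_le:
  assumes J: "finite J" and R: "finite R" and K: "\<And>\<beta>. \<beta> \<subseteq> J \<Longrightarrow> set_pmf (K \<beta>) \<subseteq> R"
  shows "(\<Sum>j\<in>J. kl R (avg K (J - {j})) (avg K J)) \<le> 2 * ln (real (card R))"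
proof -
  define N where "N = (2::real) ^ card J"
  have N: "N > 0" by (simp add: N_def)
  \<comment> \<open>\<open>q\<close> is the law of the memory, \<open>q0 j\<close> and
    \<open>q1 j\<close> are its laws conditioned on \<open>j \<notin> \<beta>\<close> and on
    \<open>j \<in> \<beta>\<close>; so \<open>q\<close> is their mean, which is
    \<open>q01\<close>.\<close>
  define q where "q = pmf (avg K J)"
  define q0 where "q0 j = pmf (avg K (J - {j}))" for j
  define q1 where "q1 j = pmf (avg (\<lambda>\<beta>. K (insert j \<beta>)) (J - {j}))" for j
  have q: "(\<Sum>\<beta>\<in>Pow J. pmf (K \<beta>) w) = N * q w" for w
    using J N by (simp add: q_def pmf_avg N_def)
  have split: "Pow J = Pow (J - {j}) \<union> insert j ` Pow (J - {j})" "Pow (J - {j}) \<inter> insert j ` Pow (J - {j}) = {}" if "j \<in> J" for j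
    using that Pow_insert [of j "J - {j}"] by (auto simp: insert_absorb)
  have inj: "inj_on (insert j) (Pow (J - {j}))" for j
    by (rule inj_onI) (metis Diff_insert_absorb PowD DiffD2 insertI1 subsetD)
  have card: "(2::real) ^ card (J - {j}) = N / 2" if "j \<in> J" for j
  proof -
    have "card J = Suc (card (J - {j}))" using that J by (simp only: card.remove)
    then show ?thesis by (simp add: N_def)
  qed
  have q0: "(\<Sum>\<beta>\<in>Pow (J - {j}). pmf (K \<beta>) w) = N / 2 * q0 j w" if "j \<in> J" for j w
    unfolding q0_def pmf_avg [OF finite_Diff [OF J]] card [OF that] using N by simp
  have q1: "(\<Sum>\<beta>\<in>Pow (J - {j}). pmf (K (insert j \<beta>)) w) = N / 2 * q1 j w" if "j \<in> J" for j w
    unfolding q1_def pmf_avg [OF finite_Diff [OF J]] card [OF that] using N by simp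
  have sum_split: "(\<Sum>\<beta>\<in>Pow J. f \<beta>) = (\<Sum>\<beta>\<in>Pow (J - {j}). f \<beta>) + (\<Sum>\<beta>\<in>Pow (J - {j}). f (insert j \<beta>))"
    if "j \<in> J" for j and f :: "nat set \<Rightarrow> real"
    unfolding split(1) [OF that] using J split(2) [OF that] inj
    by (subst sum.union_disjoint) (auto simp: sum.reindex)
  have q01: "q w = (q0 j w + q1 j w) / 2" if "j \<in> J" for j w
  proof -
    have "N * q w = N / 2 * q0 j w + N / 2 * q1 j w"
      using q [of w] sum_split [OF that, of "\<lambda>\<beta>. pmf (K \<beta>) w"] q0 [OF that, of w] q1 [OF that, of w]
      by linarith
    then have "N * (q0 j w + q1 j w) = N * (q w * 2)" by (simp add: algebra_simps)
    then show ?thesis using N by simp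
  qed
  \<comment> \<open>The ratio \<open>r j \<beta> w / q w\<close> is twice the posterior probability,
    given \<open>w\<close>, of the actual value of bit \<open>j\<close>. The product of these ratios
    describes the law with conditionally independent bits.\<close>
  define r where "r j \<beta> = (if j \<in> \<beta> then q1 j else q0 j)" for j and \<beta> :: "nat set"
  let ?joint = "(\<Sum>w\<in>R. \<Sum>\<beta>\<in>Pow J. pmf (K \<beta>) w * (\<Sum>j\<in>J. ln (r j \<beta> w / q w)))"
  let ?kl0 = "\<lambda>j. kl R (avg K (J - {j})) (avg K J)"
  let ?kl1 = "\<lambda>j. kl R (avg (\<lambda>\<beta>. K (insert j \<beta>)) (J - {j})) (avg K J)"
  have nonneg: "q w \<ge> 0" "q0 j w \<ge> 0" "q1 j w \<ge> 0" "r j \<beta> w \<ge> 0" for w j \<beta>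
    by (auto simp: q_def q0_def q1_def r_def)
  have Kq: "q w > 0" if "\<beta> \<subseteq> J" "pmf (K \<beta>) w > 0" for \<beta> w
    using that J unfolding q_def pmf_positive_iff by (auto simp: set_avg)
  have Kr: "r j \<beta> w > 0" if "\<beta> \<subseteq> J" "pmf (K \<beta>) w > 0" "j \<in> J" for \<beta> w j
  proof (cases "j \<in> \<beta>")
    case True
    then have "insert j (\<beta> - {j}) = \<beta>" by auto
    then show ?thesis using that J True unfolding r_def q1_def pmf_positive_iff
      by (auto simp: set_avg pmf_positive_iff intro!: bexI [of _ "\<beta> - {j}"])
  next
    case False
    then show ?thesis using that J unfolding r_def q0_def pmf_positive_iff
      by (auto simp: set_avg pmf_positive_iff intro!: bexI [of _ "\<beta>"])
  qed
  have pointwise: "pmf (K \<beta>) w * ln (pmf (K \<beta>) w / q w)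
      \<ge> pmf (K \<beta>) w * (\<Sum>j\<in>J. ln (r j \<beta> w / q w)) + pmf (K \<beta>) w - q w * (\<Prod>j\<in>J. r j \<beta> w / q w)"
    if "\<beta> \<in> Pow J" for \<beta> w
  proof -
    have "pmf (K \<beta>) w * ln (pmf (K \<beta>) w / q w)
      \<ge> pmf (K \<beta>) w * ln (\<Prod>j\<in>J. r j \<beta> w / q w) + pmf (K \<beta>) w - q w * (\<Prod>j\<in>J. r j \<beta> w / q w)"
      using that Kq [of \<beta> w] Kr [of \<beta> w] nonneg
      by (intro gibbs_pointwise) (auto intro!: prod_nonneg prod_pos divide_nonneg_nonneg)
    moreover have "pmf (K \<beta>) w * ln (\<Prod>j\<in>J. r j \<beta> w / q w) = pmf (K \<beta>) w * (\<Sum>j\<in>J. ln (r j \<beta> w / q w))"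
    proof (cases "pmf (K \<beta>) w = 0")
      case False
      then have "pmf (K \<beta>) w > 0" by (simp add: less_le)
      then have "ln (\<Prod>j\<in>J. r j \<beta> w / q w) = (\<Sum>j\<in>J. ln (r j \<beta> w / q w))"
        using that Kq [of \<beta> w] Kr [of \<beta> w, THEN less_imp_neq] J by (intro ln_prod) auto
      then show ?thesis by simp
    qed simp
    ultimately show ?thesis by simp
  qed
  \<comment> \<open>Total mass of the comparison law: expanding the product over \<open>J\<close>
    turns the sum over subsets into a product of sums, each equal to 2 by
    \<open>q01\<close>.\<close>
  have prods: "(\<Sum>\<beta>\<in>Pow J. q w * (\<Prod>j\<in>J. r j \<beta> w / q w)) = N * q w" for w
  proof (cases "q w = 0")
    case False
    have "(\<Sum>\<beta>\<in>Pow J. (\<Prod>j\<in>J. r j \<beta> w / q w)) = (\<Sum>\<beta>\<in>Pow J. (\<Prod>j\<in>\<beta>. q1 j w / q w) * (\<Prod>j\<in>J - \<beta>. q0 j w / q w))"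
    proof (intro sum.cong refl)
      fix \<beta> assume "\<beta> \<in> Pow J"
      then have "J = \<beta> \<union> (J - \<beta>)" "finite \<beta>" using J by (auto dest: finite_subset)
      then have "(\<Prod>j\<in>J. r j \<beta> w / q w) = (\<Prod>j\<in>\<beta>. r j \<beta> w / q w) * (\<Prod>j\<in>J - \<beta>. r j \<beta> w / q w)"
        using J by (metis Diff_disjoint finite_Diff prod.union_disjoint)
      then show "(\<Prod>j\<in>J. r j \<beta> w / q w) = (\<Prod>j\<in>\<beta>. q1 j w / q w) * (\<Prod>j\<in>J - \<beta>. q0 j w / q w)"
        by (simp add: r_def)
    qed
    also have "\<dots> = (\<Prod>j\<in>J. q1 j w / q w + q0 j w / q w)"
      using J by (rule prod_add [symmetric])
    also have "\<dots> = (\<Prod>j\<in>J. 2)"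
    proof (intro prod.cong refl)
      fix j assume "j \<in> J"
      then have "q1 j w + q0 j w = 2 * q w" using q01 [of j w] by simp
      then show "q1 j w / q w + q0 j w / q w = 2" using False by (simp add: add_divide_distrib [symmetric])
    qed
    also have "\<dots> = N" by (simp add: N_def)
    finally show ?thesis by (simp add: sum_distrib_left [symmetric])
  qed simp
  have "?joint
     = (\<Sum>w\<in>R. \<Sum>\<beta>\<in>Pow J. pmf (K \<beta>) w * (\<Sum>j\<in>J. ln (r j \<beta> w / q w)) + pmf (K \<beta>) w - q w * (\<Prod>j\<in>J. r j \<beta> w / q w))"
    by (simp add: sum.distrib sum_subtractf q prods)
  also have "\<dots> \<le> (\<Sum>w\<in>R. \<Sum>\<beta>\<in>Pow J. pmf (K \<beta>) w * ln (pmf (K \<beta>) w / q w))"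
    by (intro sum_mono pointwise)
  \<comment> \<open>Dropping the nonpositive \<open>ln (pmf (K \<beta>) w)\<close> leaves the
    entropy of \<open>q\<close>, which the number of states bounds.\<close>
  also have "\<dots> \<le> (\<Sum>w\<in>R. \<Sum>\<beta>\<in>Pow J. pmf (K \<beta>) w * - ln (q w))"
  proof (intro sum_mono)
    fix w \<beta> assume "\<beta> \<in> Pow J"
    show "pmf (K \<beta>) w * ln (pmf (K \<beta>) w / q w) \<le> pmf (K \<beta>) w * - ln (q w)"
    proof (cases "pmf (K \<beta>) w = 0")
      case False
      then have p: "pmf (K \<beta>) w > 0" by (simp add: less_le)
      have "q w > 0" using Kq [of \<beta> w] p \<open>\<beta> \<in> Pow J\<close> by auto
      moreover have "ln (pmf (K \<beta>) w) \<le> 0" using p by (simp add: pmf_le_1)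
      ultimately show ?thesis using p by (intro mult_left_mono) (auto simp: ln_div)
    qed simp
  qed
  also have "\<dots> = N * (\<Sum>w\<in>R. q w * - ln (q w))"
    by (simp only: sum_distrib_right [symmetric] q sum_distrib_left mult.assoc)
  also have "\<dots> \<le> N * ln (real (card R))"
    unfolding q_def using J R K N by (intro mult_left_mono entropy_le_ln_card) (auto simp: set_avg)
  finally have upper: "?joint \<le> N * ln (real (card R))" .
  have inner: "(\<Sum>\<beta>\<in>Pow J. pmf (K \<beta>) w * ln (r j \<beta> w / q w))
     = N / 2 * (q0 j w * ln (q0 j w / q w)) + N / 2 * (q1 j w * ln (q1 j w / q w))" if "j \<in> J" for j w
  proof -
    have "(\<Sum>\<beta>\<in>Pow J. pmf (K \<beta>) w * ln (r j \<beta> w / q w))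
       = (\<Sum>\<beta>\<in>Pow (J - {j}). pmf (K \<beta>) w * ln (q0 j w / q w)) + (\<Sum>\<beta>\<in>Pow (J - {j}). pmf (K (insert j \<beta>)) w * ln (q1 j w / q w))"
      unfolding sum_split [OF that]
      by (intro arg_cong2 [where f = "(+)"] sum.cong refl) (auto simp: r_def)
    then show ?thesis
      using q0 [OF that] q1 [OF that] by (simp add: sum_distrib_right [symmetric])
  qed
  have "?joint
     = (\<Sum>w\<in>R. \<Sum>\<beta>\<in>Pow J. \<Sum>j\<in>J. pmf (K \<beta>) w * ln (r j \<beta> w / q w))"
    by (simp add: sum_distrib_left)
  also have "\<dots> = (\<Sum>w\<in>R. \<Sum>j\<in>J. \<Sum>\<beta>\<in>Pow J. pmf (K \<beta>) w * ln (r j \<beta> w / q w))"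
    by (intro sum.cong refl sum.swap)
  also have "\<dots> = (\<Sum>j\<in>J. \<Sum>w\<in>R. \<Sum>\<beta>\<in>Pow J. pmf (K \<beta>) w * ln (r j \<beta> w / q w))"
    by (rule sum.swap)
  also have "\<dots> = (\<Sum>j\<in>J. N / 2 * (\<Sum>w\<in>R. q0 j w * ln (q0 j w / q w)) + N / 2 * (\<Sum>w\<in>R. q1 j w * ln (q1 j w / q w)))"
    by (intro sum.cong refl) (simp add: inner sum.distrib sum_distrib_left)
  also have "\<dots> = (\<Sum>j\<in>J. N / 2 * ?kl0 j + N / 2 * ?kl1 j)"
    by (simp only: kl_def q0_def q1_def q_def)
  \<comment> \<open>The terms for \<open>j \<in> \<beta>\<close> are nonnegative and are dropped.
    The remaining ones carry probability 1/2, whence the factor 2 in the claim.\<close>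
  also have "\<dots> \<ge> (\<Sum>j\<in>J. N / 2 * ?kl0 j)"
  proof (intro sum_mono)
    fix j assume "j \<in> J"
    have "?kl1 j \<ge> 0"
    proof (intro kl_nonneg R)
      show "set_pmf (avg (\<lambda>\<beta>. K (insert j \<beta>)) (J - {j})) \<subseteq> set_pmf (avg K J)"
        unfolding set_avg [OF J] set_avg [OF finite_Diff [OF J]]
      proof (rule UN_least)
        fix \<beta> assume "\<beta> \<in> Pow (J - {j})"
        then have "insert j \<beta> \<in> Pow J" using \<open>j \<in> J\<close> by auto
        then show "set_pmf (K (insert j \<beta>)) \<subseteq> (\<Union>\<beta>\<in>Pow J. set_pmf (K \<beta>))" by (rule UN_upper)
      qed
      show "set_pmf (avg K J) \<subseteq> R" using J K by (auto simp: set_avg)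
    qed
    then show "N / 2 * ?kl0 j \<le> N / 2 * ?kl0 j + N / 2 * ?kl1 j"
      using N by simp
  qed
  finally have "N / 2 * (\<Sum>j\<in>J. ?kl0 j) \<le> N * ln (real (card R))"
    using upper by (simp add: sum_distrib_left)
  then show ?thesis using N by (simp add: field_simps)
qed

section \<open>Memory chains with omitted and planted blocks\<close>

primrec chain :: "'w pmf \<Rightarrow> ('w \<Rightarrow> nat set \<Rightarrow> 'w pmf) \<Rightarrow> (nat \<Rightarrow> nat set) \<Rightarrow> nat \<Rightarrow> 'w pmf" where
  "chain I K F 0 = I"
| "chain I K F (Suc p) = bind_pmf (chain I K F p) (\<lambda>m. avg (K m) (F p))"

lemma chain_cong: "(\<And>p'. p' < p \<Longrightarrow> F p' = G p') \<Longrightarrow> chain I K F p = chain I K G p"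
  by (induction p) auto

text \<open>Overwriting the entry at \<open>j\<close> sends exactly \<open>s\<close> assignments to
  each one with \<open>P j = p\<close>.\<close>

lemma sum_PiE_fun_upd:
  fixes g :: "(nat \<Rightarrow> nat) \<Rightarrow> real"
  assumes "j < N" "p < s"
  shows "(\<Sum>P\<in>{..<N} \<rightarrow>\<^sub>E {..<s}. g (P(j := p))) = real s * (\<Sum>P\<in>{P \<in> {..<N} \<rightarrow>\<^sub>E {..<s}. P j = p}. g P)"
proof -
  let ?E = "({..<N} - {j}) \<rightarrow>\<^sub>E {..<s}"
  have E: "{..<N} \<rightarrow>\<^sub>E {..<s} = (\<lambda>(y, f). f(j := y)) ` ({..<s} \<times> ?E)"
    using PiE_insert_eq [of j "{..<N} - {j}" "\<lambda>_. {..<s}"] assms(1) by (simp add: insert_absorb)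
  have inj: "inj_on (\<lambda>(y, f). f(j := y)) ({..<s} \<times> ?E)"
  proof (rule inj_onI, clarify)
    fix y f y' f' assume *: "f \<in> ?E" "f' \<in> ?E" "f(j := y) = (f'(j := y') :: nat \<Rightarrow> nat)"
    have "f x = f' x" for x
    proof (cases "x = j")
      case True
      then show ?thesis using PiE_arb [OF *(1), of j] PiE_arb [OF *(2), of j] by simp
    next
      case False
      then show ?thesis using fun_cong [OF *(3), of x] by simp
    qed
    then show "y = y' \<and> f = f'" using fun_cong [OF *(3), of j] by auto
  qed
  have fin: "finite ?E" by (intro finite_PiE) auto
  have "(\<Sum>P\<in>{..<N} \<rightarrow>\<^sub>E {..<s}. g (P(j := p))) = (\<Sum>(y, f)\<in>{..<s} \<times> ?E. g (f(j := p)))"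
    unfolding E sum.reindex [OF inj] by (intro sum.cong refl) (simp add: case_prod_unfold)
  also have "\<dots> = real s * (\<Sum>f\<in>?E. g (f(j := p)))"
    by (simp only: sum.cartesian_product [symmetric]) simp
  also have "(\<Sum>f\<in>?E. g (f(j := p))) = (\<Sum>P\<in>{P \<in> {..<N} \<rightarrow>\<^sub>E {..<s}. P j = p}. g P)"
  proof -
    have "{P \<in> {..<N} \<rightarrow>\<^sub>E {..<s}. P j = p} = (\<lambda>f. f(j := p)) ` ?E"
      unfolding E using assms(2) by force
    moreover have "inj_on (\<lambda>f. f(j := p)) ?E"
      using inj assms(2) by (auto simp: inj_on_def)
    ultimately show ?thesis by (simp add: sum.reindex)
  qed
  finally show ?thesis .
qed

text \<open>The algorithm for one fixed seed, seen stage by stage: \<open>R\<close> will be its set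
  of reachable memories, and \<open>K\<close> the effect of streaming a set of blocks.\<close>

locale memory_chain =
  fixes I :: "'w pmf" and K :: "'w \<Rightarrow> nat set \<Rightarrow> 'w pmf" and R :: "'w set" and N s :: nat
  assumes finite_R: "finite R" and I_R: "set_pmf I \<subseteq> R"
    and K_R: "m \<in> R \<Longrightarrow> \<beta> \<subseteq> {..<N} \<Longrightarrow> set_pmf (K m \<beta>) \<subseteq> R"
begin

definition part :: "(nat \<Rightarrow> nat) \<Rightarrow> nat \<Rightarrow> nat set" where
  "part P p = {i \<in> {..<N}. P i = p}"

text \<open>Block \<open>j\<close> is absent from all stages here and offered in all stages of
  \<open>planted\<close>, so neither family depends on \<open>P j\<close>.\<close>

abbreviation null :: "nat \<Rightarrow> (nat \<Rightarrow> nat) \<Rightarrow> nat \<Rightarrow> nat set" where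
  "null j P p \<equiv> part P p - {j}"

abbreviation planted :: "nat \<Rightarrow> (nat \<Rightarrow> nat) \<Rightarrow> nat \<Rightarrow> nat set" where
  "planted j P p \<equiv> insert j (part P p)"

lemma part_subset: "part P p \<subseteq> {..<N}" and finite_part: "finite (part P p)"
  by (auto simp: part_def)

lemma avg_R: "m \<in> R \<Longrightarrow> S \<subseteq> {..<N} \<Longrightarrow> set_pmf (avg (K m) S) \<subseteq> R"
  using K_R [of m] by (subst set_avg) (auto dest: finite_subset)

lemma chain_R: "(\<And>p. F p \<subseteq> {..<N}) \<Longrightarrow> set_pmf (chain I K F p) \<subseteq> R"
proof (induction p)
  case (Suc p)
  then show ?case by (simp only: chain.simps set_bind_pmf) (intro UN_least avg_R, auto)
qed (use I_R in auto)

lemma avg_mono: "S \<subseteq> S' \<Longrightarrow> finite S' \<Longrightarrow> set_pmf (avg (K m) S) \<subseteq> set_pmf (avg (K m) S')"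
  by (subst (1 2) set_avg) (auto dest: finite_subset)

lemma chain_mono: "(\<And>p. F p \<subseteq> G p) \<Longrightarrow> (\<And>p. finite (G p)) \<Longrightarrow> set_pmf (chain I K F p) \<subseteq> set_pmf (chain I K G p)"
proof (induction p)
  case (Suc p)
  then show ?case using avg_mono by (simp only: chain.simps set_bind_pmf) (intro UN_mono avg_mono, simp_all)
qed auto

lemma kl_chain_le:
  assumes "\<And>p. F p \<subseteq> G p" "\<And>p. G p \<subseteq> {..<N}"
  shows "kl R (chain I K F t) (chain I K G t)
     \<le> (\<Sum>p<t. \<Sum>m\<in>R. pmf (chain I K F p) m * kl R (avg (K m) (F p)) (avg (K m) (G p)))"
proof (induction t)
  case 0
  have "pmf I w * ln (pmf I w / pmf I w) = 0" for w by (cases "pmf I w = 0") auto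
  then show ?case by (auto simp: kl_def intro!: sum_nonpos)
next
  case (Suc t)
  have fin: "finite (G p)" for p using assms(2) by (rule finite_subset) simp
  have "kl R (chain I K F (Suc t)) (chain I K G (Suc t))
     \<le> kl R (chain I K F t) (chain I K G t) + (\<Sum>m\<in>R. pmf (chain I K F t) m * kl R (avg (K m) (F t)) (avg (K m) (G t)))"
    unfolding chain.simps
    using assms fin by (intro kl_bind_le finite_R chain_mono chain_R avg_mono avg_R)
  with Suc show ?case by simp
qed

definition stage_kl :: "nat \<Rightarrow> (nat \<Rightarrow> nat) \<Rightarrow> nat \<Rightarrow> real" where
  "stage_kl j P p = (\<Sum>m\<in>R. pmf (chain I K (null j P) p) m * kl R (avg (K m) (null j P p)) (avg (K m) (planted j P p)))"

text \<open>The cost of stage \<open>p\<close> may be computed as if \<open>j\<close> were assigned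
  to \<open>p\<close>, which makes it one summand in the bound for a whole stage.\<close>

lemma stage_kl_upd: "j < N \<Longrightarrow> stage_kl j (P(j := q)) p = stage_kl j P p"
proof -
  assume "j < N"
  then have "part (P(j := q)) p' - {j} = part P p' - {j}" "insert j (part (P(j := q)) p') = insert j (part P p')" for p'
    by (auto simp: part_def)
  then show "stage_kl j (P(j := q)) p = stage_kl j P p"
    by (simp only: stage_kl_def)
qed

text \<open>For \<open>j\<close> in part \<open>p\<close> the earlier stages do not contain
  \<open>j\<close>, so all these \<open>j\<close> share one prefix chain, and at stage
  \<open>p\<close> planting \<open>j\<close> changes nothing. What remains is
  \<open>sum_kl_avg_le\<close> for each memory content \<open>m\<close>.\<close>

lemma sum_stage_kl_le:
  "(\<Sum>j\<in>part P p. stage_kl j P p) \<le> 2 * ln (real (card R))"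
proof -
  have "stage_kl j P p = (\<Sum>m\<in>R. pmf (chain I K (part P) p) m * kl R (avg (K m) (part P p - {j})) (avg (K m) (part P p)))"
    if "j \<in> part P p" for j
  proof -
    have "chain I K (null j P) p = chain I K (part P) p"
      using that by (intro chain_cong) (auto simp: part_def)
    then show ?thesis using that by (simp add: stage_kl_def insert_absorb)
  qed
  then have "(\<Sum>j\<in>part P p. stage_kl j P p)
     = (\<Sum>j\<in>part P p. \<Sum>m\<in>R. pmf (chain I K (part P) p) m * kl R (avg (K m) (part P p - {j})) (avg (K m) (part P p)))"
    by simp
  also have "\<dots> = (\<Sum>m\<in>R. pmf (chain I K (part P) p) m * (\<Sum>j\<in>part P p. kl R (avg (K m) (part P p - {j})) (avg (K m) (part P p))))"
    by (subst sum.swap) (simp add: sum_distrib_left)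
  also have "\<dots> \<le> (\<Sum>m\<in>R. pmf (chain I K (part P) p) m * (2 * ln (real (card R))))"
  proof (intro sum_mono mult_left_mono sum_kl_avg_le finite_part finite_R)
    fix m \<beta> assume "m \<in> R" "\<beta> \<subseteq> part P p"
    then show "set_pmf (K m \<beta>) \<subseteq> R" using part_subset [of P p] by (intro K_R) auto
  qed simp
  also have "\<dots> = 2 * ln (real (card R))"
    using sum_pmf_eq_1 [OF finite_R chain_R [of "part P" p]] part_subset by (simp add: sum_distrib_right [symmetric])
  finally show ?thesis .
qed

lemma sum_kl_le:
  "(\<Sum>j<N. \<Sum>P\<in>{..<N} \<rightarrow>\<^sub>E {..<s}. kl R (chain I K (null j P) s) (chain I K (planted j P) s))
    \<le> 2 * real s ^ 2 * real s ^ N * ln (real (card R))"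
proof -
  let ?E = "{..<N} \<rightarrow>\<^sub>E {..<s}"
  have finE: "finite ?E" by (intro finite_PiE) auto
  have "(\<Sum>j<N. \<Sum>P\<in>?E. kl R (chain I K (null j P) s) (chain I K (planted j P) s))
     \<le> (\<Sum>j<N. \<Sum>P\<in>?E. \<Sum>p<s. stage_kl j P p)"
    unfolding stage_kl_def
  proof (intro sum_mono kl_chain_le)
    fix j P p assume "j \<in> {..<N}"
    then show "planted j P p \<subseteq> {..<N}" using part_subset [of P p] by auto
  qed blast
  \<comment> \<open>Reassigning \<open>j\<close> to \<open>p\<close> costs a factor
    \<open>s\<close>, since one assignment in \<open>s\<close> has \<open>P j = p\<close>; the sum
    over the stages adds the second factor \<open>s\<close>.\<close>
  also have "\<dots> = (\<Sum>j<N. \<Sum>p<s. \<Sum>P\<in>?E. stage_kl j (P(j := p)) p)"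
    by (intro sum.cong refl, subst sum.swap, intro sum.cong refl) (simp add: stage_kl_upd)
  also have "\<dots> = (\<Sum>j<N. \<Sum>p<s. real s * (\<Sum>P\<in>{P \<in> ?E. P j = p}. stage_kl j P p))"
    by (intro sum.cong refl sum_PiE_fun_upd) auto
  also have "\<dots> = real s * (\<Sum>j<N. \<Sum>p<s. \<Sum>P\<in>?E. if P j = p then stage_kl j P p else 0)"
    using finE by (simp add: sum_distrib_left sum.inter_filter)
  also have "(\<Sum>j<N. \<Sum>p<s. \<Sum>P\<in>?E. if P j = p then stage_kl j P p else 0)
     = (\<Sum>p<s. \<Sum>j<N. \<Sum>P\<in>?E. if P j = p then stage_kl j P p else 0)" by (rule sum.swap)
  also have "\<dots> = (\<Sum>p<s. \<Sum>P\<in>?E. \<Sum>j<N. if P j = p then stage_kl j P p else 0)"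
    by (intro sum.cong refl sum.swap)
  also have "\<dots> = (\<Sum>p<s. \<Sum>P\<in>?E. \<Sum>j\<in>part P p. stage_kl j P p)"
  proof (rule sum.cong [OF refl], rule sum.cong [OF refl])
    fix p P
    show "(\<Sum>j<N. if P j = p then stage_kl j P p else 0) = (\<Sum>j\<in>part P p. stage_kl j P p)"
      unfolding part_def by (rule sum.inter_filter [symmetric]) simp
  qed
  also have "real s * \<dots> \<le> real s * (\<Sum>p<s. \<Sum>P\<in>?E. 2 * ln (real (card R)))"
    by (intro mult_left_mono sum_mono sum_stage_kl_le) auto
  also have "\<dots> = 2 * real s ^ 2 * real s ^ N * ln (real (card R))"
    by (simp add: card_PiE power2_eq_square)
  finally show ?thesis .
qed

theorem sum_advantage_le:
  assumes "\<And>w. 0 \<le> a w" "\<And>w. a w \<le> 1"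
  shows "(\<Sum>j<N. \<Sum>P\<in>{..<N} \<rightarrow>\<^sub>E {..<s}.
       measure_pmf.expectation (chain I K (planted j P) s) a / 2 - measure_pmf.expectation (chain I K (null j P) s) a)
    \<le> 2 * real s ^ 2 * real s ^ N * ln (real (card R))"
proof (rule order_trans [OF sum_mono sum_kl_le])
  fix j assume "j \<in> {..<N}"
  then have pl: "planted j P p \<subseteq> {..<N}" "finite (planted j P p)" for P p using part_subset [of P p] finite_part by auto
  show "(\<Sum>P\<in>{..<N} \<rightarrow>\<^sub>E {..<s}. measure_pmf.expectation (chain I K (planted j P) s) a / 2 - measure_pmf.expectation (chain I K (null j P) s) a)
     \<le> (\<Sum>P\<in>{..<N} \<rightarrow>\<^sub>E {..<s}. kl R (chain I K (null j P) s) (chain I K (planted j P) s))"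
    by (intro sum_mono kl_test finite_R chain_mono chain_R assms pl) auto
qed

end

section \<open>Random streams built from blocks\<close>

lemma prob_bind_pmf:
  "measure_pmf.prob (bind_pmf p f) X = measure_pmf.expectation p (\<lambda>x. measure_pmf.prob (f x) X)"
proof -
  have "ennreal (measure_pmf.prob (bind_pmf p f) X) = (\<integral>\<^sup>+x. ennreal (measure_pmf.prob (f x) X) \<partial>p)"
    using emeasure_bind_pmf [of p f X] by (simp add: measure_pmf.emeasure_eq_measure)
  also have "\<dots> = ennreal (measure_pmf.expectation p (\<lambda>x. measure_pmf.prob (f x) X))"
    by (intro nn_integral_eq_integral measure_pmf.integrable_const_bound [where B = 1]) auto
  finally show ?thesis
    by (subst (asm) ennreal_inj) (auto intro: integral_nonneg_AE)
qed

lemma integrable_prob_pmf: "integrable (measure_pmf p) (\<lambda>x. measure_pmf.prob (f x) X)"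
  by (rule measure_pmf.integrable_const_bound [where B = 1]) auto

lemma integrable_bounded_pmf: "integrable (measure_pmf p) (\<lambda>x. indicator B x :: real)"
  by (rule measure_pmf.integrable_const_bound [where B = 1]) (auto simp: indicator_def)

lemma prob_bind_pmf_ge:
  assumes "measure_pmf.prob p {x. P x} \<ge> a" "b \<ge> 0"
    and f: "\<And>x. x \<in> set_pmf p \<Longrightarrow> P x \<Longrightarrow> measure_pmf.prob (f x) X \<ge> b"
  shows "measure_pmf.prob (bind_pmf p f) X \<ge> a * b"
proof -
  have "a * b \<le> measure_pmf.prob p {x. P x} * b" using assms by (intro mult_right_mono) auto
  also have "\<dots> = measure_pmf.expectation p (\<lambda>x. indicator {x. P x} x * b)" by simp
  also have "\<dots> \<le> measure_pmf.expectation p (\<lambda>x. measure_pmf.prob (f x) X)"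
    using f by (intro integral_mono_AE integrable_prob_pmf integrable_mult_left integrable_bounded_pmf)
       (auto simp: AE_measure_pmf_iff indicator_def)
  finally show ?thesis by (simp add: prob_bind_pmf)
qed

lemma prob_bind_pmf_le:
  assumes "measure_pmf.prob p {x. P x} \<le> a" "b \<ge> 0"
    and f: "\<And>x. x \<in> set_pmf p \<Longrightarrow> \<not> P x \<Longrightarrow> measure_pmf.prob (f x) X \<le> b"
  shows "measure_pmf.prob (bind_pmf p f) X \<le> a + b"
proof -
  have "measure_pmf.expectation p (\<lambda>x. measure_pmf.prob (f x) X) \<le> measure_pmf.expectation p (\<lambda>x. indicator {x. P x} x + b)"
    using f assms(2)
    by (intro integral_mono_AE integrable_prob_pmf Bochner_Integration.integrable_add integrable_bounded_pmf)
       (auto simp: AE_measure_pmf_iff indicator_def measure_pmf.prob_le_1 intro: add_increasing2 order_trans [OF measure_pmf.prob_le_1])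
  also have "\<dots> = measure_pmf.prob p {x. P x} + b"
    by (subst Bochner_Integration.integral_add) (auto intro: integrable_bounded_pmf)
  finally show ?thesis using assms(1) by (simp add: prob_bind_pmf)
qed

text \<open>A permutation that minimises the sum of \<open>l a * z (\<pi> a)\<close> orders
  \<open>z\<close> oppositely to \<open>l\<close>; otherwise a transposition would lower the
  sum.\<close>

lemma exists_swap_permutation:
  fixes l z :: "nat \<Rightarrow> real"
  shows "\<exists>\<pi>. \<pi> permutes {..<k} \<and> (\<forall>a<k. \<forall>b<k. l a < l b \<longrightarrow> z (\<pi> b) \<le> z (\<pi> a))"
proof -
  let ?P = "{\<pi>. \<pi> permutes {..<k}}"
  define f where "f \<pi> = (\<Sum>a<k. l a * z (\<pi> a))" for \<pi>
  have "finite ?P" by (rule finite_permutations) simp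
  moreover have "?P \<noteq> {}" using permutes_id [of "{..<k}"] by blast
  ultimately obtain \<pi> where \<pi>: "\<pi> \<in> ?P" and min: "\<And>\<rho>. \<rho> \<in> ?P \<Longrightarrow> f \<pi> \<le> f \<rho>"
    using ex_is_arg_min_if_finite [of ?P f] by (auto simp: is_arg_min_linorder)
  have "z (\<pi> b) \<le> z (\<pi> a)" if ab: "a < k" "b < k" "l a < l b" for a b
  proof (rule ccontr)
    assume "\<not> z (\<pi> b) \<le> z (\<pi> a)"
    then have lt: "z (\<pi> a) < z (\<pi> b)" by simp
    define \<rho> where "\<rho> = \<pi> \<circ> Transposition.transpose a b"
    have "\<rho> \<in> ?P" using \<pi> ab unfolding \<rho>_def by (auto intro!: permutes_compose permutes_swap_id)
    have ne: "a \<noteq> b" using ab by auto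
    have split: "f \<sigma> = l a * z (\<sigma> a) + l b * z (\<sigma> b) + (\<Sum>c\<in>{..<k} - {a} - {b}. l c * z (\<sigma> c))" for \<sigma>
      unfolding f_def using ab ne by (simp add: sum.remove [of "{..<k}" a] sum.remove [of "{..<k} - {a}" b])
    have "(\<Sum>c\<in>{..<k} - {a} - {b}. l c * z (\<rho> c)) = (\<Sum>c\<in>{..<k} - {a} - {b}. l c * z (\<pi> c))"
      by (intro sum.cong refl) (auto simp: \<rho>_def)
    then have "f \<rho> - f \<pi> = (l a - l b) * (z (\<pi> b) - z (\<pi> a))"
      unfolding split [of \<rho>] split [of \<pi>] by (simp add: \<rho>_def algebra_simps)
    moreover have "(l a - l b) * (z (\<pi> b) - z (\<pi> a)) < 0" using ab lt by (intro mult_neg_pos) auto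
    ultimately show False using min [OF \<open>\<rho> \<in> ?P\<close>] by linarith
  qed
  with \<pi> show ?thesis by blast
qed

text \<open>Greedy choice: the next copy puts its larger entries on the less loaded coordinates. A
  gap between two loads then does not grow, or is reversed and at most one entry, hence at most
  \<open>Z\<close>.\<close>

lemma balanced_permutations:
  fixes z :: "nat \<Rightarrow> real" and N :: nat
  assumes z: "\<And>i. i < k \<Longrightarrow> 0 \<le> z i" "\<And>i. i < k \<Longrightarrow> z i \<le> Z" and "Z \<ge> 0"
  shows "\<exists>\<pi>. (\<forall>j<N. \<pi> j permutes {..<k}) \<and>
     (\<forall>a<k. \<forall>b<k. (\<Sum>j<N. z (\<pi> j a)) \<le> (\<Sum>j<N. z (\<pi> j b)) + Z)"
proof (induction N)
  case (Suc N)
  then obtain \<pi> where \<pi>: "\<And>j. j < N \<Longrightarrow> \<pi> j permutes {..<k}"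
    "\<And>a b. a < k \<Longrightarrow> b < k \<Longrightarrow> (\<Sum>j<N. z (\<pi> j a)) \<le> (\<Sum>j<N. z (\<pi> j b)) + Z" by blast
  define l where "l a = (\<Sum>j<N. z (\<pi> j a))" for a
  obtain \<rho> where \<rho>: "\<rho> permutes {..<k}" "\<And>a b. a < k \<Longrightarrow> b < k \<Longrightarrow> l a < l b \<Longrightarrow> z (\<rho> b) \<le> z (\<rho> a)"
    using exists_swap_permutation [of k l z] by blast
  have "l a + z (\<rho> a) \<le> l b + z (\<rho> b) + Z" if ab: "a < k" "b < k" for a b
  proof -
    have r: "\<rho> a < k" "\<rho> b < k" using ab permutes_in_image [OF \<rho>(1)] by auto
    show ?thesis
    proof (cases "l b < l a")
      case True
      then show ?thesis using \<rho>(2) [of b a] \<pi>(2) [of a b] ab by (simp add: l_def)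
    next
      case False
      then show ?thesis using z(2) [OF r(1)] z(1) [OF r(2)] by linarith
    qed
  qed
  then show ?case using \<pi>(1) \<rho>(1)
    by (intro exI [of _ "\<pi>(N := \<rho>)"]) (auto simp: l_def less_Suc_eq)
qed (use assms in auto)

section \<open>Random streams and the memory they produce\<close>

definition stream_of :: "nat \<Rightarrow> (nat \<Rightarrow> int) \<Rightarrow> update list" where
  "stream_of n v = concat (map (\<lambda>i. replicate (nat \<bar>v i\<bar>) (i, sgn (v i))) [0..<n])"

lemma stream_vec_Nil [simp]: "stream_vec [] = (\<lambda>_. 0)"
  by (simp add: stream_vec_def fun_eq_iff)

lemma stream_vec_append: "stream_vec (\<sigma> @ \<tau>) i = stream_vec \<sigma> i + stream_vec \<tau> i"
  by (simp add: stream_vec_def)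

lemma stream_vec_replicate: "stream_vec (replicate m (j, d)) i = (if j = i then int m * d else 0)"
  by (induction m) (auto simp: stream_vec_def algebra_simps)

lemma stream_vec_concat: "stream_vec (concat xss) i = (\<Sum>\<sigma>\<leftarrow>xss. stream_vec \<sigma> i)"
  by (induction xss) (auto simp: stream_vec_append)

lemma stream_vec_stream_of: "stream_vec (stream_of n v) i = (if i < n then v i else 0)"
proof -
  have "stream_vec (stream_of n v) i = (\<Sum>x\<leftarrow>[0..<n]. if x = i then v x else 0)"
    unfolding stream_of_def stream_vec_concat
    by (simp add: o_def stream_vec_replicate abs_mult_sgn cong: if_cong)
  also have "\<dots> = (\<Sum>x\<in>{..<n}. if x = i then v x else 0)"
    by (simp add: interv_sum_list_conv_sum_set_nat atLeast0LessThan)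
  finally show ?thesis by simp
qed

lemma stream_of_in_streams: "stream_of n v \<in> turnstile_streams n"
  by (auto simp: stream_of_def turnstile_streams_def sgn_if split: if_splits)

lemma append_in_streams: "\<sigma> \<in> turnstile_streams n \<Longrightarrow> \<tau> \<in> turnstile_streams n \<Longrightarrow> \<sigma> @ \<tau> \<in> turnstile_streams n"
  by (simp add: turnstile_streams_def)

definition run :: "stream_alg \<Rightarrow> nat \<Rightarrow> bool list \<Rightarrow> update list \<Rightarrow> bool list pmf" where
  "run A r m \<sigma> = foldl (\<lambda>p u. bind_pmf p (\<lambda>w. step_mem A r w u)) (return_pmf m) \<sigma>"

lemma memory_append: "memory A r (\<sigma> @ \<tau>) = bind_pmf (memory A r \<sigma>) (\<lambda>m. run A r m \<tau>)"
proof (induction \<tau> rule: rev_induct)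
  case Nil
  then show ?case by (simp add: run_def memory_def bind_return_pmf')
next
  case (snoc u \<tau>)
  have "memory A r (\<sigma> @ \<tau> @ [u]) = bind_pmf (memory A r (\<sigma> @ \<tau>)) (\<lambda>w. step_mem A r w u)"
    by (simp add: memory_def)
  then show ?case by (simp add: snoc run_def bind_assoc_pmf)
qed

definition block_sum :: "(nat \<Rightarrow> nat \<Rightarrow> int) \<Rightarrow> nat set \<Rightarrow> nat \<Rightarrow> int" where
  "block_sum u \<beta> i = (\<Sum>j\<in>\<beta>. u j i)"

abbreviation unif_subset :: "nat set \<Rightarrow> nat set pmf" where
  "unif_subset S \<equiv> pmf_of_set (Pow S)"

primrec rstream :: "nat \<Rightarrow> (nat \<Rightarrow> nat \<Rightarrow> int) \<Rightarrow> (nat \<Rightarrow> nat set) \<Rightarrow> nat \<Rightarrow> update list pmf" where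
  "rstream n u F 0 = return_pmf []"
| "rstream n u F (Suc p) =
     bind_pmf (rstream n u F p) (\<lambda>\<sigma>. map_pmf (\<lambda>\<beta>. \<sigma> @ stream_of n (block_sum u \<beta>)) (unif_subset (F p)))"

text \<open>The subset of a stage is drawn independently of the memory, so drawing the whole stream
  first and running the algorithm afterwards gives the same law as interleaving the two.\<close>

lemma chain_eq_memory:
  "chain (init_mem A r) (\<lambda>m \<beta>. run A r m (stream_of n (block_sum u \<beta>))) F p = bind_pmf (rstream n u F p) (memory A r)"
proof (induction p)
  case 0
  show ?case by (simp add: memory_def bind_return_pmf)
next
  case (Suc p)
  let ?b = "\<lambda>\<beta>. stream_of n (block_sum u \<beta>)"
  have "chain (init_mem A r) (\<lambda>m \<beta>. run A r m (?b \<beta>)) F (Suc p)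
     = bind_pmf (rstream n u F p) (\<lambda>\<sigma>. bind_pmf (memory A r \<sigma>) (\<lambda>m. bind_pmf (unif_subset (F p)) (\<lambda>\<beta>. run A r m (?b \<beta>))))"
    by (simp add: Suc avg_def bind_assoc_pmf)
  also have "\<dots> = bind_pmf (rstream n u F p) (\<lambda>\<sigma>. bind_pmf (unif_subset (F p)) (\<lambda>\<beta>. memory A r (\<sigma> @ ?b \<beta>)))"
    by (subst bind_commute_pmf) (simp add: memory_append)
  also have "\<dots> = bind_pmf (rstream n u F (Suc p)) (memory A r)"
    by (simp add: bind_assoc_pmf map_pmf_def bind_return_pmf)
  finally show ?case .
qed

lemma rstream_in_streams: "\<sigma> \<in> set_pmf (rstream n u F p) \<Longrightarrow> \<sigma> \<in> turnstile_streams n"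
  by (induction p arbitrary: \<sigma>) (auto intro: append_in_streams stream_of_in_streams, simp add: turnstile_streams_def)

text \<open>Space is bounded on actual runs only, and from an unreachable content \<open>run\<close>
  may exceed it; so the states of the chain are these and not all short bit strings.\<close>

definition reachable :: "nat \<Rightarrow> stream_alg \<Rightarrow> nat \<Rightarrow> bool list set" where
  "reachable n A r = (\<Union>\<sigma>\<in>turnstile_streams n. set_pmf (memory A r \<sigma>))"

lemma reachable_subset:
  assumes "uses_space n A S" "r \<in> set_pmf (seed A)"
  shows "reachable n A r \<subseteq> {w. length w \<le> S}"
  using assms by (auto simp: reachable_def uses_space_def)

lemma finite_short_lists: "finite {w :: bool list. length w \<le> S}"
  using finite_lists_length_le [of "UNIV :: bool set" S] by simp

lemma card_short_lists: "card {w :: bool list. length w \<le> S} \<le> 2 ^ (S + 1)"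
proof -
  have "card {w :: bool list. length w \<le> S} = (\<Sum>i\<le>S. 2 ^ i)"
    using card_lists_length_le [of "UNIV :: bool set" S] by simp
  also have "\<dots> \<le> 2 ^ (S + 1)"
    by (induction S) auto
  finally show ?thesis .
qed

definition stage_blocks :: "nat \<Rightarrow> (nat \<Rightarrow> nat) \<Rightarrow> nat \<Rightarrow> nat set" where
  "stage_blocks N P p = {i \<in> {..<N}. P i = p}"

text \<open>For each seed \<open>sum_advantage_le\<close> applies, with the probability of an answer
  in \<open>X\<close> as the test. The result is averaged over the seeds, which are independent of
  the stream and cost no space.\<close>

theorem space_lower_bound:
  assumes space: "uses_space n A S" and s: "s \<ge> 1"
    and null: "\<And>j P. j < N \<Longrightarrow> P \<in> {..<N} \<rightarrow>\<^sub>E {..<s} \<Longrightarrow>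
       measure_pmf.prob (bind_pmf (rstream n u (\<lambda>p. stage_blocks N P p - {j}) s) (alg_output A)) X \<le> d0"
    and planted: "\<And>j P. j < N \<Longrightarrow> P \<in> {..<N} \<rightarrow>\<^sub>E {..<s} \<Longrightarrow>
       measure_pmf.prob (bind_pmf (rstream n u (\<lambda>p. insert j (stage_blocks N P p)) s) (alg_output A)) X \<ge> d1"
  shows "real N * (d1 / 2 - d0) \<le> 2 * real s ^ 2 * (real S + 1)"
proof -
  define K where "K r m \<beta> = run A r m (stream_of n (block_sum u \<beta>))" for r m \<beta>
  define out where "out r F = bind_pmf (chain (init_mem A r) (K r) F s) (answer A r)" for r F
  define E where "E = {..<N} \<rightarrow>\<^sub>E {..<s}"
  define G where "G r j P = measure_pmf.prob (out r (\<lambda>p. insert j (stage_blocks N P p))) X / 2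
      - measure_pmf.prob (out r (\<lambda>p. stage_blocks N P p - {j})) X" for r j P
  have out_eq: "bind_pmf (rstream n u F s) (alg_output A) = bind_pmf (seed A) (\<lambda>r. out r F)" for F
    unfolding out_def K_def [abs_def] chain_eq_memory alg_output_def [abs_def] bind_assoc_pmf
    by (rule bind_commute_pmf)
  have per_seed: "(\<Sum>j<N. \<Sum>P\<in>E. G r j P) \<le> 2 * real s ^ 2 * real s ^ N * (real S + 1)" if r: "r \<in> set_pmf (seed A)" for r
  proof -
    let ?R = "reachable n A r"
    interpret memory_chain "init_mem A r" "K r" ?R N s
    proof
      show "finite ?R" using reachable_subset [OF space r] finite_short_lists by (rule finite_subset)
      show "set_pmf (init_mem A r) \<subseteq> ?R"
        by (auto simp: reachable_def turnstile_streams_def memory_def intro!: bexI [of _ "[]"])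
      show "set_pmf (K r m \<beta>) \<subseteq> ?R" if "m \<in> ?R" for m \<beta>
      proof
        fix w assume w: "w \<in> set_pmf (K r m \<beta>)"
        obtain \<sigma> where \<sigma>: "\<sigma> \<in> turnstile_streams n" "m \<in> set_pmf (memory A r \<sigma>)"
          using \<open>m \<in> ?R\<close> by (auto simp: reachable_def)
        then have "w \<in> set_pmf (memory A r (\<sigma> @ stream_of n (block_sum u \<beta>)))"
          using w by (auto simp: memory_append K_def)
        then show "w \<in> ?R"
          unfolding reachable_def using append_in_streams [OF \<sigma>(1) stream_of_in_streams] by blast
      qed
    qed
    have part: "part P p = stage_blocks N P p" for P p by (simp add: part_def stage_blocks_def)
    have "(\<Sum>j<N. \<Sum>P\<in>E. G r j P) \<le> 2 * real s ^ 2 * real s ^ N * ln (real (card ?R))"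
      using sum_advantage_le [of "\<lambda>w. measure_pmf.prob (answer A r w) X"]
      by (simp add: G_def E_def out_def prob_bind_pmf part measure_pmf.prob_le_1)
    also have "\<dots> \<le> 2 * real s ^ 2 * real s ^ N * (real S + 1)"
    proof (intro mult_left_mono)
      have "card ?R \<le> 2 ^ (S + 1)"
        using card_mono [OF finite_short_lists reachable_subset [OF space r]] card_short_lists [of S] by linarith
      then have "real (card ?R) \<le> 2 ^ (S + 1)" by (metis of_nat_le_iff of_nat_numeral of_nat_power)
      moreover have "set_pmf (init_mem A r) \<noteq> {}" by (rule set_pmf_not_empty)
      then have "?R \<noteq> {}" using I_R by auto
      then have "card ?R > 0" using finite_R by (simp add: card_gt_0_iff)
      ultimately have "ln (real (card ?R)) \<le> ln (2 ^ (S + 1))" by (intro ln_mono) auto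
      also have "\<dots> = real (S + 1) * ln 2" by (rule ln_realpow)
      also have "\<dots> \<le> real (S + 1) * 1" using ln_le_minus_one [of 2] by (intro mult_left_mono) auto
      finally show "ln (real (card ?R)) \<le> real S + 1" by simp
    qed auto
    finally show ?thesis .
  qed
  have finE: "finite E" unfolding E_def by (intro finite_PiE) auto
  have intG: "integrable (measure_pmf (seed A)) (\<lambda>r. G r j P)" for j P
    unfolding G_def by (intro Bochner_Integration.integrable_diff integrable_divide integrable_prob_pmf)
  have EG: "d1 / 2 - d0 \<le> measure_pmf.expectation (seed A) (\<lambda>r. G r j P)" if "j < N" "P \<in> E" for j P
  proof -
    have "measure_pmf.expectation (seed A) (\<lambda>r. G r j P)
       = measure_pmf.prob (bind_pmf (rstream n u (\<lambda>p. insert j (stage_blocks N P p)) s) (alg_output A)) X / 2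
       - measure_pmf.prob (bind_pmf (rstream n u (\<lambda>p. stage_blocks N P p - {j}) s) (alg_output A)) X"
      unfolding G_def out_eq prob_bind_pmf [of "seed A"]
      by (subst Bochner_Integration.integral_diff) (auto intro: integrable_prob_pmf integrable_divide)
    then show ?thesis using null [of j P] planted [of j P] that by (simp add: E_def)
  qed
  have "real N * real s ^ N * (d1 / 2 - d0) = (\<Sum>j<N. \<Sum>P\<in>E. d1 / 2 - d0)"
    by (simp add: E_def card_PiE)
  also have "\<dots> \<le> (\<Sum>j<N. \<Sum>P\<in>E. measure_pmf.expectation (seed A) (\<lambda>r. G r j P))"
    by (intro sum_mono EG) auto
  also have "\<dots> = measure_pmf.expectation (seed A) (\<lambda>r. \<Sum>j<N. \<Sum>P\<in>E. G r j P)"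
    using intG by (simp add: Bochner_Integration.integral_sum)
  also have "\<dots> \<le> 2 * real s ^ 2 * real s ^ N * (real S + 1)"
    using per_seed intG by (intro measure_pmf.integral_le_const Bochner_Integration.integrable_sum) (auto simp: AE_measure_pmf_iff)
  finally have "real s ^ N * (real N * (d1 / 2 - d0)) \<le> real s ^ N * (2 * real s ^ 2 * (real S + 1))"
    by (simp add: mult_ac)
  then show ?thesis using s by (subst (asm) mult_le_cancel_left_pos) auto
qed

section \<open>Laws of the final vector\<close>

lemma pair_pmf_of_set:
  assumes "finite A" "A \<noteq> {}" "finite B" "B \<noteq> {}"
  shows "pair_pmf (pmf_of_set A) (pmf_of_set B) = pmf_of_set (A \<times> B)"
proof (rule pmf_eqI)
  fix p
  show "pmf (pair_pmf (pmf_of_set A) (pmf_of_set B)) p = pmf (pmf_of_set (A \<times> B)) p"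
    using assms by (cases p) (simp add: pmf_pair pmf_of_set card_cartesian_product indicator_times)
qed

lemma unif_subset_Un:
  assumes "finite A" "finite B" "A \<inter> B = {}"
  shows "unif_subset (A \<union> B) = bind_pmf (unif_subset A) (\<lambda>x. map_pmf (\<lambda>y. x \<union> y) (unif_subset B))"
proof -
  have "bij_betw (\<lambda>(x, y). x \<union> y) (Pow A \<times> Pow B) (Pow (A \<union> B))"
    by (rule bij_betw_byWitness [where f' = "\<lambda>z. (z \<inter> A, z \<inter> B)"]) (use assms(3) in auto)
  then have "unif_subset (A \<union> B) = map_pmf (\<lambda>(x, y). x \<union> y) (pmf_of_set (Pow A \<times> Pow B))"
    using assms by (intro map_pmf_of_set_bij_betw [symmetric]) auto
  also have "pmf_of_set (Pow A \<times> Pow B) = pair_pmf (unif_subset A) (unif_subset B)"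
    using assms by (intro pair_pmf_of_set [symmetric]) auto
  finally show ?thesis
    by (simp add: pair_pmf_def map_pmf_def bind_assoc_pmf bind_return_pmf)
qed

lemma unif_subset_image:
  assumes "finite A" "inj_on f A"
  shows "map_pmf (image f) (unif_subset A) = unif_subset (f ` A)"
  using assms by (intro map_pmf_of_set_bij_betw bij_betw_Pow) (auto simp: bij_betw_def)

primrec vector_walk :: "(nat \<Rightarrow> (nat \<Rightarrow> int) pmf) \<Rightarrow> nat \<Rightarrow> (nat \<Rightarrow> int) pmf" where
  "vector_walk L 0 = return_pmf (\<lambda>_. 0)"
| "vector_walk L (Suc p) = bind_pmf (vector_walk L p) (\<lambda>v. map_pmf (\<lambda>d i. v i + d i) (L p))"

definition block_law :: "(nat \<Rightarrow> nat \<Rightarrow> int) \<Rightarrow> nat set \<Rightarrow> (nat \<Rightarrow> int) pmf" where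
  "block_law u S = map_pmf (block_sum u) (unif_subset S)"

lemma rstream_vector_law:
  assumes "\<And>j i. i \<ge> n \<Longrightarrow> u j i = 0"
  shows "map_pmf stream_vec (rstream n u F p) = vector_walk (\<lambda>p. block_law u (F p)) p"
proof (induction p)
  case 0
  show ?case by simp
next
  case (Suc p)
  have eq: "stream_vec (\<sigma> @ stream_of n (block_sum u \<beta>)) = (\<lambda>i. stream_vec \<sigma> i + block_sum u \<beta> i)" for \<sigma> \<beta>
    using assms by (auto simp: fun_eq_iff stream_vec_append stream_vec_stream_of block_sum_def)
  have "map_pmf stream_vec (rstream n u F (Suc p))
     = bind_pmf (map_pmf stream_vec (rstream n u F p)) (\<lambda>v. map_pmf (\<lambda>d i. v i + d i) (block_law u (F p)))"
    unfolding rstream.simps block_law_def map_bind_pmf bind_map_pmf pmf.map_comp o_def eq ..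
  then show ?case by (simp add: Suc)
qed

lemma block_sum_Un:
  "finite \<beta> \<Longrightarrow> finite \<gamma> \<Longrightarrow> \<beta> \<inter> \<gamma> = {} \<Longrightarrow> block_sum u (\<beta> \<union> \<gamma>) = (\<lambda>i. block_sum u \<beta> i + block_sum u \<gamma> i)"
  by (simp add: block_sum_def fun_eq_iff sum.union_disjoint)

lemma block_law_Un:
  assumes "finite A" "finite B" "A \<inter> B = {}"
  shows "block_law u (A \<union> B) = bind_pmf (block_law u A) (\<lambda>v. map_pmf (\<lambda>d i. v i + d i) (block_law u B))"
proof -
  have "block_law u (A \<union> B) = bind_pmf (unif_subset A) (\<lambda>x. map_pmf (\<lambda>y. block_sum u (x \<union> y)) (unif_subset B))"
    by (simp add: block_law_def unif_subset_Un [OF assms] map_bind_pmf pmf.map_comp o_def)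
  also have "\<dots> = bind_pmf (unif_subset A) (\<lambda>x. map_pmf (\<lambda>y i. block_sum u x i + block_sum u y i) (unif_subset B))"
  proof (intro bind_pmf_cong refl map_pmf_cong)
    fix x y assume "x \<in> set_pmf (unif_subset A)" "y \<in> set_pmf (unif_subset B)"
    then have "x \<subseteq> A" "y \<subseteq> B" using assms by auto
    then show "block_sum u (x \<union> y) = (\<lambda>i. block_sum u x i + block_sum u y i)"
      using assms by (intro block_sum_Un) (auto dest: finite_subset)
  qed
  finally show ?thesis by (simp add: block_law_def bind_map_pmf pmf.map_comp o_def)
qed

text \<open>A uniform subset of a disjoint union consists of independent uniform subsets of the
  pieces, so the stages merge into a single draw.\<close>

lemma vector_walk_disjoint:
  assumes "\<And>p. finite (F p)" "disjoint_family F"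
  shows "vector_walk (\<lambda>p. block_law u (F p)) t = block_law u (\<Union>p<t. F p)"
proof (induction t)
  case 0
  have "block_sum u {} = (\<lambda>_. 0)" by (simp add: block_sum_def fun_eq_iff)
  then show ?case by (simp add: block_law_def pmf_of_set_singleton)
next
  case (Suc t)
  have "(\<Union>p<Suc t. F p) = (\<Union>p<t. F p) \<union> F t" by (auto simp: less_Suc_eq)
  moreover have "F p \<inter> F t = {}" if "p < t" for p
    using that by (intro disjoint_family_onD [OF assms(2)]) auto
  then have "(\<Union>p<t. F p) \<inter> F t = {}" by blast
  ultimately show ?case using assms(1) by (simp add: Suc block_law_Un)
qed

lemma block_law_cong:
  assumes "finite A" "inj_on f A" "\<And>a. a \<in> A \<Longrightarrow> u' (f a) = u a"
  shows "block_law u' (f ` A) = block_law u A"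
proof -
  have "block_law u' (f ` A) = map_pmf (\<lambda>x. block_sum u' (f ` x)) (unif_subset A)"
    by (simp add: block_law_def unif_subset_image [OF assms(1,2), symmetric] pmf.map_comp o_def)
  also have "\<dots> = block_law u A"
    unfolding block_law_def
  proof (intro map_pmf_cong refl)
    fix x assume "x \<in> set_pmf (unif_subset A)"
    then have "x \<subseteq> A" using assms by auto
    moreover from this have "inj_on f x" using assms(2) by (rule inj_on_subset [rotated])
    ultimately show "block_sum u' (f ` x) = block_sum u x"
      using assms(3) by (auto simp: block_sum_def fun_eq_iff sum.reindex intro!: sum.cong)
  qed
  finally show ?thesis .
qed

text \<open>In the planted stream the block \<open>j\<close> is offered in every stage; giving it the fresh name
  \<open>N + p\<close> in stage \<open>p\<close> makes the offered sets disjoint.\<close>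

lemma planted_vector_law:
  assumes j: "j < N" and P: "P \<in> {..<N} \<rightarrow>\<^sub>E {..<s}"
  shows "vector_walk (\<lambda>p. block_law u (insert j (stage_blocks N P p))) s
    = bind_pmf (unif_subset ({..<N} - {j})) (\<lambda>B. map_pmf (\<lambda>Z i. block_sum u B i + int (card Z) * u j i) (unif_subset {N..<N + s}))"
proof -
  define u' where "u' m = (if m < N then u m else u j)" for m
  define F where "F p = insert (N + p) (stage_blocks N P p - {j})" for p
  have fin: "finite (F p)" for p by (simp add: F_def stage_blocks_def)
  have disj: "disjoint_family F"
    by (auto simp: disjoint_family_on_def F_def stage_blocks_def)
  have relabel: "block_law u (insert j (stage_blocks N P p)) = block_law u' (F p)" for p
  proof -
    define f where "f m = (if m = j then N + p else m)" for m
    have "f ` insert j (stage_blocks N P p) = F p" by (auto simp: f_def F_def stage_blocks_def)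
    moreover have "inj_on f (insert j (stage_blocks N P p))" by (auto simp: inj_on_def f_def stage_blocks_def)
    moreover have "u' (f a) = u a" if "a \<in> insert j (stage_blocks N P p)" for a
      using that by (auto simp: f_def u'_def stage_blocks_def)
    ultimately show ?thesis
      using block_law_cong [of "insert j (stage_blocks N P p)" f u' u] by (simp add: stage_blocks_def)
  qed
  have union: "(\<Union>p<s. F p) = ({..<N} - {j}) \<union> {N..<N + s}"
  proof (intro equalityI subsetI)
    fix x assume x: "x \<in> ({..<N} - {j}) \<union> {N..<N + s}"
    show "x \<in> (\<Union>p<s. F p)"
    proof (cases "x < N")
      case True
      then have "P x < s" using P by auto
      then show ?thesis using True x by (auto simp: F_def stage_blocks_def)
    next
      case False
      then have "x - N < s" "x = N + (x - N)" using x by auto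
      then show ?thesis by (auto simp: F_def)
    qed
  qed (auto simp: F_def stage_blocks_def)
  have "vector_walk (\<lambda>p. block_law u (insert j (stage_blocks N P p))) s = block_law u' (({..<N} - {j}) \<union> {N..<N + s})"
    unfolding relabel vector_walk_disjoint [OF fin disj] union ..
  also have "\<dots> = bind_pmf (unif_subset ({..<N} - {j})) (\<lambda>B. map_pmf (\<lambda>Z i. block_sum u' B i + block_sum u' Z i) (unif_subset {N..<N + s}))"
    by (subst block_law_Un) (auto simp: block_law_def bind_map_pmf pmf.map_comp o_def)
  also have "\<dots> = bind_pmf (unif_subset ({..<N} - {j})) (\<lambda>B. map_pmf (\<lambda>Z i. block_sum u B i + int (card Z) * u j i) (unif_subset {N..<N + s}))"
  proof (intro bind_pmf_cong refl map_pmf_cong ext)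
    fix B Z i assume "B \<in> set_pmf (unif_subset ({..<N} - {j}))" "Z \<in> set_pmf (unif_subset {N..<N + s})"
    then have "B \<subseteq> {..<N}" "Z \<subseteq> {N..<N + s}" by auto
    then show "block_sum u' B i + block_sum u' Z i = block_sum u B i + int (card Z) * u j i"
      by (intro arg_cong2 [where f = "(+)"]) (auto simp: block_sum_def u'_def subset_iff intro!: sum.cong trans [OF sum.cong [OF refl] sum_constant])
  qed
  finally show ?thesis .
qed

lemma null_vector_law:
  assumes P: "P \<in> {..<N} \<rightarrow>\<^sub>E {..<s}"
  shows "vector_walk (\<lambda>p. block_law u (stage_blocks N P p - {j})) s = block_law u ({..<N} - {j})"
proof -
  have "disjoint_family (\<lambda>p. stage_blocks N P p - {j})" by (auto simp: disjoint_family_on_def stage_blocks_def)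
  then have "vector_walk (\<lambda>p. block_law u (stage_blocks N P p - {j})) s = block_law u (\<Union>p<s. stage_blocks N P p - {j})"
    by (intro vector_walk_disjoint) (auto simp: stage_blocks_def)
  also have "(\<Union>p<s. stage_blocks N P p - {j}) = {..<N} - {j}" using P by (auto simp: stage_blocks_def)
  finally show ?thesis .
qed

text \<open>Complementation preserves the uniform law, and \<open>Z\<close> or \<open>A - Z\<close>
  contains at least half of the elements.\<close>

lemma prob_unif_subset_half:
  assumes "finite A"
  shows "measure_pmf.prob (unif_subset A) {Z. card A \<le> 2 * card Z} \<ge> 1/2"
proof -
  let ?G = "{Z. card A \<le> 2 * card Z}"
  have "bij_betw (\<lambda>Z. A - Z) (Pow A) (Pow A)"
    by (rule bij_betw_byWitness [where f' = "\<lambda>Z. A - Z"]) auto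
  then have flip: "map_pmf (\<lambda>Z. A - Z) (unif_subset A) = unif_subset A"
    using assms by (intro map_pmf_of_set_bij_betw) auto
  have "1 = measure_pmf.prob (unif_subset A) (?G \<union> (\<lambda>Z. A - Z) -` ?G)"
  proof (rule measure_pmf.prob_eq_1 [THEN iffD2, symmetric])
    show "AE Z in unif_subset A. Z \<in> ?G \<union> (\<lambda>Z. A - Z) -` ?G"
    proof (rule AE_pmfI)
      fix Z assume "Z \<in> set_pmf (unif_subset A)"
      then have Z: "Z \<subseteq> A" using assms by auto
      then have "card (A - Z) = card A - card Z" "card Z \<le> card A"
        using assms by (auto simp: card_Diff_subset finite_subset card_mono)
      then show "Z \<in> ?G \<union> (\<lambda>Z. A - Z) -` ?G" by auto
    qed
  qed simp
  also have "\<dots> \<le> measure_pmf.prob (unif_subset A) ?G + measure_pmf.prob (unif_subset A) ((\<lambda>Z. A - Z) -` ?G)"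
    by (rule measure_Un_le) auto
  also have "measure_pmf.prob (unif_subset A) ((\<lambda>Z. A - Z) -` ?G) = measure_pmf.prob (unif_subset A) ?G"
    using measure_map_pmf [of "\<lambda>Z. A - Z" "unif_subset A" ?G] flip by simp
  finally show ?thesis by simp
qed

section \<open>The lower bound\<close>

context sym_norm
begin

text \<open>Positions come from \<open>balanced_permutations\<close>, signs from the probabilistic
  method. Fixing the signs once makes the blocks deterministic, so that later only the choice of the
  subset matters for the noise.\<close>

lemma exists_blocks:
  fixes y :: "nat \<Rightarrow> nat" and Y N :: nat
  assumes Y: "Y > 0" and y: "\<And>i. i < k \<Longrightarrow> y i \<le> Y" and N: "real N * (\<Sum>i<k. (real (y i))\<^sup>2) \<le> real k * (real Y)\<^sup>2"
  shows "\<exists>u :: nat \<Rightarrow> nat \<Rightarrow> int. (\<forall>j i. k \<le> i \<longrightarrow> u j i = 0) \<and> (\<forall>j i. \<bar>u j i\<bar> \<le> int Y) \<and>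
     (\<forall>j<N. \<nu> (\<lambda>i. real_of_int (u j i)) = \<nu> (\<lambda>i. real (y i))) \<and>
     1000 * card {B \<in> Pow {..<N}. real Y * noise_bound < \<nu> (\<lambda>i. real_of_int (block_sum u B i))} \<le> 2 ^ N"
proof -
  have "\<exists>\<pi>. (\<forall>j<N. \<pi> j permutes {..<k}) \<and>
      (\<forall>a<k. \<forall>b<k. (\<Sum>j<N. (real (y (\<pi> j a)))\<^sup>2) \<le> (\<Sum>j<N. (real (y (\<pi> j b)))\<^sup>2) + (real Y)\<^sup>2)"
    by (rule balanced_permutations) (use y in \<open>auto intro: power_mono\<close>)
  then obtain \<pi> where "\<forall>j<N. \<pi> j permutes {..<k}"
    "\<forall>a<k. \<forall>b<k. (\<Sum>j<N. (real (y (\<pi> j a)))\<^sup>2) \<le> (\<Sum>j<N. (real (y (\<pi> j b)))\<^sup>2) + (real Y)\<^sup>2"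
    by (elim exE conjE)
  then have \<pi>: "\<And>j. j < N \<Longrightarrow> \<pi> j permutes {..<k}"
    and bal: "\<And>a b. a < k \<Longrightarrow> b < k \<Longrightarrow>
      (\<Sum>j<N. (real (y (\<pi> j a)))\<^sup>2) \<le> (\<Sum>j<N. (real (y (\<pi> j b)))\<^sup>2) + (real Y)\<^sup>2"
    by simp_all
  \<comment> \<open>The mean load of a coordinate is at most the square of \<open>Y\<close> by the
    hypothesis on \<open>N\<close>, and two loads differ by at most as much.\<close>
  have load: "(\<Sum>j<N. (real (y (\<pi> j a)))\<^sup>2) \<le> 2 * (real Y)\<^sup>2" if a: "a < k" for a
  proof -
    have "real k * (\<Sum>j<N. (real (y (\<pi> j a)))\<^sup>2) = (\<Sum>b<k. \<Sum>j<N. (real (y (\<pi> j a)))\<^sup>2)" by simp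
    also have "\<dots> \<le> (\<Sum>b<k. (\<Sum>j<N. (real (y (\<pi> j b)))\<^sup>2) + (real Y)\<^sup>2)"
      using a by (intro sum_mono bal) auto
    also have "\<dots> = (\<Sum>j<N. \<Sum>b<k. (real (y (\<pi> j b)))\<^sup>2) + real k * (real Y)\<^sup>2"
      by (simp add: sum.distrib sum.swap [of _ "{..<k}"])
    also have "(\<Sum>j<N. \<Sum>b<k. (real (y (\<pi> j b)))\<^sup>2) = (\<Sum>j<N. \<Sum>b<k. (real (y b))\<^sup>2)"
      using \<pi> by (intro sum.cong refl sum.permute [symmetric, unfolded o_def]) auto
    also have "\<dots> \<le> real k * (real Y)\<^sup>2" using N by simp
    finally have "real k * (\<Sum>j<N. (real (y (\<pi> j a)))\<^sup>2) \<le> real k * (2 * (real Y)\<^sup>2)" by simp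
    then show ?thesis using zero_less_k by (subst (asm) mult_le_cancel_left_pos) auto
  qed
  define P where "P = Pi_pmf {..<k} (\<lambda>_. 0) (\<lambda>_. Pi_pmf {..<N} 0 (\<lambda>_. pmf_of_set {-1, 1 :: real}))"
  define c where "c B j i = (if j \<in> B then real (y (\<pi> j i)) else 0)" for B :: "nat set" and j i
  define bad where "bad B e \<longleftrightarrow> real Y * noise_bound < \<nu> (\<lambda>i. \<Sum>j<N. e i j * c B j i)" for B and e :: "nat \<Rightarrow> nat \<Rightarrow> real"
  have bad_prob: "measure_pmf.prob P {e. bad B e} \<le> 1/1000" for B
    unfolding bad_def P_def
  proof (rule noise_prob)
    fix i assume "i < k"
    have "(\<Sum>j<N. (c B j i)\<^sup>2) \<le> (\<Sum>j<N. (real (y (\<pi> j i)))\<^sup>2)"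
      by (intro sum_mono) (simp add: c_def)
    also have "\<dots> \<le> 2 * (real Y)\<^sup>2" using \<open>i < k\<close> by (rule load)
    finally show "(\<Sum>j<N. (c B j i)\<^sup>2) \<le> 2 * (real Y)\<^sup>2" .
  qed (use Y in auto)
  define cnt where "cnt e = card {B \<in> Pow {..<N}. bad B e}" for e
  have cnt_eq: "real (cnt e) = (\<Sum>B\<in>Pow {..<N}. indicator {e. bad B e} e)" for e
    unfolding cnt_def by (simp add: indicator_def of_bool_def sum.If_cases Int_def)
  \<comment> \<open>On average over the signs at most a thousandth of all subsets is bad, so some
    choice of signs does as well.\<close>
  have "measure_pmf.expectation P (\<lambda>e. real (cnt e)) = (\<Sum>B\<in>Pow {..<N}. measure_pmf.prob P {e. bad B e})"
    unfolding cnt_eq by (subst Bochner_Integration.integral_sum) (auto intro: integrable_bounded_pmf)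
  also have "\<dots> \<le> (\<Sum>B\<in>Pow {..<N}. 1/1000)" by (intro sum_mono bad_prob)
  finally have Ecnt: "measure_pmf.expectation P (\<lambda>e. real (cnt e)) \<le> 2 ^ N / 1000" by (simp add: card_Pow)
  have "\<exists>e\<in>set_pmf P. 1000 * cnt e \<le> 2 ^ N"
  proof (rule ccontr)
    assume "\<not> ?thesis"
    then have *: "2 ^ N + 1 \<le> 1000 * cnt e" if "e \<in> set_pmf P" for e using that by force
    have ae: "AE e in P. (2 ^ N + 1) / 1000 \<le> real (cnt e)"
    proof (rule AE_pmfI)
      fix e assume "e \<in> set_pmf P"
      from * [OF this] have "real (2 ^ N + 1) \<le> real (1000 * cnt e)" by (simp only: of_nat_le_iff)
      then show "(2 ^ N + 1) / 1000 \<le> real (cnt e)" by simp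
    qed
    have "integrable (measure_pmf P) (\<lambda>e. real (cnt e))"
      unfolding cnt_eq by (intro Bochner_Integration.integrable_sum integrable_bounded_pmf)
    then have "(2 ^ N + 1) / 1000 \<le> measure_pmf.expectation P (\<lambda>e. real (cnt e))"
      using ae by (intro measure_pmf.integral_ge_const)
    then show False using Ecnt by simp
  qed
  then obtain e where e: "e \<in> set_pmf P" "1000 * cnt e \<le> 2 ^ N" by blast
  have sign: "e i j \<in> {-1, 1}" if "i < k" "j < N" for i j
  proof -
    have "e i \<in> set_pmf (Pi_pmf {..<N} 0 (\<lambda>_. pmf_of_set {-1, 1 :: real}))"
      using e(1) that unfolding P_def by (subst (asm) set_Pi_pmf) (auto simp: PiE_dflt_def)
    then show ?thesis using that by (subst (asm) set_Pi_pmf) (auto simp: PiE_dflt_def)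
  qed
  define u where "u j i = (if i < k \<and> j < N then (if e i j = 1 then int (y (\<pi> j i)) else - int (y (\<pi> j i))) else 0)" for j i
  have u_real: "real_of_int (u j i) = e i j * real (y (\<pi> j i))" if "i < k" "j < N" for i j
    using sign [OF that] that by (auto simp: u_def)
  have pi_lt: "\<pi> j i < k" if "i < k" "j < N" for i j
    using permutes_in_image [OF \<pi> [OF that(2)], of i] that(1) by simp
  have "\<nu> (\<lambda>i. real_of_int (u j i)) = \<nu> (\<lambda>i. real (y i))" if "j < N" for j
  proof -
    have "\<nu> (\<lambda>i. real_of_int (u j i)) = \<nu> (\<lambda>i. real (y (\<pi> j i)))"
      using that by (intro nu_abs_cong) (auto simp: u_def)
    also have "\<dots> = \<nu> (\<lambda>i. real (y i))" using nu_perm [OF \<pi> [OF that], of "\<lambda>i. real (y i)"] .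
    finally show ?thesis .
  qed
  moreover have "\<bar>u j i\<bar> \<le> int Y" for j i
    using y [OF pi_lt, of i j] by (auto simp: u_def)
  moreover have "{B \<in> Pow {..<N}. real Y * noise_bound < \<nu> (\<lambda>i. real_of_int (block_sum u B i))} = {B \<in> Pow {..<N}. bad B e}"
  proof (intro Collect_cong conj_cong refl)
    fix B assume "B \<in> Pow {..<N}"
    then have B: "B \<subseteq> {..<N}" by simp
    have "\<nu> (\<lambda>i. real_of_int (block_sum u B i)) = \<nu> (\<lambda>i. \<Sum>j<N. e i j * c B j i)"
    proof (rule nu_cong)
      fix i assume i: "i < k"
      have "real_of_int (block_sum u B i) = (\<Sum>j\<in>B. e i j * c B j i)"
        unfolding block_sum_def of_int_sum using B i by (intro sum.cong refl) (auto simp: u_real c_def)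
      also have "\<dots> = (\<Sum>j<N. e i j * c B j i)"
        using B by (intro sum.mono_neutral_left) (auto simp: c_def)
      finally show "real_of_int (block_sum u B i) = (\<Sum>j<N. e i j * c B j i)" .
    qed
    then show "(real Y * noise_bound < \<nu> (\<lambda>i. real_of_int (block_sum u B i))) = bad B e" by (simp add: bad_def)
  qed
  ultimately show ?thesis
    using e(2) by (intro exI [of _ u]) (auto simp: u_def cnt_def)
qed

text \<open>The event \<open>X\<close>, an answer above \<open>D * T\<close>, separates the streams:
  the null vector mostly has norm at most \<open>T\<close>, while the planted one exceeds
  \<open>D * T\<close> with probability close to 1/2.\<close>

lemma game_lower_bound:
  fixes y :: "nat \<Rightarrow> nat" and Y N s :: nat
  assumes kn: "k \<le> n"
    and l: "\<And>x. (\<And>i. k \<le> i \<Longrightarrow> x i = 0) \<Longrightarrow> l (\<lambda>i\<in>{..<n}. x i) = \<nu> x"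
    and D: "D \<ge> 1" and approx: "approximates_norm n l D Bd A" and space: "uses_space n A S"
    and Y: "Y > 0" and y: "\<And>i. i < k \<Longrightarrow> y i \<le> Y"
    and N: "real N * (\<Sum>i<k. (real (y i))\<^sup>2) \<le> real k * (real Y)\<^sup>2"
    and s: "s \<ge> 1" "2 * (D + 1) * (real Y * noise_bound) < real s * \<nu> (\<lambda>i. real (y i))"
    and Bd: "(real N + real s) * real Y \<le> Bd"
  shows "real N * (1/5) \<le> 2 * real s ^ 2 * (real S + 1)"
proof -
  define T where "T = real Y * noise_bound"
  obtain u :: "nat \<Rightarrow> nat \<Rightarrow> int" where u0: "\<And>j i. k \<le> i \<Longrightarrow> u j i = 0" and uY: "\<And>j i. \<bar>u j i\<bar> \<le> int Y"
    and unu: "\<And>j. j < N \<Longrightarrow> \<nu> (\<lambda>i. real_of_int (u j i)) = \<nu> (\<lambda>i. real (y i))"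
    and bad: "1000 * card {B \<in> Pow {..<N}. T < \<nu> (\<lambda>i. real_of_int (block_sum u B i))} \<le> 2 ^ N"
    using exists_blocks [OF Y y N] unfolding T_def by blast
  have T0: "T \<ge> 0" using Med_pos by (simp add: T_def noise_bound_def)
  define w where "w v = \<nu> (\<lambda>i. real_of_int (v i))" for v :: "nat \<Rightarrow> int"
  define X where "X = {x. D * T < x}"
  have bs0: "block_sum u B i = 0" if "k \<le> i" for B i using u0 [OF that] by (simp add: block_sum_def)
  have bsY: "\<bar>real_of_int (block_sum u B i)\<bar> \<le> real N * real Y" if "B \<subseteq> {..<N}" for B i
  proof -
    have "\<bar>real_of_int (block_sum u B i)\<bar> \<le> (\<Sum>j\<in>B. real Y)"
      unfolding block_sum_def of_int_sum
    proof (rule sum_abs [THEN order_trans], intro sum_mono)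
      fix j show "\<bar>real_of_int (u j i)\<bar> \<le> real Y" using uY [of j i] by linarith
    qed
    also have "\<dots> = real (card B) * real Y" by simp
    also have "\<dots> \<le> real N * real Y"
      using card_mono [OF _ that] by (intro mult_right_mono) auto
    finally show ?thesis .
  qed
  have answer_prob: "measure_pmf.prob (alg_output A \<sigma>) {x. is_approx D (w (stream_vec \<sigma>)) x} \<ge> 99/100"
    if "\<sigma> \<in> turnstile_streams n" "\<And>i. k \<le> i \<Longrightarrow> stream_vec \<sigma> i = 0" "\<And>i. \<bar>real_of_int (stream_vec \<sigma> i)\<bar> \<le> Bd" for \<sigma>
  proof -
    have "l (\<lambda>i\<in>{..<n}. real_of_int (stream_vec \<sigma> i)) = w (stream_vec \<sigma>)"
      unfolding w_def using that(2) by (intro l) simp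
    then show ?thesis
      using approx that(1,3) unfolding approximates_norm_def by auto
  qed
  \<comment> \<open>Subsets avoiding \<open>j\<close> are half of all subsets, so the fraction of
    bad ones may double.\<close>
  have bad_prob: "measure_pmf.prob (unif_subset ({..<N} - {j})) {B. T < w (block_sum u B)} \<le> 2/1000" if j: "j < N" for j
  proof -
    have "card (Pow ({..<N} - {j}) \<inter> {B. T < w (block_sum u B)}) \<le> card {B \<in> Pow {..<N}. T < \<nu> (\<lambda>i. real_of_int (block_sum u B i))}"
      by (intro card_mono) (auto simp: w_def)
    with bad have "1000 * card (Pow ({..<N} - {j}) \<inter> {B. T < w (block_sum u B)}) \<le> 2 ^ N" by linarith
    then have 1: "real (1000 * card (Pow ({..<N} - {j}) \<inter> {B. T < w (block_sum u B)})) \<le> real (2 ^ N)" by (simp only: of_nat_le_iff)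
    define m where "m = card ({..<N} - {j})"
    have "card {..<N} = Suc m" unfolding m_def using j by (intro card.remove) auto
    then have "N = Suc m" by simp
    then have 2: "(2::real) ^ N = 2 * 2 ^ m" by (simp only: power_Suc)
    have "card (Pow ({..<N} - {j})) = 2 ^ m" unfolding m_def by (rule card_Pow) simp
    then show ?thesis
      using 1 by (subst measure_pmf_of_set) (auto simp: 2 divide_le_eq)
  qed
  have null: "measure_pmf.prob (bind_pmf (rstream n u (\<lambda>p. stage_blocks N P p - {j}) s) (alg_output A)) X \<le> 2/1000 + 1/100"
    if j: "j < N" and P: "P \<in> {..<N} \<rightarrow>\<^sub>E {..<s}" for j P
  proof (rule prob_bind_pmf_le [where P = "\<lambda>\<sigma>. T < w (stream_vec \<sigma>)"])
    let ?rs = "rstream n u (\<lambda>p. stage_blocks N P p - {j}) s"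
    have law: "map_pmf stream_vec ?rs = block_law u ({..<N} - {j})"
      using null_vector_law [OF P, of u j] u0 kn by (subst rstream_vector_law) auto
    have "measure_pmf.prob ?rs {\<sigma>. T < w (stream_vec \<sigma>)} = measure_pmf.prob (map_pmf stream_vec ?rs) {v. T < w v}"
      by (simp add: vimage_def)
    also have "\<dots> = measure_pmf.prob (unif_subset ({..<N} - {j})) {B. T < w (block_sum u B)}"
      unfolding law block_law_def by (simp add: vimage_def)
    also have "\<dots> \<le> 2/1000" by (rule bad_prob [OF j])
    finally show "measure_pmf.prob ?rs {\<sigma>. T < w (stream_vec \<sigma>)} \<le> 2/1000" .
    fix \<sigma> assume \<sigma>: "\<sigma> \<in> set_pmf ?rs" "\<not> T < w (stream_vec \<sigma>)"
    have "stream_vec \<sigma> \<in> set_pmf (map_pmf stream_vec ?rs)" using \<sigma>(1) by simp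
    then obtain B where B: "B \<subseteq> {..<N}" "stream_vec \<sigma> = block_sum u B"
      unfolding law by (auto simp: block_law_def)
    have "measure_pmf.prob (alg_output A \<sigma>) {x. is_approx D (w (stream_vec \<sigma>)) x} \<ge> 99/100"
    proof (rule answer_prob)
      show "\<sigma> \<in> turnstile_streams n" using \<sigma>(1) by (rule rstream_in_streams)
      fix i
      have "\<bar>real_of_int (stream_vec \<sigma> i)\<bar> \<le> real N * real Y" using bsY [OF B(1)] B(2) by simp
      also have "\<dots> \<le> (real N + real s) * real Y" by (intro mult_right_mono) auto
      finally show "\<bar>real_of_int (stream_vec \<sigma> i)\<bar> \<le> Bd" using Bd by simp
    qed (use B bs0 in simp)
    also have "measure_pmf.prob (alg_output A \<sigma>) {x. is_approx D (w (stream_vec \<sigma>)) x} \<le> measure_pmf.prob (alg_output A \<sigma>) (UNIV - X)"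
    proof (rule measure_pmf.finite_measure_mono)
      have "D * w (stream_vec \<sigma>) \<le> D * T" using \<sigma>(2) D by (intro mult_left_mono) auto
      then show "{x. is_approx D (w (stream_vec \<sigma>)) x} \<subseteq> UNIV - X" by (auto simp: is_approx_def X_def)
    qed simp
    also have "\<dots> = 1 - measure_pmf.prob (alg_output A \<sigma>) X"
      using measure_pmf.prob_compl [of X "alg_output A \<sigma>"] by simp
    finally show "measure_pmf.prob (alg_output A \<sigma>) X \<le> 1/100" by simp
  qed simp
  have planted: "measure_pmf.prob (bind_pmf (rstream n u (\<lambda>p. insert j (stage_blocks N P p)) s) (alg_output A)) X \<ge> 499/1000 * (99/100)"
    if j: "j < N" and P: "P \<in> {..<N} \<rightarrow>\<^sub>E {..<s}" for j P
  proof (rule prob_bind_pmf_ge [where P = "\<lambda>\<sigma>. D * T < w (stream_vec \<sigma>)"])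
    let ?rs = "rstream n u (\<lambda>p. insert j (stage_blocks N P p)) s"
    let ?v = "\<lambda>B Z i. block_sum u B i + int (card Z) * u j i"
    have law: "map_pmf stream_vec ?rs = bind_pmf (unif_subset ({..<N} - {j})) (\<lambda>B. map_pmf (?v B) (unif_subset {N..<N + s}))"
      using planted_vector_law [OF j P, of u] u0 kn by (subst rstream_vector_law) auto
    have "measure_pmf.prob (map_pmf stream_vec ?rs) {v. D * T < w v} \<ge> 998/1000 * (1/2)"
      unfolding law
    proof (rule prob_bind_pmf_ge [where P = "\<lambda>B. \<not> T < w (block_sum u B)"])
      have "measure_pmf.prob (unif_subset ({..<N} - {j})) {B. \<not> T < w (block_sum u B)} = 1 - measure_pmf.prob (unif_subset ({..<N} - {j})) {B. T < w (block_sum u B)}"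
        using measure_pmf.prob_compl [of "{B. T < w (block_sum u B)}" "unif_subset ({..<N} - {j})"] by (simp add: Collect_neg_eq Compl_eq_Diff_UNIV)
      then show "998/1000 \<le> measure_pmf.prob (unif_subset ({..<N} - {j})) {B. \<not> T < w (block_sum u B)}"
        using bad_prob [OF j] by simp
      fix B assume good: "\<not> T < w (block_sum u B)"
      have "1/2 \<le> measure_pmf.prob (unif_subset {N..<N + s}) {Z. card {N..<N + s} \<le> 2 * card Z}"
        by (rule prob_unif_subset_half) simp
      also have "\<dots> \<le> measure_pmf.prob (unif_subset {N..<N + s}) (?v B -` {v. D * T < w v})"
      proof (rule measure_pmf.finite_measure_mono)
        show "{Z. card {N..<N + s} \<le> 2 * card Z} \<subseteq> ?v B -` {v. D * T < w v}"
        proof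
          fix Z assume "Z \<in> {Z. card {N..<N + s} \<le> 2 * card Z}"
          then have Z: "real s \<le> 2 * real (card Z)" by simp
          \<comment> \<open>The copies of block \<open>j\<close> are the final vector minus the
            noise; the noise has norm at most \<open>T\<close>, and \<open>s / 2\<close> copies have
            norm above \<open>(D + 1) * T\<close>.\<close>
          have "real (card Z) * \<nu> (\<lambda>i. real (y i)) = \<nu> (\<lambda>i. real (card Z) * real_of_int (u j i))"
            using unu [OF j] by (simp add: nu_scale)
          also have "\<dots> = \<nu> (\<lambda>i. real_of_int (?v B Z i) + - real_of_int (block_sum u B i))" by simp
          also have "\<dots> \<le> w (?v B Z) + \<nu> (\<lambda>i. - real_of_int (block_sum u B i))" unfolding w_def by (rule nu_add)
          also have "\<nu> (\<lambda>i. - real_of_int (block_sum u B i)) = w (block_sum u B)" unfolding w_def by (rule nu_uminus)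
          also have "\<dots> \<le> T" using good by simp
          finally have 1: "real (card Z) * \<nu> (\<lambda>i. real (y i)) \<le> w (?v B Z) + T" by simp
          have "real s * \<nu> (\<lambda>i. real (y i)) \<le> 2 * real (card Z) * \<nu> (\<lambda>i. real (y i))"
            using Z nu_nonneg by (intro mult_right_mono) auto
          with 1 s(2) have "2 * (D + 1) * T < 2 * (w (?v B Z) + T)" by (simp add: T_def)
          then show "Z \<in> ?v B -` {v. D * T < w v}" by (simp add: algebra_simps)
        qed
      qed simp
      finally show "1/2 \<le> measure_pmf.prob (map_pmf (?v B) (unif_subset {N..<N + s})) {v. D * T < w v}" by simp
    qed simp
    then show "499/1000 \<le> measure_pmf.prob ?rs {\<sigma>. D * T < w (stream_vec \<sigma>)}"
      by (simp add: vimage_def)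
    fix \<sigma> assume \<sigma>: "\<sigma> \<in> set_pmf ?rs" "D * T < w (stream_vec \<sigma>)"
    have "stream_vec \<sigma> \<in> set_pmf (map_pmf stream_vec ?rs)" using \<sigma>(1) by simp
    then obtain B Z where BZ: "B \<subseteq> {..<N}" "Z \<subseteq> {N..<N + s}" "stream_vec \<sigma> = ?v B Z"
      unfolding law by auto
    have "99/100 \<le> measure_pmf.prob (alg_output A \<sigma>) {x. is_approx D (w (stream_vec \<sigma>)) x}"
    proof (rule answer_prob)
      show "\<sigma> \<in> turnstile_streams n" using \<sigma>(1) by (rule rstream_in_streams)
      fix i
      have "card Z \<le> s" using card_mono [OF _ BZ(2)] by simp
      moreover have "\<bar>real_of_int (u j i)\<bar> \<le> real Y" using uY [of j i] by linarith
      ultimately have "real (card Z) * \<bar>real_of_int (u j i)\<bar> \<le> real s * real Y" by (intro mult_mono) auto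
      then have "\<bar>real_of_int (stream_vec \<sigma> i)\<bar> \<le> real N * real Y + real s * real Y"
        using bsY [OF BZ(1), of i] unfolding BZ(3)
        by (auto intro!: order_trans [OF abs_triangle_ineq] add_mono simp: abs_mult)
      then show "\<bar>real_of_int (stream_vec \<sigma> i)\<bar> \<le> Bd" using Bd by (simp add: algebra_simps)
      show "k \<le> i \<Longrightarrow> stream_vec \<sigma> i = 0" using BZ(3) bs0 u0 by simp
    qed
    also have "\<dots> \<le> measure_pmf.prob (alg_output A \<sigma>) X"
      using \<sigma>(2) by (intro measure_pmf.finite_measure_mono) (auto simp: X_def is_approx_def)
    finally show "99/100 \<le> measure_pmf.prob (alg_output A \<sigma>) X" .
  qed simp
  \<comment> \<open>Planted: 998/1000 for small noise, 1/2 for enough copies, 99/100 for a correct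
    answer. Null: 2/1000 for large noise plus 1/100 for a wrong answer. Half of the former product
    minus the latter sum is about 0.235.\<close>
  have "real N * (1/5) \<le> real N * (499/1000 * (99/100) / 2 - (2/1000 + 1/100))"
    by (intro mult_left_mono) auto
  also have "\<dots> \<le> 2 * real s ^ 2 * (real S + 1)"
    by (rule space_lower_bound [OF space s(1) null planted])
  finally show ?thesis .
qed

section \<open>An integer near-maximiser and the choice of parameters\<close>

lemma unit_sphere_coordinate_le: "x \<in> unit_sphere k \<Longrightarrow> i < k \<Longrightarrow> \<bar>x i\<bar> \<le> 1"
  using member_le_L2_set [of "{..<k}" i "\<lambda>i. \<bar>x i\<bar>"] by (auto simp: unit_sphere_def L2_set_def)

lemma unit_sphere_bound: "x \<in> unit_sphere k \<Longrightarrow> \<nu> x \<le> \<nu> unit_vec * real k"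
proof -
  assume x: "x \<in> unit_sphere k"
  have "\<nu> x \<le> \<nu> unit_vec * (\<Sum>i<k. \<bar>x i\<bar>)" by (rule nu_le_sum)
  also have "(\<Sum>i<k. \<bar>x i\<bar>) \<le> (\<Sum>i<k. 1)" using unit_sphere_coordinate_le [OF x] by (intro sum_mono) auto
  then have "\<nu> unit_vec * (\<Sum>i<k. \<bar>x i\<bar>) \<le> \<nu> unit_vec * real k"
    using nu_nonneg by (intro mult_left_mono) auto
  finally show ?thesis .
qed

lemma unit_sphere_le_max: "x \<in> unit_sphere k \<Longrightarrow> \<nu> x \<le> max_sphere k \<nu>"
  unfolding max_sphere_def by (intro cSUP_upper bdd_aboveI2 [of _ _ "\<nu> unit_vec * real k"] unit_sphere_bound)

lemma ones_sphere: "(\<lambda>i\<in>{..<k}. 1 / sqrt (real k)) \<in> unit_sphere k"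
proof -
  have "L2_set (\<lambda>i\<in>{..<k}. 1 / sqrt (real k)) {..<k} = L2_set (\<lambda>i. 1 / sqrt (real k)) {..<k}"
    by (rule L2_set_restrict)
  also have "\<dots> = 1" using zero_less_k by (simp add: L2_set_def power_divide)
  finally show ?thesis by (simp add: unit_sphere_def)
qed

lemma ones_le_max: "\<nu> (\<lambda>_. 1) \<le> sqrt (real k) * max_sphere k \<nu>"
proof -
  have "\<nu> (\<lambda>i\<in>{..<k}. 1 / sqrt (real k)) = \<nu> (\<lambda>i. 1 / sqrt (real k) * 1)" by (rule nu_cong) simp
  also have "\<dots> = 1 / sqrt (real k) * \<nu> (\<lambda>_. 1)" by (subst nu_scale) simp
  finally have "1 / sqrt (real k) * \<nu> (\<lambda>_. 1) \<le> max_sphere k \<nu>"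
    using unit_sphere_le_max [OF ones_sphere] by simp
  then show ?thesis using zero_less_k by (simp add: field_simps)
qed

lemma ones_pos: "\<nu> (\<lambda>_. 1) > 0"
proof -
  have "\<nu> (\<lambda>_. 1) \<noteq> 0" using zero_less_k by (auto simp: nu_eq_0_iff)
  then show ?thesis using nu_nonneg [of "\<lambda>_. 1"] by linarith
qed

lemma max_sphere_pos: "max_sphere k \<nu> > 0"
  using ones_le_max ones_pos zero_less_k by (smt (verit) mult_nonneg_nonpos real_sqrt_ge_zero of_nat_0_le_iff)

text \<open>A sphere vector with norm above \<open>3/4 * b\<close> is scaled by \<open>4 * k\<close>
  and rounded down. Rounding costs at most the norm of the all-ones vector, which is at most
  \<open>sqrt k * b\<close>, so \<open>2 * k * b\<close> remains of
  \<open>3 * k * b\<close>.\<close>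

lemma exists_integer_maximizer:
  fixes b defines "b \<equiv> max_sphere k \<nu>"
  obtains y :: "nat \<Rightarrow> nat" where "2 * real k * b \<le> \<nu> (\<lambda>i. real (y i))"
    "\<And>i. i < k \<Longrightarrow> y i \<le> 4 * k" "(\<Sum>i<k. (real (y i))\<^sup>2) \<le> (4 * real k)\<^sup>2"
proof -
  have b: "b > 0" unfolding b_def by (rule max_sphere_pos)
  have "3/4 * b < (SUP x\<in>unit_sphere k. \<nu> x)" using b unfolding b_def max_sphere_def by simp
  then obtain x where x: "x \<in> unit_sphere k" "3/4 * b < \<nu> x"
    using ones_sphere by (subst (asm) less_cSUP_iff) (auto intro: bdd_aboveI2 [of _ _ "\<nu> unit_vec * real k"] unit_sphere_bound)
  define y where "y i = nat \<lfloor>4 * real k * \<bar>x i\<bar>\<rfloor>" for i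
  have y: "real (y i) \<le> 4 * real k * \<bar>x i\<bar>" "4 * real k * \<bar>x i\<bar> - real (y i) \<le> 1" for i
  proof -
    have "0 \<le> 4 * real k * \<bar>x i\<bar>" by simp
    then have "real (y i) = real_of_int \<lfloor>4 * real k * \<bar>x i\<bar>\<rfloor>" unfolding y_def by simp
    then show "real (y i) \<le> 4 * real k * \<bar>x i\<bar>" "4 * real k * \<bar>x i\<bar> - real (y i) \<le> 1" by linarith+
  qed
  show thesis
  proof
    have "4 * real k * (3/4 * b) \<le> 4 * real k * \<nu> x" using x(2) by (intro mult_left_mono) auto
    also have "\<dots> = \<nu> (\<lambda>i. 4 * real k * \<bar>x i\<bar>)" using nu_scale [of "4 * real k" "\<lambda>i. \<bar>x i\<bar>"] by (simp add: nu_abs)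
    also have "\<dots> \<le> \<nu> (\<lambda>i. real (y i)) + \<nu> (\<lambda>i. 4 * real k * \<bar>x i\<bar> - real (y i))" by (rule nu_diff_le)
    also have "\<nu> (\<lambda>i. 4 * real k * \<bar>x i\<bar> - real (y i)) \<le> \<nu> (\<lambda>_. 1)"
      using y by (intro nu_mono) auto
    also have "\<nu> (\<lambda>_. 1) \<le> sqrt (real k) * b" unfolding b_def by (rule ones_le_max)
    also have "\<dots> \<le> real k * b"
      using b k_pos by (intro mult_right_mono) (auto intro!: real_le_lsqrt simp: power2_eq_square)
    finally show "2 * real k * b \<le> \<nu> (\<lambda>i. real (y i))" by (simp add: algebra_simps)
    show "y i \<le> 4 * k" if "i < k" for i
    proof -
      have "real (y i) \<le> 4 * real k * \<bar>x i\<bar>" by (rule y(1))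
      also have "\<dots> \<le> 4 * real k * 1"
        using unit_sphere_coordinate_le [OF x(1) that] by (intro mult_left_mono) auto
      finally show ?thesis by linarith
    qed
    have "(\<Sum>i<k. (real (y i))\<^sup>2) \<le> (\<Sum>i<k. (4 * real k * \<bar>x i\<bar>)\<^sup>2)"
      using y(1) by (intro sum_mono power_mono) auto
    also have "\<dots> = (4 * real k)\<^sup>2 * (L2_set x {..<k})\<^sup>2"
      by (simp add: L2_set_def power_mult_distrib sum_distrib_left [symmetric] sum_nonneg)
    also have "L2_set x {..<k} = 1" using x(1) by (simp add: unit_sphere_def)
    finally show "(\<Sum>i<k. (real (y i))\<^sup>2) \<le> (4 * real k)\<^sup>2" by simp
  qed
qed

text \<open>The hypothesis \<open>nontrivial\<close> keeps the number of stages below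
  \<open>k / 2\<close>, so that the planted vectors respect the bound on the coordinates.\<close>

lemma nontrivial_space_bound:
  assumes kn: "k \<le> n"
    and l: "\<And>x. (\<And>i. k \<le> i \<Longrightarrow> x i = 0) \<Longrightarrow> l (\<lambda>i\<in>{..<n}. x i) = \<nu> x"
    and D: "D \<ge> 1" and approx: "approximates_norm n l D (real n powr 5) A" and space: "uses_space n A S" and S: "S \<ge> 1"
    and nontrivial: "10 ^ 5 * D * Med < max_sphere k \<nu>"
  shows "(max_sphere k \<nu> / Med)\<^sup>2 / (10 ^ 10 * D\<^sup>2) \<le> real S"
proof -
  define b where "b = max_sphere k \<nu>"
  have b: "b > 0" unfolding b_def by (rule max_sphere_pos)
  obtain y :: "nat \<Rightarrow> nat" where y: "2 * real k * b \<le> \<nu> (\<lambda>i. real (y i))"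
    "\<And>i. i < k \<Longrightarrow> y i \<le> 4 * k" "(\<Sum>i<k. (real (y i))\<^sup>2) \<le> (4 * real k)\<^sup>2"
    using exists_integer_maximizer unfolding b_def by blast
  define v E Y \<tau> where "v = \<nu> (\<lambda>i. real (y i))" and "E = (\<Sum>i<k. (real (y i))\<^sup>2)"
    and "Y = Max (y ` {..<k})" and "\<tau> = noise_bound"
  have kr: "real k \<ge> 1" using k_pos by simp
  have v: "v > 0" using y(1) b kr unfolding v_def by (smt (verit) mult_pos_pos)
  have tau: "\<tau> > 0" using Med_pos kr by (simp add: \<tau>_def noise_bound_def)
  have ne: "y ` {..<k} \<noteq> {}" using zero_less_k by auto
  have yY: "y i \<le> Y" if "i < k" for i unfolding Y_def using that by (intro Max_ge) auto
  obtain i0 where i0: "i0 < k" "Y = y i0" using Max_in [OF _ ne] unfolding Y_def by auto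
  have "v \<noteq> 0" using v by simp
  then obtain i1 where "i1 < k" "y i1 \<noteq> 0" unfolding v_def nu_eq_0_iff by auto
  then have Y: "Y > 0" using yY [of i1] by simp
  have Y4: "real Y \<le> 4 * real k" using y(2) [OF i0(1)] i0(2) by simp
  have EY: "(real Y)\<^sup>2 \<le> E" unfolding E_def i0(2) using i0(1) by (intro member_le_sum) auto
  have E: "E > 0" using EY Y by (smt (verit) of_nat_0_less_iff zero_less_power)
  define q where "q = real Y * \<tau> / v"
  \<comment> \<open>The 5 is 1280 / 256. It makes \<open>q\<close> large enough for the rounding in
    \<open>s\<close> to cost only a constant factor.\<close>
  have v_le: "5 * v \<le> real Y * \<tau>"
  proof -
    have "v \<le> \<nu> (\<lambda>i. real Y * 1)" unfolding v_def using yY by (intro nu_mono) auto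
    also have "\<dots> = real Y * \<nu> (\<lambda>_. 1)" by (subst nu_scale) simp
    also have "\<dots> \<le> real Y * (256 * (sqrt (real k) * Med))" by (intro mult_left_mono nu_ones_le) simp
    also have "\<dots> = real Y * \<tau> / 5" by (simp add: \<tau>_def noise_bound_def)
    finally show ?thesis by simp
  qed
  then have q: "q \<ge> 5" using v by (simp add: q_def pos_le_divide_eq)
  \<comment> \<open>The least integer beyond the threshold of \<open>game_lower_bound\<close>;
    \<open>q\<close> is the noise level measured in norms of a single block.\<close>
  define s where "s = nat \<lfloor>2 * (D + 1) * q\<rfloor> + 1"
  have s_gt: "real s > 2 * (D + 1) * q" and s_le: "real s \<le> 2 * (D + 1) * q + 1"
    using D q unfolding s_def by (auto simp: of_nat_nat mult_nonneg_nonneg) linarith+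
  have Dq: "1 * q \<le> D * q" using D q by (intro mult_right_mono) auto
  have expand: "2 * (D + 1) * q = 2 * (D * q) + 2 * q" by (simp add: algebra_simps)
  have s5: "real s \<le> 5 * (D * q)"
    using s_le Dq q unfolding expand by linarith
  \<comment> \<open>From \<open>Y \<le> 4 * k\<close> and \<open>v \<ge> 2 * k * b\<close> the ratio
    \<open>b * Y / v\<close> is at most 2, and \<open>nontrivial\<close> trades
    \<open>D * Med\<close> for \<open>b\<close>.\<close>
  have Dq_le: "D * q * 10 ^ 5 \<le> 2560 * sqrt (real k)"
  proof -
    have "D * q * 10 ^ 5 = (10 ^ 5 * D * Med) * (1280 * real Y * sqrt (real k) / v)"
      by (simp add: q_def \<tau>_def noise_bound_def)
    also have "\<dots> \<le> b * (1280 * real Y * sqrt (real k) / v)"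
      using nontrivial v by (intro mult_right_mono) (auto simp: b_def)
    also have "\<dots> = (1280 * sqrt (real k)) * (b * real Y) / v" by simp
    also have "\<dots> \<le> (1280 * sqrt (real k)) * (2 * v) / v"
    proof (intro divide_right_mono mult_left_mono)
      have "b * real Y \<le> b * (4 * real k)" using b Y4 by (intro mult_left_mono) auto
      also have "\<dots> \<le> 2 * v" using y(1) by (simp add: v_def mult_ac)
      finally show "b * real Y \<le> 2 * v" .
    qed (use v in auto)
    also have "\<dots> = 2560 * sqrt (real k)" using v by simp
    finally show ?thesis .
  qed
  have sqrt_le: "sqrt (real k) \<le> real k" using kr by (intro real_le_lsqrt) (auto simp: power2_eq_square)
  have sk: "real s \<le> real k / 2" using s5 Dq_le sqrt_le by simp
  have k2: "k \<ge> 2" using sk by (simp add: s_def)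
  \<comment> \<open>The largest number of blocks whose mean load per coordinate stays within the
    square of \<open>Y\<close>. As the quotient is at least 1, rounding down at most halves
    it.\<close>
  define N where "N = nat \<lfloor>real k * (real Y)\<^sup>2 / E\<rfloor>"
  have ratio: "real k * (real Y)\<^sup>2 / E \<ge> 1"
  proof -
    have "E \<le> (\<Sum>i<k. (real Y)\<^sup>2)" unfolding E_def using yY by (intro sum_mono power_mono) auto
    then show ?thesis using E by (simp add: le_divide_eq)
  qed
  have N_le: "real N \<le> real k * (real Y)\<^sup>2 / E" and N_ge: "real k * (real Y)\<^sup>2 / E \<le> 2 * real N"
  proof -
    have fl: "1 \<le> \<lfloor>real k * (real Y)\<^sup>2 / E\<rfloor>" using ratio by (simp only: le_floor_iff of_int_1)
    then have "real N = real_of_int \<lfloor>real k * (real Y)\<^sup>2 / E\<rfloor>" unfolding N_def by simp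
    then show "real N \<le> real k * (real Y)\<^sup>2 / E" "real k * (real Y)\<^sup>2 / E \<le> 2 * real N"
      using fl by linarith+
  qed
  have Nk: "real N \<le> real k"
  proof -
    have "real k * (real Y)\<^sup>2 / E \<le> real k * E / E" using E EY by (intro divide_right_mono mult_left_mono) auto
    then show ?thesis using N_le E by simp
  qed
  have game: "real N * (1/5) \<le> 2 * real s ^ 2 * (real S + 1)"
  proof (rule game_lower_bound [OF kn l D approx space Y yY])
    show "real N * (\<Sum>i<k. (real (y i))\<^sup>2) \<le> real k * (real Y)\<^sup>2"
      using N_le E by (simp add: E_def pos_le_divide_eq)
    show "2 * (D + 1) * (real Y * noise_bound) < real s * \<nu> (\<lambda>i. real (y i))"
      using s_gt v by (simp add: q_def v_def [symmetric] \<tau>_def [symmetric] pos_divide_less_eq)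
    \<comment> \<open>The entries are at most \<open>8 * k\<^sup>2\<close>, and for
      \<open>k \<ge> 2\<close> the factor 8 is at most \<open>k ^ 3\<close>: this is where the
      exponent 5 comes from.\<close>
    show "(real N + real s) * real Y \<le> real n powr 5"
    proof -
      have "(real N + real s) * real Y \<le> (2 * real k) * (4 * real k)"
        using Nk sk Y4 kr by (intro mult_mono) auto
      also have "\<dots> = 2 ^ 3 * (real k)\<^sup>2" by (simp add: power2_eq_square)
      also have "\<dots> \<le> real k ^ 3 * (real k)\<^sup>2" using k2 by (intro mult_right_mono power_mono) auto
      also have "\<dots> = real k ^ 5" by (simp add: power_add [symmetric])
      also have "\<dots> \<le> real n ^ 5" using kn by (intro power_mono) auto
      also have "\<dots> = real n powr 5" using kn k2 by (simp add: powr_numeral)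
      finally show ?thesis .
    qed
  qed (auto simp: s_def)
  define K where "K = 1638400 * real k * Med\<^sup>2"
  have K: "\<tau>\<^sup>2 = K" unfolding K_def \<tau>_def noise_bound_def by (simp add: power_mult_distrib)
  have Kpos: "K > 0" using Med_pos kr by (simp add: K_def)
  have "real k * (real Y)\<^sup>2 / E \<le> 20 * real s ^ 2 * (real S + 1)"
    using game N_ge by simp
  also have "\<dots> \<le> 20 * (5 * (D * q)) ^ 2 * (2 * real S)"
    using s5 S by (intro mult_mono power_mono) auto
  also have "\<dots> = 1000 * D\<^sup>2 * q\<^sup>2 * real S" by (simp add: power_mult_distrib)
  also have "q\<^sup>2 = (real Y)\<^sup>2 * K / v\<^sup>2" by (simp add: q_def power_mult_distrib power_divide K)
  finally have "(real Y)\<^sup>2 * (real k / E) \<le> (real Y)\<^sup>2 * (1000 * D\<^sup>2 * K / v\<^sup>2 * real S)"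
    by (simp add: mult_ac)
  then have "real k / E \<le> 1000 * D\<^sup>2 * K / v\<^sup>2 * real S"
    using Y by (subst (asm) mult_le_cancel_left_pos) auto
  then have "real k / E * (v\<^sup>2 * E) \<le> 1000 * D\<^sup>2 * K / v\<^sup>2 * real S * (v\<^sup>2 * E)"
    using E by (intro mult_right_mono) auto
  then have main: "real k * v\<^sup>2 \<le> 1000 * D\<^sup>2 * K * real S * E" using E v by simp
  have "real k * (2 * real k * b)\<^sup>2 \<le> real k * v\<^sup>2"
    using y(1) b by (intro mult_left_mono power_mono) (auto simp: v_def)
  also note main
  also have "1000 * D\<^sup>2 * K * real S * E \<le> 1000 * D\<^sup>2 * K * real S * (4 * real k)\<^sup>2"
    using y(3) Kpos by (intro mult_left_mono) (auto simp: E_def)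
  finally have "(real k)\<^sup>2 * real k * (4 * b\<^sup>2) \<le> (real k)\<^sup>2 * real k * (16000 * 1638400 * D\<^sup>2 * Med\<^sup>2 * real S)"
    by (simp add: power_mult_distrib K_def mult_ac)
  then have "4 * b\<^sup>2 \<le> 16000 * 1638400 * D\<^sup>2 * Med\<^sup>2 * real S"
    using kr by (subst (asm) mult_le_cancel_left_pos) auto
  \<comment> \<open>The product 16000 * 1638400 is about 2.6 * 10 ^ 10, below four times the
    constant of the theorem.\<close>
  also have "\<dots> \<le> 4 * (10 ^ 10 * D\<^sup>2 * Med\<^sup>2 * real S)"
  proof -
    have "0 \<le> D\<^sup>2 * Med\<^sup>2 * real S" by simp
    then show ?thesis by simp
  qed
  finally have "b\<^sup>2 \<le> real S * (10 ^ 10 * D\<^sup>2) * Med\<^sup>2" by (simp add: mult_ac)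
  then have "(b / Med)\<^sup>2 \<le> real S * (10 ^ 10 * D\<^sup>2)"
    using Med_pos by (simp add: power_divide divide_le_eq)
  then show ?thesis using D by (simp add: b_def divide_le_eq)
qed

end

section \<open>Restricted norms, algorithms without memory, and the conclusion\<close>

lemma sym_norm_norm_restr:
  assumes l: "symmetric_norm n l" and k: "1 \<le> k" "k \<le> n"
  shows "sym_norm k (norm_restr n l k)"
proof -
  define z where "z x = (\<lambda>i\<in>{..<n}. if i < k then x i else 0 :: real)" for x
  have zR: "z x \<in> Rn n" for x by (simp add: z_def)
  have eq: "norm_restr n l k x = l (z x)" for x by (simp add: norm_restr_def z_def)
  note norm = l [unfolded symmetric_norm_def norm_on_def]
  show ?thesis
  proof
    show "1 \<le> k" by fact
    show "norm_restr n l k x = norm_restr n l k y" if "\<And>i. i < k \<Longrightarrow> x i = y i" for x y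
      unfolding eq z_def using that by (intro arg_cong [where f = l]) (auto simp: fun_eq_iff)
    show "norm_restr n l k x = 0 \<longleftrightarrow> (\<forall>i<k. x i = 0)" for x
    proof -
      have "l (z x) = 0 \<longleftrightarrow> (\<forall>i<n. z x i = 0)" using norm zR by blast
      also have "\<dots> \<longleftrightarrow> (\<forall>i<k. x i = 0)" using k by (auto simp: z_def)
      finally show ?thesis by (simp add: eq)
    qed
    show "norm_restr n l k (\<lambda>i. a * x i) = \<bar>a\<bar> * norm_restr n l k x" for a x
    proof -
      have "z (\<lambda>i. a * x i) = (\<lambda>i\<in>{..<n}. a * z x i)" by (auto simp: z_def fun_eq_iff)
      then show ?thesis using norm zR by (simp add: eq)
    qed
    show "norm_restr n l k (\<lambda>i. x i + y i) \<le> norm_restr n l k x + norm_restr n l k y" for x y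
    proof -
      have "z (\<lambda>i. x i + y i) = (\<lambda>i\<in>{..<n}. z x i + z y i)" by (auto simp: z_def fun_eq_iff)
      then show ?thesis using norm zR by (simp add: eq)
    qed
    show "norm_restr n l k (\<lambda>i. x (p i)) = norm_restr n l k x" if p: "p permutes {..<k}" for p x
    proof -
      have pn: "p permutes {..<n}" by (rule permutes_subset [OF p]) (use k in auto)
      have "p i < k \<longleftrightarrow> i < k" "p i < n \<longleftrightarrow> i < n" for i
        using permutes_in_image [OF p, of i] permutes_in_image [OF pn, of i] by auto
      then have "z (\<lambda>i. x (p i)) = (\<lambda>i\<in>{..<n}. z x (p i))" by (auto simp: z_def fun_eq_iff)
      then show ?thesis using norm zR pn by (simp add: eq)
    qed
    show "norm_restr n l k (\<lambda>i. \<bar>x i\<bar>) = norm_restr n l k x" for x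
    proof -
      have "z (\<lambda>i. \<bar>x i\<bar>) = (\<lambda>i\<in>{..<n}. \<bar>z x i\<bar>)" by (auto simp: z_def fun_eq_iff)
      then show ?thesis using norm zR by (simp add: eq)
    qed
  qed
qed

text \<open>Without memory the empty stream and a single update get the same answers, but the zero
  vector admits only the answer 0 and a nonzero one only positive answers. This settles the case of
  small \<open>mmc\<close>, and in the other case it turns \<open>S + 1\<close> into
  \<open>2 * S\<close>.\<close>

lemma space_pos:
  assumes n: "n \<ge> 1" and l: "symmetric_norm n l" and B: "B \<ge> 1"
    and approx: "approximates_norm n l D B A" and space: "uses_space n A S"
  shows "S \<ge> 1"
proof (rule ccontr)
  assume "\<not> S \<ge> 1"
  then have S0: "S = 0" by simp
  have mem: "memory A r \<sigma> = return_pmf []" if "\<sigma> \<in> turnstile_streams n" "r \<in> set_pmf (seed A)" for \<sigma> r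
    using space that set_pmf_subset_singleton [of "memory A r \<sigma>" "[]"] by (auto simp: uses_space_def S0)
  define \<sigma> :: "update list" where "\<sigma> = [(0, 1)]"
  have \<sigma>: "\<sigma> \<in> turnstile_streams n" "[] \<in> turnstile_streams n" using n by (auto simp: \<sigma>_def turnstile_streams_def)
  have vec: "stream_vec \<sigma> i = (if i = 0 then 1 else 0)" for i by (auto simp: \<sigma>_def stream_vec_def)
  have same: "alg_output A \<sigma> = alg_output A []"
    unfolding alg_output_def using mem \<sigma> by (intro bind_pmf_cong) auto
  note norm = l [unfolded symmetric_norm_def norm_on_def]
  define x0 x1 where "x0 = (\<lambda>i\<in>{..<n}. real_of_int (stream_vec [] i))" and "x1 = (\<lambda>i\<in>{..<n}. real_of_int (stream_vec \<sigma> i))"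
  have R: "x0 \<in> Rn n" "x1 \<in> Rn n" by (simp_all add: x0_def x1_def)
  have l0: "l x0 = 0" using norm R(1) by (simp add: x0_def)
  have "l x1 \<noteq> 0" using norm R(2) n by (auto simp: x1_def vec)
  moreover have "l x1 \<ge> 0"
  proof -
    interpret sym_norm n "norm_restr n l n" using n by (intro sym_norm_norm_restr l) auto
    have "norm_restr n l n x1 = l x1" unfolding norm_restr_def using R(2)
      by (intro arg_cong [where f = l]) (auto simp: fun_eq_iff x1_def)
    then show ?thesis using nu_nonneg [of x1] by simp
  qed
  ultimately have l1: "l x1 > 0" by simp
  have p0: "measure_pmf.prob (alg_output A []) {y. is_approx D 0 y} \<ge> 99/100"
    using approx \<sigma>(2) B l0 unfolding approximates_norm_def x0_def by auto
  have p1: "measure_pmf.prob (alg_output A []) {y. is_approx D (l x1) y} \<ge> 99/100"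
    using approx \<sigma>(1) B unfolding approximates_norm_def x1_def by (auto simp: vec same)
  have "measure_pmf.prob (alg_output A []) ({y. is_approx D 0 y} \<union> {y. is_approx D (l x1) y})
     = measure_pmf.prob (alg_output A []) {y. is_approx D 0 y} + measure_pmf.prob (alg_output A []) {y. is_approx D (l x1) y}"
    using l1 by (intro measure_pmf.finite_measure_Union) (auto simp: is_approx_def)
  then show False using p0 p1 measure_pmf.prob_le_1 [of "alg_output A []" "{y. is_approx D 0 y} \<union> {y. is_approx D (l x1) y}"] by simp
qed

theorem theorem1p4:
  "\<exists>c C0 :: real. c > 0 \<and> C0 \<ge> 1 \<and>
     (\<forall>n \<ge> 1. \<forall>l. symmetric_norm n l \<longrightarrow>
       (\<forall>D \<ge> 1. \<forall>A. approximates_norm n l D (real n powr C0) A \<longrightarrow>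
         (\<forall>s. uses_space n A s \<longrightarrow> real s \<ge> c * (mmc n l)\<^sup>2 / D\<^sup>2)))"
proof (rule exI [of _ "1 / 10 ^ 10"], rule exI [of _ 5], intro conjI allI impI)
  fix n :: nat and l :: "rvec \<Rightarrow> real" and D :: real and A s
  assume n: "1 \<le> n" and l: "symmetric_norm n l" and D: "1 \<le> D"
    and approx: "approximates_norm n l D (real n powr 5) A" and space: "uses_space n A s"
  have "mmc n l \<in> (\<lambda>k. mc k (norm_restr n l k)) ` {1..n}"
    unfolding mmc_def using n by (intro Max_in) auto
  then obtain k where k: "1 \<le> k" "k \<le> n" and mmc: "mmc n l = mc k (norm_restr n l k)" by auto
  interpret sym_norm k "norm_restr n l k"
    using l k by (rule sym_norm_norm_restr)
  have mc: "mmc n l = max_sphere k (norm_restr n l k) / Med" by (simp add: mmc mc_def Med_def)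
  have s: "s \<ge> 1"
    using n by (intro space_pos [OF n l _ approx space]) (simp add: ge_one_powr_ge_zero)
  show "1 / 10 ^ 10 * (mmc n l)\<^sup>2 / D\<^sup>2 \<le> real s"
  proof (cases "10 ^ 5 * D * Med < max_sphere k (norm_restr n l k)")
    case True
    have lk: "l (\<lambda>i\<in>{..<n}. x i) = norm_restr n l k x" if "\<And>i. k \<le> i \<Longrightarrow> x i = 0" for x
      unfolding norm_restr_def using that by (intro arg_cong [where f = l]) (auto simp: fun_eq_iff)
    show ?thesis
      using nontrivial_space_bound [OF k(2) lk D approx space s True] by (simp add: mc)
  next
    \<comment> \<open>The claimed bound is at most 1 here: \<open>10 ^ 10\<close> is the square of
      the threshold \<open>10 ^ 5\<close> of the case distinction.\<close>
    case False
    then have "mmc n l \<le> 10 ^ 5 * D"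
      using Med_pos by (simp add: mc pos_divide_le_eq)
    moreover have "0 \<le> mmc n l" using max_sphere_pos Med_pos by (simp add: mc)
    ultimately have "(mmc n l)\<^sup>2 \<le> (10 ^ 5 * D)\<^sup>2" by (intro power_mono)
    then have "(mmc n l)\<^sup>2 \<le> 10 ^ 10 * D\<^sup>2" by (simp add: power_mult_distrib)
    then have "1 / 10 ^ 10 * (mmc n l)\<^sup>2 / D\<^sup>2 \<le> 1" using D by (simp add: divide_le_eq)
    then show ?thesis using s by simp
  qed
qed auto

end
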